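(* Let $d=2$ and consider a two-dimensional random walk with internal states satisfying the basic assumptions (i)–(iv). Assume that $\varepsilon_0$ is distributed according to the stationary measure $\mu$ and that third moments exist, i.e. $\sum_{y\in\mathbb{Z}^2}\|y\|^3A_y$ converges. Then $$E_2(n)=\frac{2\pi\sqrt{|\sigma|}\,n}{\log n}+O\left(\frac{n\log\log n}{\log^2 n}\right)\qquad(n\to\infty),$$ where $|\sigma|$ is the determinant of the covariance matrix $\sigma$.
   Context: Random walk with internal states (RWwIS). $E=\{1,\dots,s\}$ is a finite set, $d\ge1$ (here $d=2$), and $p_{y,j,k}\ge 0$ ($y\in\mathbb{Z}^d$, $j,k\in E$) satisfy $\sum_{y,k}p_{y,j,k}=1$ for each $j$. The RWwIS is the Markov chain $\xi_n=(\eta_n,\varepsilon_n)$ on $\mathbb{Z}^d\times E$ with $P(\xi_{n+1}=(x',k)\mid \xi_n=(x,j))=p_{x'-x,j,k}$; we start from $\eta_0=0$. Put $A_y=(p_{y,j,k})_{j,k}$, $Q=\sum_y A_y$, $M_l=\sum_y y_lA_y$, $\Sigma_{l,m}=\sum_y y_ly_mA_y$, $\underline{1}=(1,\dots,1)^T\in\mathbb{R}^s$. Basic assumptions: (i) the Markov chain $(\varepsilon_n)$ on $E$, whose transition matrix is $Q$, is irreducible and aperiodic; $\mu$ is its unique stationary distribution. (ii) Trivial arithmetic: for $j\in E$ the subgroup of $\mathbb{Z}^d$ generated by all differences $y-y'$ such that for some $n\geq 1$ both $P(\xi_n=(y,j)\mid\xi_0=(0,j))>0$ and $P(\xi_n=(y',j)\mid\xi_0=(0,j))>0$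 is $\mathbb{Z}^d$. (iii) Zero mean: $\langle\mu,M_l\underline{1}\rangle=0$ for all $l$. (iv) The second moments $\sum_y\|y\|^2A_y$ converge and the covariance matrix $\sigma=(\sigma_{l,m})_{1\le l,m\le d}$, $\sigma_{l,m}=\langle\mu,\Sigma_{l,m}\underline{1}\rangle-\langle\mu,M_l(Q-1)^{-1}M_m\underline{1}\rangle-\langle\mu,M_m(Q-1)^{-1}M_l\underline{1}\rangle$, is nonsingular (positive definite); here $(Q-1)^{-1}M_m\underline{1}$ is the unique vector $v$ with $\langle\mu,v\rangle=0$ and $Qv-v=M_m\underline{1}$. $L_d(n)=\#\{\eta_0,\dots,\eta_n\}$ is the number of distinct sites visited up to $n$ steps, and $E_d(n)$ is its expectation. *)

theory Defs
  imports "HOL-Probability.Probability" "HOL-Computational_Algebra.Group_Closure"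
begin

text \<open>
  The lattice is \<^typ>\<open>int ^ 'd\<close> and the finite set of internal states is a type \<open>'e::finite\<close>.
  The entry \<open>p y j k\<close> is the probability of moving by \<open>y\<close> while the internal state
  changes from \<open>j\<close> to \<open>k\<close>.
\<close>

type_synonym ('d, 'e) kernel = "int ^ 'd \<Rightarrow> 'e \<Rightarrow> 'e \<Rightarrow> real"

definition stochastic_kernel :: "('d::finite, 'e::finite) kernel \<Rightarrow> bool" where
  "stochastic_kernel p \<longleftrightarrow>
     (\<forall>y j k. p y j k \<ge> 0) \<and> (\<forall>j. ((\<lambda>(y, k). p y j k) has_sum 1) UNIV)"

definition lattice_norm :: "int ^ 'd::finite \<Rightarrow> real" where
  "lattice_norm y = norm (\<chi> l. real_of_int (y $ l))"

definition A_mat :: "('d::finite, 'e::finite) kernel \<Rightarrow> int ^ 'd \<Rightarrow> real ^ 'e ^ 'e" where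
  "A_mat p y = (\<chi> j k. p y j k)"

definition Q_mat :: "('d::finite, 'e::finite) kernel \<Rightarrow> real ^ 'e ^ 'e" where
  "Q_mat p = (\<Sum>\<^sub>\<infinity>y. A_mat p y)"

definition M_mat :: "('d::finite, 'e::finite) kernel \<Rightarrow> 'd \<Rightarrow> real ^ 'e ^ 'e" where
  "M_mat p l = (\<Sum>\<^sub>\<infinity>y. real_of_int (y $ l) *\<^sub>R A_mat p y)"

definition Sigma_mat :: "('d::finite, 'e::finite) kernel \<Rightarrow> 'd \<Rightarrow> 'd \<Rightarrow> real ^ 'e ^ 'e" where
  "Sigma_mat p l m = (\<Sum>\<^sub>\<infinity>y. real_of_int (y $ l * y $ m) *\<^sub>R A_mat p y)"

definition moment_converges :: "nat \<Rightarrow> ('d::finite, 'e::finite) kernel \<Rightarrow> bool" where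
  "moment_converges r p \<longleftrightarrow> (\<lambda>y. lattice_norm y ^ r *\<^sub>R A_mat p y) summable_on UNIV"


text \<open>The operation \<open>^\<close> on \<^typ>\<open>real ^ 'e ^ 'e\<close> is componentwise, hence the matrix power below.\<close>

definition matrix_pow :: "real ^ 'e ^ 'e \<Rightarrow> nat \<Rightarrow> real ^ 'e ^ 'e::finite" where
  "matrix_pow A n = (((**) A) ^^ n) (mat 1)"

definition irreducible_chain :: "real ^ 'e ^ 'e::finite \<Rightarrow> bool" where
  "irreducible_chain A \<longleftrightarrow> (\<forall>j k. \<exists>n. matrix_pow A n $ j $ k > 0)"

definition aperiodic_chain :: "real ^ 'e ^ 'e::finite \<Rightarrow> bool" where
  "aperiodic_chain A \<longleftrightarrow> (\<forall>j. Gcd {n. n \<ge> 1 \<and> matrix_pow A n $ j $ j > 0} = 1)"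

definition stationary_distribution :: "real ^ 'e ^ 'e \<Rightarrow> real ^ 'e::finite \<Rightarrow> bool" where
  "stationary_distribution A \<mu> \<longleftrightarrow>
     (\<forall>j. \<mu> $ j \<ge> 0) \<and> (\<Sum>j\<in>UNIV. \<mu> $ j) = 1 \<and> \<mu> v* A = \<mu>"


text \<open>\<open>n_step p n u v\<close> is \<open>P(\<xi>\<^sub>n = v | \<xi>\<^sub>0 = u)\<close>, by the Chapman--Kolmogorov recursion.\<close>

primrec n_step ::
  "('d::finite, 'e::finite) kernel \<Rightarrow> nat \<Rightarrow> (int ^ 'd) \<times> 'e \<Rightarrow> (int ^ 'd) \<times> 'e \<Rightarrow> real" where
  "n_step p 0 u v = of_bool (u = v)"
| "n_step p (Suc n) u v =
     (\<Sum>\<^sub>\<infinity>w. n_step p n u w * p (fst v - fst w) (snd w) (snd v))"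

definition trivial_arithmetic :: "('d::finite, 'e::finite) kernel \<Rightarrow> bool" where
  "trivial_arithmetic p \<longleftrightarrow>
     (\<forall>j. group_closure
        {y - y' | y y'. \<exists>n\<ge>1. n_step p n (0, j) (y, j) > 0 \<and> n_step p n (0, j) (y', j) > 0} = UNIV)"

definition zero_mean :: "('d::finite, 'e::finite) kernel \<Rightarrow> real ^ 'e \<Rightarrow> bool" where
  "zero_mean p \<mu> \<longleftrightarrow> (\<forall>l. \<mu> \<bullet> (M_mat p l *v vec 1) = 0)"


text \<open>The inverse of \<open>Q - 1\<close> on the hyperplane orthogonal to \<open>\<mu>\<close>; meaningful when \<open>\<mu> \<bullet> w = 0\<close>.\<close>

definition Q_minus_1_inv ::
  "('d::finite, 'e::finite) kernel \<Rightarrow> real ^ 'e \<Rightarrow> real ^ 'e \<Rightarrow> real ^ 'e" where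
  "Q_minus_1_inv p \<mu> w = (THE v. \<mu> \<bullet> v = 0 \<and> Q_mat p *v v - v = w)"

definition covariance :: "('d::finite, 'e::finite) kernel \<Rightarrow> real ^ 'e \<Rightarrow> real ^ 'd ^ 'd" where
  "covariance p \<mu> = (\<chi> l m.
       \<mu> \<bullet> (Sigma_mat p l m *v vec 1)
     - \<mu> \<bullet> (M_mat p l *v Q_minus_1_inv p \<mu> (M_mat p m *v vec 1))
     - \<mu> \<bullet> (M_mat p m *v Q_minus_1_inv p \<mu> (M_mat p l *v vec 1)))"

definition positive_definite :: "real ^ 'd ^ 'd::finite \<Rightarrow> bool" where
  "positive_definite S \<longleftrightarrow> transpose S = S \<and> (\<forall>v. v \<noteq> 0 \<longrightarrow> v \<bullet> (S *v v) > 0)"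

definition basic_assumptions :: "('d::finite, 'e::finite) kernel \<Rightarrow> real ^ 'e \<Rightarrow> bool" where
  "basic_assumptions p \<mu> \<longleftrightarrow>
     irreducible_chain (Q_mat p) \<and> aperiodic_chain (Q_mat p) \<and>
     stationary_distribution (Q_mat p) \<mu> \<and>
     trivial_arithmetic p \<and>
     zero_mean p \<mu> \<and>
     moment_converges 2 p \<and>
     invertible (covariance p \<mu>) \<and> positive_definite (covariance p \<mu>)"


text \<open>
  The process is any realisation of the Markov chain on a probability space; the transition
  law is only required on histories of positive probability, where the conditional
  probability is meaningful.
\<close>

definition RWwIS ::
  "('d::finite, 'e::finite) kernel \<Rightarrow> 'w measure \<Rightarrow> (nat \<Rightarrow> 'w \<Rightarrow> (int ^ 'd) \<times> 'e) \<Rightarrow> bool" where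
  "RWwIS p M \<xi> \<longleftrightarrow>
     prob_space M \<and>
     (\<forall>n. \<xi> n \<in> M \<rightarrow>\<^sub>M count_space UNIV) \<and>
     (AE \<omega> in M. fst (\<xi> 0 \<omega>) = 0) \<and>
     (\<forall>n x. \<P>(\<omega> in M. \<forall>i\<le>n. \<xi> i \<omega> = x i) > 0 \<longrightarrow>
        \<P>(\<omega> in M. \<xi> (Suc n) \<omega> = x (Suc n) \<bar> \<forall>i\<le>n. \<xi> i \<omega> = x i)
          = p (fst (x (Suc n)) - fst (x n)) (snd (x n)) (snd (x (Suc n))))"

definition initial_state_law ::
  "'w measure \<Rightarrow> (nat \<Rightarrow> 'w \<Rightarrow> (int ^ 'd) \<times> 'e) \<Rightarrow> real ^ 'e::finite \<Rightarrow> bool" where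
  "initial_state_law M \<xi> \<mu> \<longleftrightarrow> (\<forall>j. \<P>(\<omega> in M. snd (\<xi> 0 \<omega>) = j) = \<mu> $ j)"

definition visited_sites :: "(nat \<Rightarrow> 'w \<Rightarrow> (int ^ 'd) \<times> 'e) \<Rightarrow> nat \<Rightarrow> 'w \<Rightarrow> nat" where
  "visited_sites \<xi> n \<omega> = card ((\<lambda>i. fst (\<xi> i \<omega>)) ` {..n})"

definition expected_visited ::
  "'w measure \<Rightarrow> (nat \<Rightarrow> 'w \<Rightarrow> (int ^ 'd) \<times> 'e) \<Rightarrow> nat \<Rightarrow> real" where
  "expected_visited M \<xi> n = (\<integral>\<omega>. real (visited_sites \<xi> n \<omega>) \<partial>M)"

end

theory Submission
  imports Defs "HOL-Real_Asymp.Real_Asymp"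
begin

text \<open>
  A site visited up to time \<open>n\<close> is counted once, at its last visit. As the
  internal state is stationary, the expected range is therefore \<open>\<Sum>m\<le>n. \<gamma> m\<close>, where \<open>\<gamma> m\<close> is the
  \<open>\<mu>\<close>-average of the probability \<open>escape p m k\<close> that a walk started in state \<open>k\<close> does not return to
  its starting site in \<open>m\<close> steps (\<open>expected_visited_eq\<close>). Decomposing a single walk at its last
  visit to the origin gives the renewal equation \<open>escape_renewal\<close>, whose kernel is the probability
  \<open>returns j i k\<close> of being at the origin in state \<open>k\<close> after \<open>i\<close> steps. If these return probabilities are
  \<open>O(1 / i)\<close> and sum up to \<open>\<mu> k * ln N / (2 * pi * sqrt (det \<sigma>)) + O(1)\<close>, the argument of Dvoretzky and
  Erdos (\<open>escape_asymptotics\<close>) yields \<open>\<gamma> n = 2 * pi * sqrt (det \<sigma>) / ln n\<close> up to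
  \<open>O(ln (ln n) / (ln n)\<^sup>2)\<close>, and summation over \<open>n\<close> gives the theorem.

  The return probabilities are Fourier coefficients of \<open>T t ^^ n\<close>, where the characteristic operator
  \<open>T t\<close> acts on functions of the internal state. Spectral perturbation theory is avoided by two
  elementary facts. First, \<open>T t ^^ n\<close> is at most a constant times \<open>exp (- c * n * (norm t)\<^sup>2)\<close> in sup norm,
  because loops of equal length at the same internal state interfere if their displacements differ,
  and by trivial arithmetic the differences of such displacements generate the lattice
  (\<open>char_op_decay\<close>). Second, solving the Poisson equation of the internal chain twice produces an
  explicit function that \<open>T t\<close> multiplies by \<open>exp (- q)\<close> up to \<open>O((norm t) ^ 3)\<close>, where \<open>q\<close> is half the
  quadratic form of the covariance matrix (\<open>approximate_eigenvector\<close>); this is where the third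
  moments enter. A third use of the Poisson equation writes the indicator of a state as its mean
  plus a coboundary, which telescopes when the return probabilities are summed
  (\<open>local_expansion\<close>). What remains is a Gaussian integral over the plane.
\<close>

section \<open>Expectations with respect to discrete distributions\<close>

abbreviation mean :: "'a pmf \<Rightarrow> ('a \<Rightarrow> 'b::{banach,second_countable_topology}) \<Rightarrow> 'b" where
  "mean P \<equiv> measure_pmf.expectation P"

lemma integrable_pmf_bounded:
  fixes f :: "'a \<Rightarrow> 'b::{banach,second_countable_topology}"
  assumes "\<And>x. x \<in> set_pmf P \<Longrightarrow> norm (f x) \<le> B"
  shows "integrable (measure_pmf P) f"
  by (rule measure_pmf.integrable_const_bound[where B=B]) (auto simp: AE_measure_pmf_iff assms)

text \<open>
  Adding the bound \<open>B\<close> makes the integrand nonnegative, so that the corresponding rule for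
  nonnegative integrals applies.
\<close>

lemma expectation_bind_pmf_real:
  fixes f :: "'b \<Rightarrow> real"
  assumes B: "\<And>x. x \<in> set_pmf (bind_pmf M K) \<Longrightarrow> \<bar>f x\<bar> \<le> B"
  shows "mean (bind_pmf M K) f
       = mean M (\<lambda>x. mean (K x) f)"
proof -
  have BK: "\<bar>f y\<bar> \<le> B" if "x \<in> set_pmf M" "y \<in> set_pmf (K x)" for x y
    using B that by auto
  define g where "g = (\<lambda>x. f x + B)"
  have ibind: "integrable (measure_pmf (bind_pmf M K)) f"
    by (rule integrable_pmf_bounded) (use B in auto)
  have iK: "integrable (measure_pmf (K x)) f" if "x \<in> set_pmf M" for x
    by (rule integrable_pmf_bounded) (use BK that in auto)
  have eK: "mean (K x) g = mean (K x) f + B"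
    if "x \<in> set_pmf M" for x
    using iK[OF that] by (simp add: g_def)
  have bK: "\<bar>mean (K x) f\<bar> \<le> B" if "x \<in> set_pmf M" for x
  proof -
    have "\<bar>mean (K x) f\<bar> \<le> mean (K x) (\<lambda>y. \<bar>f y\<bar>)"
      using integral_norm_bound[of "K x" f] by simp
    also have "\<dots> \<le> mean (K x) (\<lambda>y. B)"
      by (rule integral_mono_AE) (use iK[OF that] BK[OF that] in \<open>auto simp: AE_measure_pmf_iff\<close>)
    finally show ?thesis by simp
  qed
  have iM: "integrable (measure_pmf M) (\<lambda>x. mean (K x) f)"
    by (rule integrable_pmf_bounded) (use bK in auto)
  have "ennreal (mean (bind_pmf M K) g) = (\<integral>\<^sup>+x. g x \<partial>bind_pmf M K)"
    by (rule nn_integral_eq_integral[symmetric])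
       (use ibind B in \<open>auto simp: g_def AE_measure_pmf_iff abs_le_iff\<close>, force)
  also have "\<dots> = (\<integral>\<^sup>+x. \<integral>\<^sup>+y. g y \<partial>K x \<partial>M)"
    by simp
  also have "\<dots> = (\<integral>\<^sup>+x. ennreal (mean (K x) g) \<partial>M)"
  proof (intro nn_integral_cong_AE, unfold AE_measure_pmf_iff, intro ballI)
    fix x assume x: "x \<in> set_pmf M"
    have "AE y in K x. 0 \<le> g y"
      unfolding AE_measure_pmf_iff g_def using BK[OF x] by (fastforce simp: abs_le_iff)
    moreover have "integrable (K x) g" unfolding g_def using iK[OF x] by simp
    ultimately show "(\<integral>\<^sup>+y. g y \<partial>K x) = ennreal (mean (K x) g)"
      by (simp add: nn_integral_eq_integral)
  qed
  also have "\<dots> = (\<integral>\<^sup>+x. ennreal (mean (K x) f + B) \<partial>M)"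
    by (intro nn_integral_cong_AE) (auto simp: AE_measure_pmf_iff eK)
  also have "\<dots> = ennreal (mean M (\<lambda>x. mean (K x) f + B))"
  proof (rule nn_integral_eq_integral)
    show "AE x in M. 0 \<le> mean (K x) f + B"
      unfolding AE_measure_pmf_iff using bK by (fastforce simp: abs_le_iff)
  qed (use iM in simp)
  finally have "ennreal (mean (bind_pmf M K) g)
    = ennreal (mean M (\<lambda>x. mean (K x) f + B))" .
  moreover have "0 \<le> mean (bind_pmf M K) g"
    by (rule integral_nonneg_AE) (unfold AE_measure_pmf_iff g_def, use B in \<open>fastforce simp: abs_le_iff\<close>)
  moreover have "0 \<le> mean M (\<lambda>x. mean (K x) f + B)"
    by (rule integral_nonneg_AE) (unfold AE_measure_pmf_iff, use bK in \<open>fastforce simp: abs_le_iff\<close>)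
  ultimately have "mean (bind_pmf M K) g
    = mean M (\<lambda>x. mean (K x) f + B)"
    by simp
  thus ?thesis unfolding g_def using ibind iM by simp
qed

lemma norm_expectation_le:
  fixes f :: "'a \<Rightarrow> 'b::{banach,second_countable_topology}"
  assumes "\<And>x. x \<in> set_pmf P \<Longrightarrow> norm (f x) \<le> B"
  shows "norm (mean P f) \<le> B"
proof -
  have "norm (mean P f) \<le> mean P (\<lambda>x. norm (f x))"
    by (rule integral_norm_bound)
  also have "\<dots> \<le> mean P (\<lambda>x. B)"
    by (rule integral_mono_AE)
       (use assms in \<open>auto simp: AE_measure_pmf_iff intro!: integrable_norm integrable_pmf_bounded\<close>)
  finally show ?thesis by simp
qed

lemma expectation_bind_pmf_complex:
  fixes f :: "'b \<Rightarrow> complex"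
  assumes B: "\<And>x. norm (f x) \<le> B"
  shows "mean (bind_pmf M K) f
       = mean M (\<lambda>x. mean (K x) f)"
proof -
  have i: "integrable (measure_pmf P) f" for P
    by (rule integrable_pmf_bounded) (use B in auto)
  have i2: "integrable (measure_pmf M) (\<lambda>x. mean (K x) f)"
    by (rule integrable_pmf_bounded[where B=B], rule norm_expectation_le) (use B in auto)
  have "mean (bind_pmf M K) (\<lambda>x. Re (f x))
      = mean M (\<lambda>x. mean (K x) (\<lambda>x. Re (f x)))"
    by (rule expectation_bind_pmf_real[where B=B]) (use B abs_Re_le_cmod order_trans in blast)
  moreover have "mean (bind_pmf M K) (\<lambda>x. Im (f x))
      = mean M (\<lambda>x. mean (K x) (\<lambda>x. Im (f x)))"
    by (rule expectation_bind_pmf_real[where B=B]) (use B abs_Im_le_cmod order_trans in blast)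
  ultimately show ?thesis
    using i i2 by (intro complex_eqI) simp_all
qed

lemma pmf_bind_map_snoc:
  "pmf (bind_pmf P (\<lambda>l. map_pmf (\<lambda>s. l @ [s]) (K l))) (l @ [s]) = pmf P l * pmf (K l) s"
proof -
  have "pmf (map_pmf (\<lambda>s. l' @ [s]) (K l')) (l @ [s]) = pmf (K l) s * indicator {l} l'" for l'
  proof (cases "l' = l")
    case True
    have "pmf (map_pmf (\<lambda>s. l @ [s]) (K l)) ((\<lambda>s. l @ [s]) s) = pmf (K l) s"
      by (rule pmf_map_inj') (auto simp: inj_def)
    thus ?thesis using True by simp
  next
    case False
    thus ?thesis by (auto intro!: pmf_map_outside)
  qed
  thus ?thesis
    by (simp add: pmf_bind measure_pmf_single mult.commute)
qed

section \<open>The walk as a discrete Markov chain\<close>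

definition step_pmf :: "('d::finite, 'e::finite) kernel \<Rightarrow> 'e \<Rightarrow> ((int ^ 'd) \<times> 'e) pmf" where
  "step_pmf p j = embed_pmf (\<lambda>(y, k). p y j k)"

definition shift :: "int ^ 'd \<Rightarrow> (int ^ 'd) \<times> 'e \<Rightarrow> (int ^ 'd) \<times> 'e" where
  "shift x v = (x + fst v, snd v)"

definition trans_pmf ::
  "('d::finite, 'e::finite) kernel \<Rightarrow> (int ^ 'd) \<times> 'e \<Rightarrow> ((int ^ 'd) \<times> 'e) pmf" where
  "trans_pmf p w = map_pmf (shift (fst w)) (step_pmf p (snd w))"

primrec walk_pmf ::
  "('d::finite, 'e::finite) kernel \<Rightarrow> nat \<Rightarrow> (int ^ 'd) \<times> 'e \<Rightarrow> ((int ^ 'd) \<times> 'e) pmf" where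
  "walk_pmf p 0 w = return_pmf w"
| "walk_pmf p (Suc n) w = bind_pmf (trans_pmf p w) (walk_pmf p n)"

text \<open>
  Paths are listed with the oldest position first, so that the recursion removes the starting
  point; whether that point is visited again then depends on the tail of the list only.
\<close>

primrec path_pmf ::
  "('d::finite, 'e::finite) kernel \<Rightarrow> nat \<Rightarrow> (int ^ 'd) \<times> 'e \<Rightarrow> ((int ^ 'd) \<times> 'e) list pmf" where
  "path_pmf p 0 w = return_pmf [w]"
| "path_pmf p (Suc n) w = bind_pmf (trans_pmf p w) (\<lambda>v. map_pmf ((#) w) (path_pmf p n v))"

text \<open>
  The probability that none of the positions at times \<open>1, ..., n\<close> lies over the site \<open>x\<close>; the
  starting position itself may.
\<close>

primrec avoid ::
  "('d::finite, 'e::finite) kernel \<Rightarrow> int ^ 'd \<Rightarrow> nat \<Rightarrow> (int ^ 'd) \<times> 'e \<Rightarrow> real" where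
  "avoid p x 0 w = 1"
| "avoid p x (Suc n) w =
     mean (trans_pmf p w) (\<lambda>v. if fst v = x then 0 else avoid p x n v)"

lemma pmf_step:
  assumes "stochastic_kernel p"
  shows "pmf (step_pmf p j) (y, k) = p y j k"
proof -
  let ?f = "\<lambda>(y, k). p y j k"
  have nn: "0 \<le> ?f x" for x using assms by (auto simp: stochastic_kernel_def split: prod.splits)
  have hs: "(?f has_sum 1) UNIV" using assms by (auto simp: stochastic_kernel_def)
  hence "?f summable_on UNIV" by (auto simp: summable_on_def)
  hence "(\<lambda>x. norm (?f x)) summable_on UNIV" using summable_on_iff_abs_summable_on_real by blast
  hence "Infinite_Set_Sum.abs_summable_on ?f UNIV" by (simp only: abs_summable_equivalent)
  hence "(\<integral>\<^sup>+x. ennreal (?f x) \<partial>count_space UNIV) = ennreal (infsetsum ?f UNIV)"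
    by (rule nn_integral_conv_infsetsum) (use nn in auto)
  also have "infsetsum ?f UNIV = infsum ?f UNIV"
    by (rule infsetsum_infsum) fact
  also have "\<dots> = 1" using hs by (rule infsumI)
  finally have "(\<integral>\<^sup>+x. ennreal (?f x) \<partial>count_space UNIV) = 1" by simp
  with pmf_embed_pmf[of ?f, OF nn] show ?thesis unfolding step_pmf_def by simp
qed

lemma inj_shift: "inj (shift x)"
  by (auto simp: inj_def shift_def prod_eq_iff)

lemma pmf_trans:
  assumes "stochastic_kernel p"
  shows "pmf (trans_pmf p w) v = p (fst v - fst w) (snd w) (snd v)"
proof -
  have "v = shift (fst w) (fst v - fst w, snd v)" by (simp add: shift_def)
  hence "pmf (trans_pmf p w) v = pmf (step_pmf p (snd w)) (fst v - fst w, snd v)"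
    unfolding trans_pmf_def by (metis pmf_map_inj' inj_shift)
  thus ?thesis by (simp add: pmf_step[OF assms])
qed

lemma trans_pmf_shift: "trans_pmf p (shift x w) = map_pmf (shift x) (trans_pmf p w)"
  by (simp add: trans_pmf_def map_pmf_comp shift_def[abs_def] add.assoc)

lemma path_pmf_shift: "path_pmf p n (shift x w) = map_pmf (map (shift x)) (path_pmf p n w)"
  by (induction n arbitrary: w) (simp_all add: trans_pmf_shift bind_map_pmf map_bind_pmf map_pmf_comp)

lemma path_pmf_nonempty: "l \<in> set_pmf (path_pmf p n w) \<Longrightarrow> l \<noteq> []"
  by (cases n) auto

lemma path_pmf_length: "l \<in> set_pmf (path_pmf p n w) \<Longrightarrow> length l = Suc n"
  by (induction n arbitrary: w l) auto

text \<open>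
  The law of a realisation is prescribed by its last step, whereas the definition of
  \<open>path_pmf\<close> conditions on the first one.
\<close>

lemma path_pmf_snoc:
  "path_pmf p (Suc n) w
     = bind_pmf (path_pmf p n w) (\<lambda>l. map_pmf (\<lambda>s. l @ [s]) (trans_pmf p (last l)))"
proof (induction n arbitrary: w)
  case 0
  show ?case by (simp add: bind_return_pmf map_pmf_def bind_assoc_pmf)
next
  case (Suc n)
  have "path_pmf p (Suc (Suc n)) w
      = bind_pmf (trans_pmf p w) (\<lambda>v. map_pmf ((#) w) (path_pmf p (Suc n) v))"
    by simp
  also have "\<dots> = bind_pmf (trans_pmf p w) (\<lambda>v. bind_pmf (path_pmf p n v)
         (\<lambda>l. map_pmf (\<lambda>s. w # l @ [s]) (trans_pmf p (last l))))"
    unfolding Suc by (simp add: map_bind_pmf map_pmf_comp)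
  also have "\<dots> = bind_pmf (trans_pmf p w) (\<lambda>v. bind_pmf (path_pmf p n v)
         (\<lambda>l. map_pmf (\<lambda>s. w # l @ [s]) (trans_pmf p (last (w # l)))))"
    by (intro bind_pmf_cong refl) (auto dest: path_pmf_nonempty)
  also have "\<dots> = bind_pmf (path_pmf p (Suc n) w) (\<lambda>l. map_pmf (\<lambda>s. l @ [s]) (trans_pmf p (last l)))"
    by (simp add: bind_assoc_pmf bind_map_pmf)
  finally show ?case .
qed

lemma walk_pmf_snoc: "walk_pmf p (Suc n) w = bind_pmf (walk_pmf p n w) (trans_pmf p)"
proof (induction n arbitrary: w)
  case (Suc n)
  have "walk_pmf p (Suc (Suc n)) w = bind_pmf (trans_pmf p w) (walk_pmf p (Suc n))" by simp
  also have "\<dots> = bind_pmf (trans_pmf p w) (\<lambda>v. bind_pmf (walk_pmf p n v) (trans_pmf p))"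
    using Suc by presburger
  also have "\<dots> = bind_pmf (walk_pmf p (Suc n) w) (trans_pmf p)" by (simp add: bind_assoc_pmf)
  finally show ?case .
next
  case 0
  have "walk_pmf p 0 = return_pmf" by (rule ext) simp
  thus ?case by (simp add: bind_return_pmf bind_return_pmf')
qed

lemma expectation_has_sum:
  fixes f :: "'a \<Rightarrow> real"
  assumes "integrable (measure_pmf P) f"
  shows "((\<lambda>x. pmf P x * f x) has_sum mean P f) UNIV"
proof -
  have "Infinite_Set_Sum.abs_summable_on (\<lambda>x. pmf P x * f x) UNIV"
    using assms unfolding measure_pmf_eq_density Infinite_Set_Sum.abs_summable_on_def set_integrable_def
    by (simp add: integrable_density)
  hence a: "(\<lambda>x. norm (pmf P x * f x)) summable_on UNIV" by (simp only: abs_summable_equivalent)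
  have "mean P f = infsum (\<lambda>x. pmf P x * f x) UNIV"
    unfolding pmf_expectation_eq_infsetsum by (rule infsetsum_infsum) fact
  with a show ?thesis using abs_summable_summable[OF a] by (simp add: has_sum_infsum)
qed

lemma n_step_eq_walk:
  assumes "stochastic_kernel p"
  shows "n_step p n u v = pmf (walk_pmf p n u) v"
proof (induction n arbitrary: v)
  case (Suc n)
  have "pmf (walk_pmf p (Suc n) u) v
      = mean (walk_pmf p n u) (\<lambda>w. pmf (trans_pmf p w) v)"
    by (simp only: walk_pmf_snoc pmf_bind)
  also have "\<dots> = (\<Sum>\<^sub>\<infinity>w. pmf (walk_pmf p n u) w * pmf (trans_pmf p w) v)"
    by (rule infsumI[symmetric], rule expectation_has_sum, rule integrable_pmf_bounded[where B=1])
       (auto simp: pmf_le_1)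
  also have "\<dots> = n_step p (Suc n) u v" by (simp add: Suc pmf_trans[OF assms])
  finally show ?case by simp
qed auto

section \<open>Kernel averages as matrices\<close>

lemma has_sum_vec:
  fixes f :: "'a \<Rightarrow> 'b::real_normed_vector ^ 'n::finite"
  assumes "\<And>i. ((\<lambda>x. f x $ i) has_sum (a $ i)) A"
  shows "(f has_sum a) A"
  using assms unfolding has_sum_def by (auto intro!: vec_tendstoI simp: sum_component)

text \<open>
  Matrix-valued sums over the lattice, such as those in the hypotheses on \<open>p\<close>, become expectations
  over a single step.
\<close>

lemma weighted_kernel_has_sum:
  assumes p: "stochastic_kernel p"
    and int: "\<And>j. integrable (measure_pmf (step_pmf p j)) (\<lambda>v. \<phi> (fst v))"
  shows "((\<lambda>y. \<phi> y *\<^sub>R A_mat p y) has_sum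
     (\<chi> j k. mean (step_pmf p j) (\<lambda>v. \<phi> (fst v) * of_bool (snd v = k)))) UNIV"
proof (rule has_sum_vec, rule has_sum_vec)
  fix j k :: 'b
  let ?f = "\<lambda>v. \<phi> (fst v) * of_bool (snd v = k)"
  have "integrable (measure_pmf (step_pmf p j)) ?f"
    by (rule Bochner_Integration.integrable_bound[OF int[of j]]) auto
  hence "((\<lambda>v. pmf (step_pmf p j) v * ?f v) has_sum mean (step_pmf p j) ?f) UNIV"
    by (rule expectation_has_sum)
  hence "((\<lambda>v. pmf (step_pmf p j) v * ?f v) has_sum mean (step_pmf p j) ?f)
           ((\<lambda>y. (y, k)) ` UNIV)"
    by (rule has_sum_cong_neutral[THEN iffD1, rotated -1]) auto
  hence "((\<lambda>y. pmf (step_pmf p j) (y, k) * ?f (y, k)) has_sum mean (step_pmf p j) ?f) UNIV"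
    by (subst (asm) has_sum_reindex) (auto simp: inj_on_def o_def)
  thus "((\<lambda>y. (\<phi> y *\<^sub>R A_mat p y) $ j $ k) has_sum
     (\<chi> j k. mean (step_pmf p j) (\<lambda>v. \<phi> (fst v) * of_bool (snd v = k))) $ j $ k) UNIV"
    by (simp add: A_mat_def pmf_step[OF p] mult.commute)
qed

lemma expectation_by_state:
  fixes g :: "'s \<times> 'e::finite \<Rightarrow> real"
  assumes int: "integrable (measure_pmf P) g"
  shows "mean P (\<lambda>v. g v * f (snd v))
       = (\<Sum>k\<in>UNIV. mean P (\<lambda>v. g v * of_bool (snd v = k)) * f k)"
proof -
  have i: "integrable (measure_pmf P) (\<lambda>v. g v * of_bool (snd v = k))" for k
    by (rule Bochner_Integration.integrable_bound[OF int]) auto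
  have "(\<Sum>k\<in>UNIV. mean P (\<lambda>v. g v * of_bool (snd v = k)) * f k)
      = (\<Sum>k\<in>UNIV. mean P (\<lambda>v. g v * of_bool (snd v = k) * f k))"
    by simp
  also have "\<dots> = mean P (\<lambda>v. \<Sum>k\<in>UNIV. g v * of_bool (snd v = k) * f k)"
    by (rule Bochner_Integration.integral_sum[symmetric]) (use i in auto)
  also have "(\<lambda>v. \<Sum>k\<in>UNIV. g v * of_bool (snd v = k) * f k) = (\<lambda>v. g v * f (snd v))"
    by (simp add: of_bool_def if_distrib if_distribR cong: if_cong)
  finally show ?thesis by simp
qed

lemma weighted_kernel_vec:
  assumes p: "stochastic_kernel p"
    and int: "\<And>j. integrable (measure_pmf (step_pmf p j)) (\<lambda>v. \<phi> (fst v))"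
  shows "((\<Sum>\<^sub>\<infinity>y. \<phi> y *\<^sub>R A_mat p y) *v f) $ j
    = mean (step_pmf p j) (\<lambda>v. \<phi> (fst v) * f $ snd v)"
  unfolding infsumI[OF weighted_kernel_has_sum[OF p int]]
  by (simp add: matrix_vector_mult_def expectation_by_state[OF int])

lemma Q_mat_vec:
  assumes p: "stochastic_kernel p"
  shows "(Q_mat p *v f) $ j = mean (step_pmf p j) (\<lambda>v. f $ snd v)"
  using weighted_kernel_vec[OF p, of "\<lambda>_. 1" f j] by (simp add: Q_mat_def)

section \<open>The expected range as a sum of escape probabilities\<close>

definition range_size :: "('x \<times> 'e) list \<Rightarrow> real" where
  "range_size l = real (card (fst ` set l))"

definition expected_range :: "('d::finite, 'e::finite) kernel \<Rightarrow> nat \<Rightarrow> (int ^ 'd) \<times> 'e \<Rightarrow> real" where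
  "expected_range p n w = mean (path_pmf p n w) range_size"

definition escape :: "('d::finite, 'e::finite) kernel \<Rightarrow> nat \<Rightarrow> 'e \<Rightarrow> real" where
  "escape p n j = avoid p 0 n (0, j)"

text \<open>
  The range does not depend on the starting site, since translations act injectively on sites.
\<close>

lemma expected_range_snd: "expected_range p n (y, j) = expected_range p n (0, j)"
proof -
  have s: "(y, j) = shift y (0, j)" by (simp add: shift_def)
  have "range_size (map (shift y) l) = range_size l" for l :: "((int ^ 'a) \<times> 'b) list"
  proof -
    have "fst ` set (map (shift y) l) = (+) y ` (fst ` set l)"
      by (simp add: image_image shift_def)
    thus ?thesis by (simp add: range_size_def card_image)
  qed
  thus ?thesis unfolding expected_range_def s path_pmf_shift by simp
qed

lemma avoid_bounds: "0 \<le> avoid p x n w \<and> avoid p x n w \<le> 1"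
proof (induction n arbitrary: w)
  case (Suc n)
  let ?f = "\<lambda>v. if fst v = x then 0 else avoid p x n v"
  have "integrable (trans_pmf p w) ?f"
    by (rule integrable_pmf_bounded[where B=1]) (use Suc in auto)
  hence "mean (trans_pmf p w) ?f \<le> mean (trans_pmf p w) (\<lambda>_. 1)"
    by (rule integral_mono) (use Suc in auto)
  moreover have "0 \<le> mean (trans_pmf p w) ?f"
    by (rule integral_nonneg_AE) (use Suc in auto)
  ultimately show ?case by simp
qed simp

lemma avoid_nonneg: "0 \<le> avoid p x n w" and avoid_le_1: "avoid p x n w \<le> 1"
  using avoid_bounds by blast+

lemma prob_path_avoids:
  "measure_pmf.prob (path_pmf p n v) {l. x \<notin> fst ` set l} = (if fst v = x then 0 else avoid p x n v)"
proof (induction n arbitrary: v)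
  case 0
  thus ?case by (auto simp: indicator_def)
next
  case (Suc n)
  let ?E = "\<lambda>l. indicator {l. x \<notin> fst ` set l} l :: real"
  have "measure_pmf.prob (path_pmf p (Suc n) v) {l. x \<notin> fst ` set l}
      = mean (path_pmf p (Suc n) v) ?E" by simp
  also have "\<dots> = mean (trans_pmf p v)
        (\<lambda>u. mean (map_pmf ((#) v) (path_pmf p n u)) ?E)"
    unfolding path_pmf.simps by (rule expectation_bind_pmf_real[where B=1]) (auto simp: indicator_def)
  also have "\<dots> = mean (trans_pmf p v)
        (\<lambda>u. if fst v = x then 0 else if fst u = x then 0 else avoid p x n u)"
  proof (intro Bochner_Integration.integral_cong refl)
    fix u
    have "(\<lambda>l. ?E (v # l)) = (\<lambda>l. if fst v = x then 0 else ?E l)"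
      by (auto simp: indicator_def)
    hence "mean (map_pmf ((#) v) (path_pmf p n u)) ?E
        = (if fst v = x then 0 else mean (path_pmf p n u) ?E)"
      by auto
    thus "mean (map_pmf ((#) v) (path_pmf p n u)) ?E
       = (if fst v = x then 0 else if fst u = x then 0 else avoid p x n u)"
      using Suc[of u] by simp
  qed
  finally show ?case by simp
qed

lemma range_size_Cons:
  "range_size (w # l) = range_size l + indicator {l. fst w \<notin> fst ` set l} l"
  by (auto simp: range_size_def card_insert_if)

lemma range_size_bound: "\<bar>range_size l\<bar> \<le> real (length l)"
proof -
  have "card (fst ` set l) \<le> length l"
    using card_image_le[of "set l" fst] card_length[of l] by simp
  thus ?thesis by (simp add: range_size_def)
qed

lemma expected_range_bound: "\<bar>expected_range p n w\<bar> \<le> real (Suc n)"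
proof -
  have "norm (expected_range p n w) \<le> real (Suc n)"
    unfolding expected_range_def
    by (rule norm_expectation_le) (metis path_pmf_length range_size_bound real_norm_def)
  thus ?thesis by simp
qed

text \<open>
  The starting site contributes to the range of a path, in addition to the range of the tail,
  exactly if the tail avoids it. Counting each site at its last visit in this way makes the
  contribution a function of the future alone, so that no time reversal is needed.
\<close>

lemma expected_range_Suc:
  "expected_range p (Suc n) w
     = mean (trans_pmf p w) (expected_range p n) + avoid p (fst w) (Suc n) w"
proof -
  have "expected_range p (Suc n) w = mean (trans_pmf p w)
        (\<lambda>u. mean (map_pmf ((#) w) (path_pmf p n u)) range_size)"
    unfolding expected_range_def path_pmf.simps
  proof (rule expectation_bind_pmf_real[where B="real (Suc (Suc n))"])
    fix l assume "l \<in> set_pmf (trans_pmf p w \<bind> (\<lambda>v. map_pmf ((#) w) (path_pmf p n v)))"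
    hence "length l = Suc (Suc n)" by (auto dest: path_pmf_length)
    thus "\<bar>range_size l\<bar> \<le> real (Suc (Suc n))" using range_size_bound[of l] by simp
  qed
  also have "\<dots> = mean (trans_pmf p w)
        (\<lambda>u. expected_range p n u + (if fst u = fst w then 0 else avoid p (fst w) n u))"
  proof (intro Bochner_Integration.integral_cong refl)
    fix u
    have "integrable (path_pmf p n u) range_size"
      by (rule integrable_pmf_bounded[where B="real (Suc n)"])
         (metis path_pmf_length range_size_bound real_norm_def)
    moreover have "integrable (path_pmf p n u) (indicator {l. fst w \<notin> fst ` set l} :: _ \<Rightarrow> real)"
      by (rule integrable_pmf_bounded[where B=1]) (auto simp: indicator_def)
    ultimately show "mean (map_pmf ((#) w) (path_pmf p n u)) range_size
       = expected_range p n u + (if fst u = fst w then 0 else avoid p (fst w) n u)"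
      by (simp add: range_size_Cons expected_range_def prob_path_avoids)
  qed
  also have "\<dots> = mean (trans_pmf p w) (expected_range p n) + avoid p (fst w) (Suc n) w"
    unfolding avoid.simps
  proof (intro Bochner_Integration.integral_add)
    show "integrable (trans_pmf p w) (expected_range p n)"
      by (rule integrable_pmf_bounded) (use expected_range_bound in auto)
    show "integrable (trans_pmf p w) (\<lambda>u. if fst u = fst w then 0 else avoid p (fst w) n u)"
      by (rule integrable_pmf_bounded[where B=1]) (auto simp: avoid_nonneg avoid_le_1)
  qed
  finally show ?thesis .
qed

text \<open>
  Averaging over \<open>\<mu>\<close> removes the first term of the recursion for the range, because \<open>\<mu>\<close> is invariant.
\<close>

lemma expected_range_stationary:
  assumes p: "stochastic_kernel p" and st: "stationary_distribution (Q_mat p) \<mu>"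
  shows "(\<Sum>j\<in>UNIV. \<mu> $ j * expected_range p n (0, j))
       = (\<Sum>m\<le>n. \<Sum>j\<in>UNIV. \<mu> $ j * escape p m j)"
proof (induction n)
  case 0
  have "expected_range p 0 (0, j) = escape p 0 j" for j
    by (simp add: expected_range_def escape_def range_size_def)
  thus ?case by simp
next
  case (Suc n)
  define F where "F = (\<chi> j. expected_range p n (0, j))"
  have "mean (trans_pmf p (0, j)) (expected_range p n) = (Q_mat p *v F) $ j" for j
  proof -
    have "mean (trans_pmf p (0, j)) (expected_range p n)
        = mean (step_pmf p j) (\<lambda>v. expected_range p n (shift 0 v))"
      by (simp add: trans_pmf_def)
    also have "(\<lambda>v. expected_range p n (shift 0 v)) = (\<lambda>v. F $ snd v)"
      by (rule ext) (simp add: shift_def F_def, metis expected_range_snd prod.collapse)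
    finally show ?thesis by (simp add: Q_mat_vec[OF p])
  qed
  hence E: "expected_range p (Suc n) (0, j) = (Q_mat p *v F) $ j + escape p (Suc n) j" for j
    by (simp only: expected_range_Suc escape_def fst_conv)
  have "(\<Sum>j\<in>UNIV. \<mu> $ j * expected_range p (Suc n) (0, j))
      = \<mu> \<bullet> (Q_mat p *v F) + (\<Sum>j\<in>UNIV. \<mu> $ j * escape p (Suc n) j)"
    by (simp add: E inner_vec_def distrib_left sum.distrib)
  also have "\<mu> \<bullet> (Q_mat p *v F) = \<mu> \<bullet> F"
    using st by (simp only: dot_lmul_matrix[symmetric] stationary_distribution_def)
  also have "\<dots> = (\<Sum>j\<in>UNIV. \<mu> $ j * expected_range p n (0, j))"
    by (simp add: inner_vec_def F_def)
  finally show ?case using Suc by simp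
qed

lemma escape_antimono: "escape p (Suc n) j \<le> escape p n j"
proof -
  have "avoid p x (Suc n) w \<le> avoid p x n w" for x w
  proof (induction n arbitrary: w)
    case 0
    show ?case using avoid_le_1[of p x "Suc 0" w] by simp
  next
    case (Suc n)
    have i: "integrable (trans_pmf p w) (\<lambda>v. if fst v = x then 0 else avoid p x m v)" for m
      by (rule integrable_pmf_bounded[where B=1]) (auto simp: avoid_nonneg avoid_le_1)
    show ?case
      by (subst (1 2) avoid.simps, rule integral_mono[OF i i]) (simp add: Suc del: avoid.simps)
  qed
  thus ?thesis by (simp add: escape_def del: avoid.simps)
qed

text \<open>
  The renewal equation: either the path never visits \<open>x\<close> after time \<open>0\<close>, or there is a last such
  visit, at some time \<open>i\<close>, after which the path avoids \<open>x\<close> for the remaining \<open>n - i\<close> steps.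
\<close>

lemma last_visit_decomposition:
  "avoid p x n w + (\<Sum>i\<in>{1..n}. \<Sum>k\<in>UNIV. pmf (walk_pmf p i w) (x, k) * avoid p x (n - i) (x, k)) = 1"
proof (induction n arbitrary: w)
  case (Suc n)
  let ?S = "\<lambda>v. \<Sum>i\<in>{0..n}. \<Sum>k\<in>UNIV. pmf (walk_pmf p i v) (x, k) * avoid p x (n - i) (x, k)"
  \<comment> \<open>The induction hypothesis for a walk started at \<open>v\<close>; the summand \<open>i = 0\<close> accounts for \<open>v\<close> itself lying over \<open>x\<close>.\<close>
  have one: "(if fst v = x then 0 else avoid p x n v) + ?S v = 1" for v
  proof -
    have "(\<Sum>k\<in>UNIV. pmf (walk_pmf p 0 v) (x, k) * avoid p x n (x, k))
        = (if fst v = x then avoid p x n v else 0)"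
    proof -
      have "pmf (walk_pmf p 0 v) (x, k) * avoid p x n (x, k)
          = (if k = snd v then (if fst v = x then avoid p x n v else 0) else 0)" for k
        by (cases v) (auto simp: indicator_def)
      thus ?thesis by simp
    qed
    moreover have "{0..n} = insert 0 {1..n}" by auto
    ultimately have "?S v = (if fst v = x then avoid p x n v else 0)
       + (\<Sum>i\<in>{1..n}. \<Sum>k\<in>UNIV. pmf (walk_pmf p i v) (x, k) * avoid p x (n - i) (x, k))"
      by simp
    thus ?thesis using Suc[of v] by auto
  qed
  have i: "integrable (trans_pmf p w) (\<lambda>v. pmf (walk_pmf p i v) (x, k))" for i k
    by (rule integrable_pmf_bounded[where B=1]) (auto simp: pmf_le_1)
  have i2: "integrable (trans_pmf p w) (\<lambda>v. if fst v = x then 0 else avoid p x n v)"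
    by (rule integrable_pmf_bounded[where B=1]) (auto simp: avoid_nonneg avoid_le_1)
  have i3: "integrable (trans_pmf p w) ?S"
    by (intro Bochner_Integration.integrable_sum integrable_mult_left i)
  have "1 = mean (trans_pmf p w) (\<lambda>v. (if fst v = x then 0 else avoid p x n v) + ?S v)"
    unfolding one by simp
  also have "\<dots> = avoid p x (Suc n) w + mean (trans_pmf p w) ?S"
    unfolding avoid.simps by (rule Bochner_Integration.integral_add[OF i2 i3])
  also have "mean (trans_pmf p w) ?S
    = (\<Sum>i\<in>{0..n}. \<Sum>k\<in>UNIV. pmf (walk_pmf p (Suc i) w) (x, k) * avoid p x (n - i) (x, k))"
    using i by (simp add: Bochner_Integration.integral_sum pmf_bind)
  also have "\<dots> = (\<Sum>i\<in>{1..Suc n}. \<Sum>k\<in>UNIV. pmf (walk_pmf p i w) (x, k) * avoid p x (Suc n - i) (x, k))"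
    by (rule sum.reindex_bij_witness[where i="\<lambda>i. i - 1" and j=Suc]) auto
  finally show ?case by simp
qed simp

section \<open>Identifying the law of a realisation\<close>

definition init_pmf :: "real ^ 'e::finite \<Rightarrow> ((int ^ 'd::finite) \<times> 'e) pmf" where
  "init_pmf \<mu> = map_pmf (Pair 0) (embed_pmf (\<lambda>j. \<mu> $ j))"

lemma pmf_init:
  fixes \<mu> :: "real ^ 'e::finite"
  assumes "stationary_distribution A \<mu>"
  shows "pmf (embed_pmf (\<lambda>j. \<mu> $ j)) j = \<mu> $ j"
proof (rule pmf_embed_pmf)
  show nn: "\<And>j. 0 \<le> \<mu> $ j" using assms by (auto simp: stationary_distribution_def)
  show "(\<integral>\<^sup>+j. ennreal (\<mu> $ j) \<partial>count_space UNIV) = 1"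
    using assms nn by (simp add: nn_integral_count_space_finite sum_ennreal stationary_distribution_def)
qed

lemma expectation_init:
  fixes \<mu> :: "real ^ 'e::finite"
  assumes st: "stationary_distribution A \<mu>"
  shows "mean (init_pmf \<mu> :: ((int ^ 'd::finite) \<times> 'e) pmf) f
     = (\<Sum>j\<in>UNIV. \<mu> $ j * (f (0, j) :: real))"
  unfolding init_pmf_def integral_map_pmf
  by (subst integral_measure_pmf_real[where A=UNIV]) (auto simp: pmf_init[OF st] mult.commute)

definition history :: "(nat \<Rightarrow> 'w \<Rightarrow> 's) \<Rightarrow> nat \<Rightarrow> 'w \<Rightarrow> 's list" where
  "history \<xi> n \<omega> = map (\<lambda>i. \<xi> i \<omega>) [0..<Suc n]"

lemma history_eq_iff:
  assumes "length l = Suc n"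
  shows "history \<xi> n \<omega> = l \<longleftrightarrow> (\<forall>i\<le>n. \<xi> i \<omega> = l ! i)"
  using assms by (auto simp: history_def list_eq_iff_nth_eq less_Suc_eq_le simp del: upt_Suc)

lemma history_Suc: "history \<xi> (Suc n) \<omega> = history \<xi> n \<omega> @ [\<xi> (Suc n) \<omega>]"
  by (simp add: history_def)

lemma history_event:
  fixes \<xi> :: "nat \<Rightarrow> 'w \<Rightarrow> 's::countable"
  assumes [measurable]: "\<And>i. \<xi> i \<in> M \<rightarrow>\<^sub>M count_space UNIV"
  shows "{\<omega>\<in>space M. history \<xi> n \<omega> = h} \<in> sets M"
proof (cases "length h = Suc n")
  case True
  show ?thesis unfolding history_eq_iff[OF True] by measurable
next
  case False
  hence "{\<omega>\<in>space M. history \<xi> n \<omega> = h} = {}" by (auto simp: history_def)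
  thus ?thesis by (metis sets.empty_sets)
qed

text \<open>
  The transition law is given only after histories of positive probability. A history of
  probability zero has no extension of positive probability, and the product formula for paths
  assigns probability zero to its extensions as well, so both sides agree for all histories.
\<close>

lemma history_law:
  fixes \<xi> :: "nat \<Rightarrow> 'w \<Rightarrow> (int ^ 'd::finite) \<times> 'e::finite"
  assumes p: "stochastic_kernel p" and st: "stationary_distribution (Q_mat p) \<mu>"
    and W: "RWwIS p M \<xi>" and I: "initial_state_law M \<xi> \<mu>"
  shows "measure M {\<omega>\<in>space M. history \<xi> n \<omega> = l} = pmf (bind_pmf (init_pmf \<mu>) (path_pmf p n)) l"
proof -
  interpret prob_space M using W by (simp add: RWwIS_def)
  have meas[measurable]: "\<xi> n \<in> M \<rightarrow>\<^sub>M count_space UNIV" for n using W by (simp add: RWwIS_def)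
  have ev: "{\<omega>\<in>space M. R (\<xi> n \<omega>)} \<in> events" for R n
    using measurable_sets[OF meas[of n], of "{v. R v}"] by (simp add: vimage_def Int_def conj_commute)
  show ?thesis
  proof (induction n arbitrary: l)
    case 0
    have AE0: "AE \<omega> in M. fst (\<xi> 0 \<omega>) = 0" using W by (simp add: RWwIS_def)
    have P0: "prob {\<omega>\<in>space M. \<xi> 0 \<omega> = w} = (if fst w = 0 then \<mu> $ snd w else 0)" for w
    proof -
      have "prob {\<omega>\<in>space M. \<xi> 0 \<omega> = w}
         = prob {\<omega>\<in>space M. fst w = 0 \<and> snd (\<xi> 0 \<omega>) = snd w}"
        by (rule finite_measure_eq_AE) (use AE0 in \<open>auto simp: prod_eq_iff intro: ev[of "\<lambda>v. v = w" 0, unfolded prod_eq_iff] ev[of "\<lambda>v. fst w = 0 \<and> snd v = snd w" 0]\<close>)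
      also have "\<dots> = (if fst w = 0 then prob {\<omega>\<in>space M. snd (\<xi> 0 \<omega>) = snd w} else 0)"
        by auto
      also have "\<dots> = (if fst w = 0 then \<mu> $ snd w else 0)"
        using I by (auto simp: initial_state_law_def)
      finally show ?thesis .
    qed
    have init: "pmf (init_pmf \<mu>) w = (if fst w = 0 then \<mu> $ snd w else 0)" for w :: "(int^'d)\<times>'e"
    proof (cases "fst w = 0")
      case True
      hence "w = Pair 0 (snd w)" by (cases w) auto
      hence "pmf (init_pmf \<mu>) w = pmf (embed_pmf (\<lambda>j. \<mu> $ j)) (snd w)"
        unfolding init_pmf_def by (metis pmf_map_inj' inj_def prod.inject)
      thus ?thesis using True by (simp add: pmf_init[OF st])
    next
      case False
      thus ?thesis unfolding init_pmf_def by (auto intro!: pmf_map_outside)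
    qed
    have b: "bind_pmf (init_pmf \<mu>) (path_pmf p 0) = map_pmf (\<lambda>w. [w]) (init_pmf \<mu>)"
    proof -
      have "path_pmf p 0 = (\<lambda>w. return_pmf [w])" by (rule ext) simp
      thus ?thesis by (simp add: map_pmf_def)
    qed
    show ?case
    proof (cases "\<exists>w. l = [w]")
      case True
      then obtain w where l: "l = [w]" by auto
      have "pmf (map_pmf (\<lambda>w. [w]) (init_pmf \<mu>)) ((\<lambda>w. [w]) w) = pmf (init_pmf \<mu>) w"
        by (rule pmf_map_inj') (auto simp: inj_def)
      thus ?thesis unfolding b l using P0[of w] by (simp add: init history_def)
    next
      case False
      moreover have "history \<xi> 0 \<omega> = [\<xi> 0 \<omega>]" for \<omega> by (simp add: history_def)
      ultimately have "history \<xi> 0 \<omega> \<noteq> l" for \<omega> by metis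
      hence "{\<omega>\<in>space M. history \<xi> 0 \<omega> = l} = {}" by blast
      moreover have "pmf (map_pmf (\<lambda>w. [w]) (init_pmf \<mu>)) l = 0"
        using False by (auto intro!: pmf_map_outside)
      ultimately show ?thesis unfolding b by (simp only: measure_empty)
    qed
  next
    case (Suc n)
    let ?B = "bind_pmf (init_pmf \<mu>) (path_pmf p n)"
    have b: "bind_pmf (init_pmf \<mu>) (path_pmf p (Suc n))
           = bind_pmf ?B (\<lambda>l. map_pmf (\<lambda>s. l @ [s]) (trans_pmf p (last l)))"
      unfolding path_pmf_snoc[of p n] by (simp add: bind_assoc_pmf)
    show ?case
    proof (cases l rule: rev_cases)
      case Nil
      have "[] \<notin> set_pmf (bind_pmf (init_pmf \<mu>) (path_pmf p (Suc n)))"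
        by (auto simp del: path_pmf.simps dest: path_pmf_nonempty)
      hence "pmf (bind_pmf (init_pmf \<mu>) (path_pmf p (Suc n))) [] = 0"
        by (simp only: pmf_eq_0_set_pmf simp_thms)
      moreover have "{\<omega>\<in>space M. history \<xi> (Suc n) \<omega> = []} = {}" by (auto simp: history_def)
      ultimately show ?thesis using Nil by (simp only: measure_empty)
    next
      case (snoc h s)
      have R: "pmf (bind_pmf (init_pmf \<mu>) (path_pmf p (Suc n))) l = pmf ?B h * pmf (trans_pmf p (last h)) s"
        unfolding b snoc by (rule pmf_bind_map_snoc)
      have sub: "{\<omega>\<in>space M. history \<xi> (Suc n) \<omega> = l}
          = {\<omega>\<in>space M. \<xi> (Suc n) \<omega> = s \<and> history \<xi> n \<omega> = h}"
        by (auto simp: history_Suc snoc)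
      note hm = history_event[of \<xi> M n h, OF meas]
      show ?thesis
      proof (cases "prob {\<omega>\<in>space M. history \<xi> n \<omega> = h} = 0")
        case True
        have "prob {\<omega>\<in>space M. history \<xi> (Suc n) \<omega> = l} \<le> prob {\<omega>\<in>space M. history \<xi> n \<omega> = h}"
          unfolding sub by (rule finite_measure_mono[OF _ hm]) auto
        hence "prob {\<omega>\<in>space M. history \<xi> (Suc n) \<omega> = l} = 0"
          unfolding True by (simp add: measure_le_0_iff)
        thus ?thesis using True R Suc by (simp del: path_pmf.simps)
      next
        case False
        hence pos: "prob {\<omega>\<in>space M. history \<xi> n \<omega> = h} > 0" by (simp add: zero_less_measure_iff)
        then obtain \<omega> where "history \<xi> n \<omega> = h"
          by (metis (mono_tags, lifting) Collect_empty_eq measure_empty less_irrefl)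
        hence len: "length h = Suc n" by (auto simp: history_def)
        let ?x = "\<lambda>i. l ! i"
        have eq: "history \<xi> n \<omega> = h \<longleftrightarrow> (\<forall>i\<le>n. \<xi> i \<omega> = ?x i)" for \<omega>
          unfolding history_eq_iff[OF len] using len by (auto simp: snoc nth_append)
        have s: "?x (Suc n) = s" using len by (simp add: snoc nth_append)
        have la: "?x n = last h" using len by (simp add: snoc nth_append last_conv_nth flip: length_greater_0_conv)
        have "\<P>(\<omega> in M. \<xi> (Suc n) \<omega> = ?x (Suc n) \<bar> \<forall>i\<le>n. \<xi> i \<omega> = ?x i)
          = p (fst (?x (Suc n)) - fst (?x n)) (snd (?x n)) (snd (?x (Suc n)))"
          using W pos unfolding RWwIS_def eq by blast
        hence "\<P>(\<omega> in M. \<xi> (Suc n) \<omega> = s \<bar> history \<xi> n \<omega> = h) = pmf (trans_pmf p (last h)) s"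
          unfolding s la pmf_trans[OF p] eq .
        hence "prob {\<omega>\<in>space M. history \<xi> (Suc n) \<omega> = l}
            = prob {\<omega>\<in>space M. history \<xi> n \<omega> = h} * pmf (trans_pmf p (last h)) s"
          unfolding sub cond_prob_def using False by (simp add: field_simps)
        thus ?thesis unfolding R Suc by simp
      qed
    qed
  qed
qed

lemma expected_visited_eq:
  fixes \<xi> :: "nat \<Rightarrow> 'w \<Rightarrow> (int ^ 'd::finite) \<times> 'e::finite"
  assumes p: "stochastic_kernel p" and st: "stationary_distribution (Q_mat p) \<mu>"
    and W: "RWwIS p M \<xi>" and I: "initial_state_law M \<xi> \<mu>"
  shows "expected_visited M \<xi> n = (\<Sum>m\<le>n. \<Sum>j\<in>UNIV. \<mu> $ j * escape p m j)"
proof -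
  interpret prob_space M using W by (simp add: RWwIS_def)
  have meas[measurable]: "\<xi> n \<in> M \<rightarrow>\<^sub>M count_space UNIV" for n using W by (simp add: RWwIS_def)
  let ?P = "bind_pmf (init_pmf \<mu>) (path_pmf p n)"
  have hist[measurable]: "history \<xi> n \<in> M \<rightarrow>\<^sub>M count_space UNIV"
    using history_event[of \<xi> M n, OF meas]
    by (subst measurable_count_space_eq2_countable) (auto simp: vimage_def Int_def conj_commute)
  have "distr M (count_space UNIV) (history \<xi> n) = measure_pmf ?P"
  proof (rule measure_eqI_countable[where A=UNIV])
    fix l :: "((int ^ 'd) \<times> 'e) list"
    have "emeasure (distr M (count_space UNIV) (history \<xi> n)) {l} = emeasure M {\<omega>\<in>space M. history \<xi> n \<omega> = l}"
      by (subst emeasure_distr) (auto intro!: arg_cong2[where f=emeasure])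
    also have "\<dots> = ennreal (pmf ?P l)"
      by (simp add: emeasure_eq_measure history_law[OF assms])
    finally show "emeasure (distr M (count_space UNIV) (history \<xi> n)) {l} = emeasure ?P {l}"
      by (simp add: emeasure_pmf_single)
  qed auto
  moreover have "real (visited_sites \<xi> n \<omega>) = range_size (history \<xi> n \<omega>)" for \<omega>
  proof -
    have "fst ` set (history \<xi> n \<omega>) = (\<lambda>i. fst (\<xi> i \<omega>)) ` {..n}"
      by (auto simp: history_def image_image atLeast0LessThan lessThan_Suc_atMost simp del: upt_Suc)
    thus ?thesis by (simp add: visited_sites_def range_size_def)
  qed
  hence "expected_visited M \<xi> n = (\<integral>l. range_size l \<partial>distr M (count_space UNIV) (history \<xi> n))"
    by (simp add: expected_visited_def integral_distr[OF hist])
  ultimately have "expected_visited M \<xi> n = mean ?P range_size" by simp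
  also have "\<dots> = mean (init_pmf \<mu>) (expected_range p n)"
    unfolding expected_range_def
  proof (rule expectation_bind_pmf_real[where B="real (Suc n)"])
    fix l assume "l \<in> set_pmf ?P"
    hence "length l = Suc n" by (auto dest: path_pmf_length)
    thus "\<bar>range_size l\<bar> \<le> real (Suc n)" using range_size_bound[of l] by simp
  qed
  also have "\<dots> = (\<Sum>m\<le>n. \<Sum>j\<in>UNIV. \<mu> $ j * escape p m j)"
    by (simp add: expectation_init[OF st] expected_range_stationary[OF p st])
  finally show ?thesis .
qed

section \<open>The characteristic operator\<close>

definition real_vec :: "int ^ 'd \<Rightarrow> real ^ 'd" where
  "real_vec z = (\<chi> l. real_of_int (z $ l))"

lemma lattice_norm_real_vec: "lattice_norm z = norm (real_vec z)"
  by (simp add: lattice_norm_def real_vec_def)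

lemma real_vec_simps: "real_vec (x + y) = real_vec x + real_vec y" "real_vec (x - y) = real_vec x - real_vec y" "real_vec 0 = 0"
  by (simp_all add: real_vec_def vec_eq_iff)

text \<open>
  The Fourier transform of the one-step kernel, as an operator on functions of the internal state.
\<close>

definition char_op ::
  "('d::finite, 'e::finite) kernel \<Rightarrow> real ^ 'd \<Rightarrow> ('e \<Rightarrow> complex) \<Rightarrow> 'e \<Rightarrow> complex" where
  "char_op p t f j =
     mean (step_pmf p j) (\<lambda>v. iexp (t \<bullet> real_vec (fst v)) * f (snd v))"

lemma finite_range_bound:
  fixes f :: "'e::finite \<Rightarrow> complex"
  obtains B where "0 \<le> B" "\<And>k. cmod (f k) \<le> B"
proof -
  have "cmod (f k) \<le> (\<Sum>k\<in>UNIV. cmod (f k))" for k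
    by (rule member_le_sum) auto
  thus ?thesis using that[of "\<Sum>k\<in>UNIV. cmod (f k)"] by (simp add: sum_nonneg)
qed

lemma integrable_char:
  fixes f :: "'e::finite \<Rightarrow> complex"
  shows "integrable (measure_pmf P) (\<lambda>v. iexp (t \<bullet> real_vec (fst v)) * f (snd v))"
proof -
  obtain B where "\<And>k. cmod (f k) \<le> B" using finite_range_bound by blast
  thus ?thesis by (intro integrable_pmf_bounded[where B=B]) (simp add: norm_mult)
qed

lemma char_op_bound:
  assumes "\<And>k. cmod (f k) \<le> B"
  shows "cmod (char_op p t f j) \<le> B"
  unfolding char_op_def by (rule norm_expectation_le) (simp add: norm_mult assms)

lemma char_op_pow_bound:
  assumes "\<And>k. cmod (f k) \<le> B"
  shows "cmod ((char_op p t ^^ n) f j) \<le> B"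
  by (induction n arbitrary: j) (simp_all add: assms char_op_bound)

lemma char_op_add: "char_op p t (\<lambda>k. f k + g k) j = char_op p t f j + char_op p t g j"
  unfolding char_op_def using integrable_char
  by (subst Bochner_Integration.integral_add[symmetric]) (auto simp: distrib_left)

lemma char_op_scale: "char_op p t (\<lambda>k. c * f k) j = c * char_op p t f j"
  unfolding char_op_def
  by (subst Bochner_Integration.integral_mult_right_zero[symmetric]) (simp add: mult_ac)

lemma char_op_pow_add:
  "(char_op p t ^^ n) (\<lambda>k. f k + g k) j = (char_op p t ^^ n) f j + (char_op p t ^^ n) g j"
proof (induction n arbitrary: j)
  case (Suc n)
  have "(char_op p t ^^ n) (\<lambda>k. f k + g k) = (\<lambda>k. (char_op p t ^^ n) f k + (char_op p t ^^ n) g k)"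
    using Suc by (rule ext)
  thus ?case by (simp add: char_op_add)
qed simp

lemma char_op_pow_scale: "(char_op p t ^^ n) (\<lambda>k. c * f k) j = c * (char_op p t ^^ n) f j"
proof (induction n arbitrary: j)
  case (Suc n)
  have "(char_op p t ^^ n) (\<lambda>k. c * f k) = (\<lambda>k. c * (char_op p t ^^ n) f k)"
    using Suc by (rule ext)
  thus ?case by (simp add: char_op_scale)
qed simp

lemma char_op_pow_diff:
  "(char_op p t ^^ n) (\<lambda>k. f k - g k) j = (char_op p t ^^ n) f j - (char_op p t ^^ n) g j"
  using char_op_pow_add[where p=p and n=n and t=t and j=j and f=f and g="\<lambda>k. (-1) * g k"]
    char_op_pow_scale[where p=p and n=n and t=t and j=j and c="-1" and f=g] by simp

text \<open>
  The functions \<open>exp (\<i> * (t \<bullet> y)) * f k\<close> keep this form under the transition operator of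
  the walk, which acts on the factor \<open>f\<close> as the characteristic operator.
\<close>

lemma char_op_pow_walk:
  "mean (walk_pmf p n w) (\<lambda>v. iexp (t \<bullet> real_vec (fst v)) * f (snd v))
     = iexp (t \<bullet> real_vec (fst w)) * (char_op p t ^^ n) f (snd w)"
proof (induction n arbitrary: w)
  case (Suc n)
  obtain B where B: "\<And>k. cmod (f k) \<le> B" using finite_range_bound by blast
  let ?F = "\<lambda>f v. iexp (t \<bullet> real_vec (fst v)) * f (snd v)"
  have "mean (walk_pmf p (Suc n) w) (?F f)
      = mean (trans_pmf p w) (\<lambda>v. mean (walk_pmf p n v) (?F f))"
    unfolding walk_pmf.simps by (rule expectation_bind_pmf_complex[where B=B]) (simp add: norm_mult B)
  also have "\<dots> = mean (trans_pmf p w) (?F ((char_op p t ^^ n) f))"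
    unfolding Suc ..
  also have "\<dots> = mean (step_pmf p (snd w))
       (\<lambda>v. iexp (t \<bullet> real_vec (fst w)) * ?F ((char_op p t ^^ n) f) v)"
    by (simp add: trans_pmf_def shift_def real_vec_simps inner_add_right distrib_left exp_add mult_ac)
  also have "\<dots> = iexp (t \<bullet> real_vec (fst w)) * (char_op p t ^^ Suc n) f (snd w)"
    by (simp add: char_op_def)
  finally show ?case .
qed simp

section \<open>Decay of the powers of the characteristic operator\<close>

text \<open>
  Two unimodular numbers with different phases add up to less than the sum of their weights; a
  common part \<open>q\<close> of the weights already produces a quantitative loss.
\<close>

lemma two_phases:
  fixes A B a b q :: real
  assumes "0 \<le> q" "q \<le> A" "q \<le> B"
  shows "cmod (A * iexp a + B * iexp b) \<le> A + B - q / 2 * (1 - cos (a - b))"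
proof -
  let ?c = "1 - cos (a - b)"
  have c2: "0 \<le> 2 - ?c / 2"
  proof -
    have "-1 \<le> cos (a - b)" by (rule cos_ge_minus_one)
    thus ?thesis by argo
  qed
  have "(cmod (iexp a + iexp b))\<^sup>2 = (cos a + cos b)\<^sup>2 + (sin a + sin b)\<^sup>2"
    by (simp add: cmod_power2 Re_exp Im_exp)
  also have "\<dots> = 4 - 2 * ?c"
    by (simp add: cos_diff power2_sum cos_squared_eq algebra_simps)
  also have "\<dots> \<le> 4 - 2 * ?c + (?c / 2)\<^sup>2" by simp
  also have "\<dots> = (2 - ?c / 2)\<^sup>2" by (simp add: power2_eq_square field_simps)
  finally have s: "cmod (iexp a + iexp b) \<le> 2 - ?c / 2"
    by (rule power2_le_imp_le) (simp only: c2)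
  have "A * iexp a + B * iexp b = of_real (A - q) * iexp a + of_real (B - q) * iexp b + q * (iexp a + iexp b)"
    by (simp add: algebra_simps)
  also have "cmod \<dots> \<le> (A - q) + (B - q) + q * cmod (iexp a + iexp b)"
    using assms
    by (intro order_trans[OF norm_triangle_ineq] add_mono) (auto simp: norm_mult simp flip: of_real_diff)
  also have "\<dots> \<le> (A - q) + (B - q) + q * (2 - ?c / 2)"
    using s assms by (intro add_left_mono mult_left_mono)
  also have "\<dots> = A + B - q / 2 * ?c" by (simp add: field_simps)
  finally show ?thesis .
qed

text \<open>
  The powers of the characteristic operator shrink the value at \<open>j\<close> unless the phase of \<open>t\<close> along
  the displacement \<open>d\<close> is trivial. Demanding the bound for all large exponents makes it possible to
  combine several displacements, and the set of displacements with this property is a group.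
\<close>

definition contracts :: "('d::finite, 'e::finite) kernel \<Rightarrow> 'e \<Rightarrow> int ^ 'd \<Rightarrow> bool" where
  "contracts p j d \<longleftrightarrow> (\<exists>m \<kappa>. \<kappa> > 0 \<and> (\<forall>n\<ge>m. \<forall>t f. (\<forall>k. cmod (f k) \<le> 1) \<longrightarrow>
      cmod ((char_op p t ^^ n) f j) \<le> 1 - \<kappa> * (1 - cos (t \<bullet> real_vec d))))"

text \<open>
  Two loops at \<open>j\<close> of the same length, with displacements \<open>y\<close> and \<open>y'\<close>, contribute two terms of different
  phase to the same coefficient.
\<close>

lemma contracts_difference:
  assumes "pmf (walk_pmf p n (0, j)) (y, j) > 0" "pmf (walk_pmf p n (0, j)) (y', j) > 0"
  shows "contracts p j (y - y')"
proof -
  define P where "P = walk_pmf p n (0, j)"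
  define A where "A = pmf P (y, j)"
  define B where "B = pmf P (y', j)"
  define q where "q = min A B"
  have q: "0 < q" "q \<le> A" "q \<le> B" using assms by (auto simp: q_def A_def B_def P_def)
  have main: "cmod ((char_op p t ^^ n) f j) \<le> 1 - q / 2 * (1 - cos (t \<bullet> real_vec (y - y')))"
    if f: "\<And>k. cmod (f k) \<le> 1" for t f
  proof (cases "y = y'")
    case True
    thus ?thesis using char_op_pow_bound[of f 1] f by (simp add: real_vec_simps)
  next
    case False
    let ?F = "\<lambda>v. iexp (t \<bullet> real_vec (fst v)) * f (snd v)"
    let ?S = "{(y, j), (y', j)}"
    have "(char_op p t ^^ n) f j = mean P ?F"
      using char_op_pow_walk[where p=p and n=n and w="(0, j)" and t=t and f=f] by (simp add: P_def real_vec_simps)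
    also have "\<dots> = mean P (\<lambda>v. indicator (- ?S) v *\<^sub>R ?F v + indicator ?S v *\<^sub>R ?F v)"
      by (intro Bochner_Integration.integral_cong) (auto simp: indicator_def)
    also have "\<dots> = mean P (\<lambda>v. indicator (- ?S) v *\<^sub>R ?F v)
                  + mean P (\<lambda>v. indicator ?S v *\<^sub>R ?F v)"
      by (intro Bochner_Integration.integral_add integrable_pmf_bounded[where B=1])
         (auto simp: indicator_def norm_mult f)
    also have "mean P (\<lambda>v. indicator ?S v *\<^sub>R ?F v)
      = (\<Sum>v\<in>?S. pmf P v *\<^sub>R (indicator ?S v *\<^sub>R ?F v))"
      by (rule integral_measure_pmf) (auto simp: indicator_def split: if_splits)
    also have "\<dots> = (A * iexp (t \<bullet> real_vec y) + B * iexp (t \<bullet> real_vec y')) * f j"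
      using False by (simp add: A_def B_def scaleR_conv_of_real algebra_simps)
    finally have eq: "(char_op p t ^^ n) f j = mean P (\<lambda>v. indicator (- ?S) v *\<^sub>R ?F v)
        + (A * iexp (t \<bullet> real_vec y) + B * iexp (t \<bullet> real_vec y')) * f j" .
    have "cmod (mean P (\<lambda>v. indicator (- ?S) v *\<^sub>R ?F v))
        \<le> mean P (\<lambda>v. cmod (indicator (- ?S) v *\<^sub>R ?F v))"
      by (rule integral_norm_bound)
    also have "\<dots> \<le> mean P (indicator (- ?S))"
      by (intro integral_mono integrable_pmf_bounded[where B=1]) (auto simp: indicator_def norm_mult f)
    also have "\<dots> = 1 - measure_pmf.prob P ?S"
      using measure_pmf.prob_compl[of ?S P] by (simp add: Compl_eq_Diff_UNIV)
    also have "measure_pmf.prob P ?S = A + B"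
      using False by (simp add: measure_measure_pmf_finite A_def B_def)
    finally have 1: "cmod (mean P (\<lambda>v. indicator (- ?S) v *\<^sub>R ?F v)) \<le> 1 - (A + B)" .
    have tp: "cmod (A * iexp (t \<bullet> real_vec y) + B * iexp (t \<bullet> real_vec y'))
        \<le> A + B - q / 2 * (1 - cos (t \<bullet> real_vec y - t \<bullet> real_vec y'))"
      using q by (intro two_phases) auto
    have "cmod ((A * iexp (t \<bullet> real_vec y) + B * iexp (t \<bullet> real_vec y')) * f j)
        \<le> (A + B - q / 2 * (1 - cos (t \<bullet> real_vec y - t \<bullet> real_vec y'))) * 1"
      unfolding norm_mult by (rule mult_mono[OF tp f order_trans[OF norm_ge_zero tp] norm_ge_zero])
    with 1 show ?thesis
      unfolding eq by (intro order_trans[OF norm_triangle_ineq]) (simp add: real_vec_simps inner_diff_right)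
  qed
  have "cmod ((char_op p t ^^ N) f j) \<le> 1 - q / 2 * (1 - cos (t \<bullet> real_vec (y - y')))"
    if f: "\<And>k. cmod (f k) \<le> 1" and N: "N \<ge> n" for t f N
  proof -
    have "N = n + (N - n)" using N by simp
    hence "(char_op p t ^^ N) f = (char_op p t ^^ n) ((char_op p t ^^ (N - n)) f)"
      by (metis funpow_add o_apply)
    moreover have "cmod ((char_op p t ^^ (N - n)) f k) \<le> 1" for k
      by (rule char_op_pow_bound) (rule f)
    ultimately show ?thesis using main[of "(char_op p t ^^ (N - n)) f" t] by simp
  qed
  thus ?thesis unfolding contracts_def using q(1)
    by (intro exI[of _ n] exI[of _ "q / 2"]) auto
qed

text \<open>
  As \<open>1 - cos a\<close> is half the squared distance of \<open>exp (\<i> * a)\<close> from \<open>1\<close>, this is the triangle inequality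
  on the unit circle, squared.
\<close>

lemma cos_diff_ge: "1 - cos (a - b) \<le> 2 * (1 - cos a) + 2 * (1 - cos b)" for a b :: real
proof -
  have "2 * (1 - cos a) + 2 * (1 - cos b) - (1 - cos (a - b))
      = (1 - cos a) ^ 2 / 2 + (1 - cos b)^2 / 2 + (1 - cos a) * (1 - cos b) + ((sin a)\<^sup>2 + (sin b)\<^sup>2) / 2 + sin a * sin b
        + 0"
    unfolding cos_diff by (simp add: power2_diff cos_squared_eq field_simps)
  also have "\<dots> = ((1 - cos a) + (1 - cos b))\<^sup>2 / 2 + (sin a + sin b)\<^sup>2 / 2"
    by (simp add: power2_eq_square field_simps)
  finally show ?thesis by (smt (verit) zero_le_power2 divide_nonneg_nonneg)
qed

lemma contracts_diff:
  assumes "contracts p j d" "contracts p j d'"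
  shows "contracts p j (d - d')"
proof -
  obtain m \<kappa> where 1: "\<kappa> > 0" "\<And>n t f. n \<ge> m \<Longrightarrow> (\<And>k. cmod (f k) \<le> 1) \<Longrightarrow>
      cmod ((char_op p t ^^ n) f j) \<le> 1 - \<kappa> * (1 - cos (t \<bullet> real_vec d))"
    using assms(1) unfolding contracts_def by blast
  obtain m' \<kappa>' where 2: "\<kappa>' > 0" "\<And>n t f. n \<ge> m' \<Longrightarrow> (\<And>k. cmod (f k) \<le> 1) \<Longrightarrow>
      cmod ((char_op p t ^^ n) f j) \<le> 1 - \<kappa>' * (1 - cos (t \<bullet> real_vec d'))"
    using assms(2) unfolding contracts_def by blast
  define q where "q = min \<kappa> \<kappa>'"
  have q: "q > 0" "q \<le> \<kappa>" "q \<le> \<kappa>'" using 1 2 by (auto simp: q_def)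
  have "cmod ((char_op p t ^^ n) f j) \<le> 1 - q / 4 * (1 - cos (t \<bullet> real_vec (d - d')))"
    if "n \<ge> max m m'" "\<And>k. cmod (f k) \<le> 1" for n t f
  proof -
    let ?X = "cmod ((char_op p t ^^ n) f j)"
    have "?X \<le> 1 - \<kappa> * (1 - cos (t \<bullet> real_vec d))" "?X \<le> 1 - \<kappa>' * (1 - cos (t \<bullet> real_vec d'))"
      using 1(2)[of n f t] 2(2)[of n f t] that by auto
    moreover have "q * (1 - cos (t \<bullet> real_vec d)) \<le> \<kappa> * (1 - cos (t \<bullet> real_vec d))"
                  "q * (1 - cos (t \<bullet> real_vec d')) \<le> \<kappa>' * (1 - cos (t \<bullet> real_vec d'))"
      using q by (auto intro!: mult_right_mono)
    moreover have "q * (1 - cos (t \<bullet> real_vec (d - d')))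
        \<le> q * (2 * (1 - cos (t \<bullet> real_vec d)) + 2 * (1 - cos (t \<bullet> real_vec d')))"
      using q cos_diff_ge[of "t \<bullet> real_vec d" "t \<bullet> real_vec d'"]
      by (intro mult_left_mono) (auto simp: real_vec_simps inner_diff_right)
    ultimately show ?thesis by (simp add: algebra_simps)
  qed
  thus ?thesis unfolding contracts_def using q(1)
    by (intro exI[of _ "max m m'"] exI[of _ "q / 4"]) auto
qed

lemma contracts_all:
  assumes p: "stochastic_kernel p" and ta: "trivial_arithmetic p"
  shows "contracts p j d"
proof -
  let ?D = "{y - y' | y y'. \<exists>n\<ge>1. n_step p n (0, j) (y, j) > 0 \<and> n_step p n (0, j) (y', j) > 0}"
  have "d \<in> group_closure ?D" using ta by (auto simp: trivial_arithmetic_def)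
  thus ?thesis
  proof (induction rule: group_closure.induct)
    case (base s)
    show ?case
    proof (cases "s = 0")
      case True
      thus ?thesis unfolding contracts_def
        by (intro exI[of _ 0] exI[of _ 1]) (auto simp: real_vec_simps char_op_pow_bound)
    next
      case False
      then obtain y y' n where "s = y - y'"
          "n_step p n (0, j) (y, j) > 0" "n_step p n (0, j) (y', j) > 0" using base by auto
      thus ?thesis using contracts_difference[of p n j y y'] by (simp add: n_step_eq_walk[OF p])
    qed
  qed (rule contracts_diff)
qed

text \<open>
  The Taylor bound for the cosine at the half angle \<open>u = x / 2\<close> suffices: there \<open>u\<^sup>2 \<le> 4\<close>, and
  \<open>1 - cos x = 2 * (1 - cos u) * (1 + cos u)\<close> loses only the factor \<open>1 + cos u \<ge> 1\<close>.
\<close>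

lemma one_minus_cos_ge:
  fixes x :: real assumes "\<bar>x\<bar> \<le> pi"
  shows "x\<^sup>2 / 6 \<le> 1 - cos x"
proof -
  define u where "u = x / 2"
  have u: "\<bar>u\<bar> \<le> pi / 2" using assms by (simp add: u_def)
  hence u2: "u\<^sup>2 \<le> 4"
    using pi_half_less_two power2_le_iff_abs_le[of 2 u] by simp
  have c: "0 \<le> cos u" using u by (intro cos_ge_zero) auto
  define S where "S = (\<Sum>k\<le>3. (\<i> * u)^k / fact k)"
  have "\<bar>Re (iexp u - S)\<bar> \<le> \<bar>u\<bar>^4 / fact 4"
    unfolding S_def using order_trans[OF abs_Re_le_cmod iexp_approx1[of u 3]] by simp
  moreover have "Re S = 1 - u\<^sup>2 / 2"
  proof -
    have "{..3} = {0, 1, 2, 3::nat}" by auto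
    moreover have "(\<i> * u)^2 = of_real (- (u^2))" "(\<i> * u)^3 = - \<i> * of_real (u^3)"
      by (simp_all add: power_mult_distrib power3_eq_cube[of \<i>])
    ultimately show ?thesis by (simp add: S_def fact_numeral)
  qed
  moreover have "Re (iexp u) = cos u" by (simp add: Re_exp)
  moreover have "\<bar>u\<bar>^4 / fact 4 = u^4 / 24" by (simp add: fact_numeral)
  ultimately have "\<bar>cos u - (1 - u\<^sup>2 / 2)\<bar> \<le> u^4 / 24"
    by (simp only: minus_complex.sel)
  hence "u\<^sup>2 / 2 - u ^ 4 / 24 \<le> 1 - cos u" by linarith
  moreover have "u ^ 4 \<le> u\<^sup>2 * 4"
  proof -
    have "u ^ 4 = u\<^sup>2 * u\<^sup>2" by (simp add: power4_eq_xxxx power2_eq_square)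
    thus ?thesis using mult_left_mono[OF u2, of "u\<^sup>2"] by simp
  qed
  ultimately have "u\<^sup>2 / 3 \<le> 1 - cos u" by linarith
  also have "\<dots> \<le> (1 - cos u) * (1 + cos u)" using c mult_left_mono[of 1 "1 + cos u" "1 - cos u"] by simp
  also have "\<dots> = (1 - cos x) / 2"
    using cos_double_cos[of u] by (simp add: u_def power2_eq_square algebra_simps)
  finally show ?thesis by (simp add: u_def power2_eq_square)
qed

text \<open>
  A closed fundamental domain for the characters of the lattice.
\<close>

definition period_cube :: "(real ^ 'd::finite) set" where
  "period_cube = {t. \<forall>l. \<bar>t $ l\<bar> \<le> pi}"

lemma period_cube_norm: "t \<in> period_cube \<Longrightarrow> (norm (t :: real ^ 'd::finite))\<^sup>2 \<le> CARD('d) * pi\<^sup>2"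
proof -
  assume t: "t \<in> period_cube"
  have "(norm t)\<^sup>2 = (\<Sum>l\<in>UNIV. (t $ l)\<^sup>2)" by (simp add: norm_vec_def L2_set_def sum_nonneg)
  also have "\<dots> \<le> (\<Sum>l\<in>(UNIV::'d set). pi\<^sup>2)"
    using t by (intro sum_mono) (auto simp: period_cube_def abs_le_square_iff[symmetric])
  finally show ?thesis by simp
qed

text \<open>
  Applied to the unit vectors of the lattice, \<open>contracts\<close> bounds the loss below by the square of
  every coordinate of \<open>t\<close>, as long as \<open>t\<close> stays in the period cube.
\<close>

lemma char_op_contraction:
  fixes p :: "('d::finite, 'e::finite) kernel"
  assumes p: "stochastic_kernel p" and ta: "trivial_arithmetic p"
  shows "\<exists>M c. c > 0 \<and> (\<forall>t\<in>period_cube. \<forall>f j. (\<forall>k. cmod (f k) \<le> 1) \<longrightarrow>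
      cmod ((char_op p t ^^ Suc M) f j) \<le> 1 - c * (norm t)\<^sup>2)"
proof -
  have "\<forall>j l. \<exists>m \<kappa>. \<kappa> > 0 \<and> (\<forall>n\<ge>m. \<forall>t f. (\<forall>k. cmod (f k) \<le> 1) \<longrightarrow>
      cmod ((char_op p t ^^ n) f j) \<le> 1 - \<kappa> * (1 - cos (t \<bullet> real_vec (axis l 1))))"
    using contracts_all[OF p ta] unfolding contracts_def by blast
  then obtain m \<kappa> where m: "\<And>j l. \<kappa> j l > 0"
      "\<And>j l n t f. n \<ge> m j l \<Longrightarrow> (\<And>k. cmod (f k) \<le> 1) \<Longrightarrow>
      cmod ((char_op p t ^^ n) f j) \<le> 1 - \<kappa> j l * (1 - cos (t \<bullet> real_vec (axis l 1)))"
    by metis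
  define M where "M = (\<Sum>(j,l)\<in>UNIV. m j l)"
  define q where "q = Min (range (\<lambda>(j,l). \<kappa> j l))"
  have M: "m j l \<le> M" for j l
    unfolding M_def using member_le_sum[of "(j,l)" UNIV "\<lambda>(j,l). m j l"] by simp
  have q: "q \<le> \<kappa> j l" for j l unfolding q_def by (rule Min_le) auto
  have q0: "q > 0" unfolding q_def using m(1) by (subst Min_gr_iff) auto
  have ax: "t \<bullet> real_vec (axis l 1) = t $ l" for t :: "real ^ 'd" and l
  proof -
    have "real_vec (axis l 1) = axis l 1" by (simp add: real_vec_def axis_def vec_eq_iff)
    thus ?thesis by (simp add: inner_axis)
  qed
  have "cmod ((char_op p t ^^ Suc M) f j) \<le> 1 - q / (6 * CARD('d)) * (norm t)\<^sup>2"
    if t: "t \<in> period_cube" and f: "\<And>k. cmod (f k) \<le> 1" for t f j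
  proof -
    let ?X = "cmod ((char_op p t ^^ Suc M) f j)"
    have "?X \<le> 1 - q / 6 * (t $ l)\<^sup>2" for l
    proof -
      have "?X \<le> 1 - \<kappa> j l * (1 - cos (t $ l))"
        using m(2)[of j l "Suc M" f t] M[of j l] f by (simp add: ax del: funpow.simps)
      moreover have "q * ((t $ l)\<^sup>2 / 6) \<le> \<kappa> j l * (1 - cos (t $ l))"
        using q[of j l] q0 t by (intro mult_mono one_minus_cos_ge) (auto simp: period_cube_def)
      ultimately show ?thesis by simp
    qed
    hence "(\<Sum>l\<in>(UNIV::'d set). ?X) \<le> (\<Sum>l\<in>(UNIV::'d set). 1 - q / 6 * (t $ l)\<^sup>2)"
      by (intro sum_mono) auto
    also have "\<dots> = CARD('d) - q / 6 * (norm t)\<^sup>2"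
      by (simp add: sum_subtractf sum_distrib_left[symmetric] norm_vec_def L2_set_def sum_nonneg
           flip: sum_divide_distrib)
    finally have "CARD('d) * ?X \<le> CARD('d) - q / 6 * (norm t)\<^sup>2" by simp
    hence "?X \<le> (CARD('d) - q / 6 * (norm t)\<^sup>2) / CARD('d)" by (simp add: field_simps)
    thus ?thesis by (simp add: field_simps)
  qed
  moreover have "q / (6 * CARD('d)) > 0" using q0 by simp
  ultimately show ?thesis by blast
qed

text \<open>
  Iterating the contraction over blocks of \<open>Suc M\<close> steps. The incomplete last block costs only a
  constant, since \<open>norm t\<close> is bounded on the period cube.
\<close>

lemma char_op_decay:
  fixes p :: "('d::finite, 'e::finite) kernel"
  assumes p: "stochastic_kernel p" and ta: "trivial_arithmetic p"
  shows "\<exists>C c. c > 0 \<and> C > 0 \<and> (\<forall>t\<in>period_cube. \<forall>n f B j. (\<forall>k. cmod (f k) \<le> B) \<longrightarrow>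
      cmod ((char_op p t ^^ n) f j) \<le> C * B * exp (- c * n * (norm t)\<^sup>2))"
proof -
  obtain c M where c: "c > 0" and M: "\<And>t f j. t \<in> period_cube \<Longrightarrow> (\<And>k. cmod (f k) \<le> 1) \<Longrightarrow>
      cmod ((char_op p t ^^ Suc M) f j) \<le> 1 - c * (norm t)\<^sup>2"
    using char_op_contraction[OF p ta] by metis
  define a where "a = c / Suc M"
  define C where "C = exp (c * (CARD('d) * pi\<^sup>2))"
  have step: "cmod ((char_op p t ^^ Suc M) f j) \<le> exp (- c * (norm t)\<^sup>2) * B"
    if t: "t \<in> period_cube" and f: "\<And>k. cmod (f k) \<le> B" for t f B j
  proof (cases "B > 0")
    case False
    hence "cmod (f k) = 0" for k using f[of k] by (smt (verit) norm_ge_zero)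
    hence "f = (\<lambda>k. 0)" "B = 0"
      using False f[of undefined] by (auto simp: fun_eq_iff)
    thus ?thesis using char_op_pow_bound[where f="\<lambda>k. 0" and B=0 and p=p and t=t and n="Suc M" and j=j] by simp
  next
    case True
    have "(char_op p t ^^ Suc M) f j = B * (char_op p t ^^ Suc M) (\<lambda>k. (1 / B) * f k) j"
      unfolding char_op_pow_scale using True by simp
    hence "cmod ((char_op p t ^^ Suc M) f j) = B * cmod ((char_op p t ^^ Suc M) (\<lambda>k. (1 / B) * f k) j)"
      using True by (simp add: norm_mult del: funpow.simps)
    also have "\<dots> \<le> B * (1 - c * (norm t)\<^sup>2)"
      using True f by (intro mult_left_mono M t) (auto simp: norm_divide norm_mult)
    also have "\<dots> \<le> B * exp (- c * (norm t)\<^sup>2)"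
      using True exp_ge_add_one_self[of "- c * (norm t)\<^sup>2"] by (intro mult_left_mono) auto
    finally show ?thesis by (simp add: mult.commute)
  qed
  have pow: "cmod ((char_op p t ^^ (Suc M * k)) f j) \<le> exp (- c * (norm t)\<^sup>2) ^ k * B"
    if t: "t \<in> period_cube" and f: "\<And>k. cmod (f k) \<le> B" for t f B j k
  proof (induction k arbitrary: j)
    case (Suc k)
    have "Suc M * Suc k = Suc M + Suc M * k" by simp
    hence "(char_op p t ^^ (Suc M * Suc k)) f = (char_op p t ^^ Suc M) ((char_op p t ^^ (Suc M * k)) f)"
      by (metis funpow_add o_apply)
    hence "cmod ((char_op p t ^^ (Suc M * Suc k)) f j) \<le> exp (- c * (norm t)\<^sup>2) * (exp (- c * (norm t)\<^sup>2) ^ k * B)"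
      using step[where j=j, OF t Suc.IH] by (simp only:)
    thus ?case by (simp add: mult.assoc)
  qed (use f in simp)
  have "cmod ((char_op p t ^^ n) f j) \<le> C * B * exp (- a * n * (norm t)\<^sup>2)"
    if t: "t \<in> period_cube" and f: "\<And>k. cmod (f k) \<le> B" for t f B j n
  proof -
    have B: "B \<ge> 0" using f[of undefined] by (smt (verit) norm_ge_zero)
    define k r where "k = n div Suc M" and "r = n mod Suc M"
    have n: "n = Suc M * k + r" unfolding k_def r_def by (rule mult_div_mod_eq[symmetric])
    have r: "r \<le> Suc M" by (simp add: r_def less_imp_le)
    have "(char_op p t ^^ n) f = (char_op p t ^^ (Suc M * k)) ((char_op p t ^^ r) f)"
      unfolding n by (metis funpow_add o_apply)
    hence "cmod ((char_op p t ^^ n) f j) \<le> exp (- c * (norm t)\<^sup>2) ^ k * B"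
      using pow[where f="(char_op p t ^^ r) f" and k=k and j=j, OF t char_op_pow_bound, OF f]
      by (simp only:)
    also have "exp (- c * (norm t)\<^sup>2) ^ k = exp (- c * k * (norm t)\<^sup>2)"
      by (simp add: exp_of_nat_mult[symmetric] mult_ac)
    also have "\<dots> \<le> C * exp (- a * n * (norm t)\<^sup>2)"
    proof -
      have "real n \<le> Suc M * (k + 1)" using r unfolding n by (simp add: algebra_simps)
      hence "a * n \<le> a * (Suc M * (k + 1))" using c by (intro mult_left_mono) (auto simp: a_def)
      also have "\<dots> = c * (k + 1)" by (simp add: a_def field_simps)
      finally have "a * n * (norm t)\<^sup>2 \<le> c * (k + 1) * (norm t)\<^sup>2" by (rule mult_right_mono) auto
      moreover have "c * (norm t)\<^sup>2 \<le> c * (CARD('d) * pi\<^sup>2)"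
        using period_cube_norm[OF t] c by (intro mult_left_mono) auto
      ultimately have "- c * k * (norm t)\<^sup>2 \<le> c * (CARD('d) * pi\<^sup>2) + (- a * n * (norm t)\<^sup>2)"
        by (simp add: algebra_simps)
      thus ?thesis unfolding C_def exp_add[symmetric] by simp
    qed
    finally show ?thesis using B by (simp add: mult_ac mult_right_mono)
  qed
  moreover have "a > 0" "C > 0" using c by (auto simp: a_def C_def)
  ultimately show ?thesis by blast
qed

section \<open>The Poisson equation for the internal states\<close>

lemma integrable_pmf_if_summable:
  fixes f :: "'a \<Rightarrow> real"
  assumes "(\<lambda>x. norm (pmf P x * f x)) summable_on UNIV"
  shows "integrable (measure_pmf P) f"
proof -
  have "Infinite_Set_Sum.abs_summable_on (\<lambda>x. pmf P x * f x) UNIV"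
    using assms by (simp only: abs_summable_equivalent)
  thus ?thesis
    unfolding measure_pmf_eq_density Infinite_Set_Sum.abs_summable_on_def set_integrable_def
    by (simp add: integrable_density)
qed

lemma moment_integrable:
  fixes p :: "('d::finite, 'e::finite) kernel"
  assumes p: "stochastic_kernel p" and m: "moment_converges r p"
  shows "integrable (measure_pmf (step_pmf p j)) (\<lambda>v. norm (real_vec (fst v)) ^ r)"
proof -
  let ?g = "\<lambda>v :: (int ^ 'd) \<times> 'e. norm (real_vec (fst v)) ^ r"
  have int: "integrable (measure_pmf (step_pmf p j)) (\<lambda>v. ?g v * of_bool (snd v = k))" for k
  proof (rule integrable_pmf_if_summable)
    let ?h = "\<lambda>A :: real ^ 'e ^ 'e. A $ j $ k"
    have "bounded_linear ?h"
      using bounded_linear_compose[OF bounded_linear_vec_nth[of k] bounded_linear_vec_nth[of j]] by simp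
    hence "(\<lambda>y. ?h (lattice_norm y ^ r *\<^sub>R A_mat p y)) summable_on UNIV"
      using m unfolding moment_converges_def by (rule summable_on_bounded_linear)
    also have "(\<lambda>y. ?h (lattice_norm y ^ r *\<^sub>R A_mat p y))
       = (\<lambda>v. norm (pmf (step_pmf p j) v * (?g v * of_bool (snd v = k)))) \<circ> (\<lambda>y. (y, k))"
      using p by (auto simp: fun_eq_iff A_mat_def pmf_step[OF p] lattice_norm_real_vec norm_mult stochastic_kernel_def)
    finally have "(\<lambda>v. norm (pmf (step_pmf p j) v * (?g v * of_bool (snd v = k)))) summable_on (range (\<lambda>y. (y, k)))"
      by (subst summable_on_reindex) (auto simp: inj_on_def o_def)
    thus "(\<lambda>v. norm (pmf (step_pmf p j) v * (?g v * of_bool (snd v = k)))) summable_on UNIV"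
      by (rule summable_on_cong_neutral[THEN iffD1, rotated -1]) auto
  qed
  have "integrable (measure_pmf (step_pmf p j)) (\<lambda>v. \<Sum>k\<in>UNIV. ?g v * of_bool (snd v = k))"
    using int by (rule Bochner_Integration.integrable_sum)
  also have "(\<lambda>v. \<Sum>k\<in>UNIV. ?g v * of_bool (snd v = k)) = ?g"
  proof (rule ext)
    fix v :: "(int ^ 'd) \<times> 'e"
    have "(\<Sum>k\<in>UNIV. ?g v * of_bool (snd v = k)) = (\<Sum>k\<in>{snd v}. ?g v)"
      by (rule sum.mono_neutral_cong_right) auto
    thus "(\<Sum>k\<in>UNIV. ?g v * of_bool (snd v = k)) = ?g v" by simp
  qed
  finally show ?thesis .
qed

lemma norm_vec_le_sum:
  fixes f :: "real ^ 'n::finite" and B :: real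
  assumes "\<And>j. \<bar>f $ j\<bar> \<le> B"
  shows "norm f \<le> CARD('n) * B"
proof -
  have "norm f \<le> (\<Sum>j\<in>UNIV. \<bar>f $ j\<bar>)" by (rule norm_le_l1_cart)
  also have "\<dots> \<le> (\<Sum>j\<in>(UNIV :: 'n set). B)" by (rule sum_mono) (rule assms)
  finally show ?thesis by simp
qed

lemma matrix_pow_vec_fixed: "A *v f = f \<Longrightarrow> matrix_pow A n *v f = f"
  by (induction n) (simp_all add: matrix_pow_def matrix_vector_mul_assoc[symmetric])

lemma matrix_pow_nonneg:
  assumes "\<And>j k. A $ j $ k \<ge> 0"
  shows "matrix_pow A n $ j $ k \<ge> 0"
proof (induction n arbitrary: j k)
  case 0
  show ?case by (simp add: matrix_pow_def mat_def)
next
  case (Suc n)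
  have "matrix_pow A (Suc n) = A ** matrix_pow A n" by (simp add: matrix_pow_def)
  thus ?case using Suc assms by (auto simp: matrix_matrix_mult_def intro!: sum_nonneg)
qed

text \<open>
  The maximum principle: at a maximum of \<open>f\<close>, averaging by a power of \<open>A\<close> can reproduce the maximal
  value only if \<open>f\<close> is maximal at every state charged by that power.
\<close>

lemma harmonic_constant:
  fixes A :: "real ^ 'e::finite ^ 'e"
  assumes nn: "\<And>j k. A $ j $ k \<ge> 0" and one: "A *v 1 = 1"
    and irr: "irreducible_chain A" and harm: "A *v f = f"
  obtains c where "f = c *\<^sub>R 1"
proof -
  obtain j where j: "\<And>k. f $ k \<le> f $ j"
  proof -
    have "Max (range (($) f)) \<in> range (($) f)" by (rule Max_in) auto
    then obtain j where "Max (range (($) f)) = f $ j" by (metis imageE)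
    thus ?thesis using that by (metis Max_ge finite finite_imageI rangeI)
  qed
  have "f $ k = f $ j" for k
  proof -
    obtain n where n: "matrix_pow A n $ j $ k > 0" using irr by (auto simp: irreducible_chain_def)
    let ?P = "matrix_pow A n"
    have "(\<Sum>i\<in>UNIV. ?P $ j $ i * (f $ j - f $ i)) = f $ j * (?P *v 1) $ j - (?P *v f) $ j"
      by (simp add: matrix_vector_mult_def right_diff_distrib sum_subtractf sum_distrib_left mult.commute)
    also have "\<dots> = 0" by (simp add: matrix_pow_vec_fixed[OF one] matrix_pow_vec_fixed[OF harm])
    finally have "\<forall>i\<in>UNIV. ?P $ j $ i * (f $ j - f $ i) = 0"
      by (subst (asm) sum_nonneg_eq_0_iff) (use matrix_pow_nonneg[OF nn] j in \<open>auto intro!: mult_nonneg_nonneg\<close>)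
    hence "?P $ j $ k * (f $ j - f $ k) = 0" by blast
    thus ?thesis using n by simp
  qed
  hence "f = (f $ j) *\<^sub>R 1" by (simp add: vec_eq_iff)
  thus ?thesis using that by blast
qed

lemma lattice_norm_power_le: "norm (real_vec z) ^ r \<le> 1 + norm (real_vec z) ^ 3" if "r \<le> 3"
proof (cases "norm (real_vec z) \<le> 1")
  case True
  hence "norm (real_vec z) ^ r \<le> 1" by (simp add: power_le_one)
  thus ?thesis by (simp add: add_increasing2)
next
  case False
  hence "norm (real_vec z) ^ r \<le> norm (real_vec z) ^ 3" using that by (intro power_increasing) auto
  thus ?thesis by simp
qed

lemma matrix_sum_vec: "(\<Sum>i\<in>I. A i :: real ^ 'n::finite ^ 'm::finite) *v f = (\<Sum>i\<in>I. A i *v f)"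
  by (induction I rule: infinite_finite_induct) (simp_all add: matrix_vector_mult_add_rdistrib)

lemma inner_real_vec: "t \<bullet> real_vec z = (\<Sum>l\<in>UNIV. t $ l * real_of_int (z $ l))"
  by (simp add: inner_vec_def real_vec_def)

lemma coord_bound: "\<bar>real_of_int (z $ l)\<bar> \<le> norm (real_vec z :: real ^ 'd)"
  using component_le_norm_cart[of "real_vec z" l] by (simp add: real_vec_def)

lemma phase_bound: "\<bar>t \<bullet> real_vec z\<bar> \<le> norm t * norm (real_vec z :: real ^ 'd)"
  by (rule Cauchy_Schwarz_ineq2)

lemma phase_power_bound: "\<bar>t \<bullet> real_vec z\<bar> ^ r \<le> norm t ^ r * norm (real_vec z :: real ^ 'd) ^ r"
  using power_mono[OF phase_bound, of t z r] by (simp add: power_mult_distrib)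

lemma expectation_complex_combination:
  fixes f g h :: "'a \<Rightarrow> real"
  assumes "integrable (measure_pmf P) f" "integrable (measure_pmf P) g" "integrable (measure_pmf P) h"
  shows "mean P (\<lambda>v. of_real (f v) + \<i> * of_real (g v) - of_real (h v))
       = of_real (mean P f) + \<i> * of_real (mean P g)
         - of_real (mean P h)" (is ?A)
    and "integrable (measure_pmf P) (\<lambda>v. of_real (f v) + \<i> * of_real (g v) - of_real (h v))" (is ?B)
proof -
  note [simp] = assms
  show ?A
    by (subst Bochner_Integration.integral_diff, simp, simp, subst Bochner_Integration.integral_add) simp_all
  show ?B by simp
qed

lemma exp_minus_bound:
  fixes q :: real assumes "0 \<le> q"
  shows "\<bar>1 - q - exp (- q)\<bar> \<le> q\<^sup>2"
proof -
  have "1 - q \<le> exp (- q)" using exp_ge_add_one_self[of "-q"] by simp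
  moreover have "exp (- q) \<le> 1 - q + q\<^sup>2"
  proof -
    have "exp (- q) \<le> 1 / (1 + q)"
      using exp_ge_add_one_self[of q] assms by (simp add: exp_minus field_simps)
    also have "\<dots> \<le> 1 - q + q\<^sup>2"
      using assms by (simp add: field_simps power2_eq_square)
    finally show ?thesis .
  qed
  ultimately show ?thesis by (simp add: abs_le_iff)
qed

lemma times_exp_minus_le:
  fixes c y :: real assumes "c > 0" "y \<ge> 0"
  shows "y * exp (- c * y) \<le> 2 / c * exp (- (c / 2) * y)"
proof -
  have "c * y / 2 \<le> exp (c * y / 2)" using exp_ge_add_one_self[of "c * y / 2"] by linarith
  hence "y \<le> 2 / c * exp (c * y / 2)" using assms by (simp add: field_simps)
  hence "y * exp (- c * y) \<le> 2 / c * exp (c * y / 2) * exp (- c * y)" by (rule mult_right_mono) simp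
  also have "\<dots> = 2 / c * exp (c * y / 2 + (- c * y))" by (simp only: exp_add mult.assoc)
  also have "c * y / 2 + (- c * y) = - (c / 2) * y" by simp
  finally show ?thesis .
qed

lemma period_cube_bounded: "\<exists>R\<ge>1. \<forall>t\<in>(period_cube :: (real ^ 'd) set). norm t \<le> R"
proof -
  have "norm t \<le> sqrt (CARD('d) * pi\<^sup>2)" if "t \<in> period_cube" for t :: "real ^ 'd"
    using period_cube_norm[OF that] by (rule real_le_rsqrt)
  thus ?thesis by (intro exI[of _ "max 1 (sqrt (CARD('d) * pi\<^sup>2))"]) (auto simp: le_max_iff_disj)
qed

locale rwwis =
  fixes p :: "('d::finite, 'e::finite) kernel" and \<mu> :: "real ^ 'e"
  assumes stochastic: "stochastic_kernel p"
    and basic: "basic_assumptions p \<mu>"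
    and third_moment: "moment_converges 3 p"
begin

abbreviation Q where "Q \<equiv> Q_mat p"

lemma stationary: "stationary_distribution Q \<mu>"
  and irreducible: "irreducible_chain Q"
  and arithmetic: "trivial_arithmetic p"
  using basic by (auto simp: basic_assumptions_def)

lemma mu_Q: "\<mu> \<bullet> (Q *v f) = \<mu> \<bullet> f"
  using stationary by (simp only: dot_lmul_matrix[symmetric] stationary_distribution_def)

lemma mu_one: "\<mu> \<bullet> 1 = 1"
  using stationary by (simp add: inner_vec_def stationary_distribution_def)

lemma mu_nonneg: "\<mu> $ j \<ge> 0"
  using stationary by (simp add: stationary_distribution_def)

lemma Q_one: "Q *v 1 = 1"
  by (simp add: vec_eq_iff Q_mat_vec[OF stochastic])

lemma Q_entry: "Q $ j $ k = mean (step_pmf p j) (\<lambda>v. of_bool (snd v = k))"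
proof -
  have "Q $ j $ k = (Q *v axis k 1) $ j"
    by (simp add: matrix_vector_mult_basis column_def)
  thus ?thesis unfolding Q_mat_vec[OF stochastic] by (simp add: axis_def of_bool_def eq_commute)
qed

lemma Q_nonneg: "Q $ j $ k \<ge> 0"
  unfolding Q_entry by (rule integral_nonneg_AE) auto

text \<open>
  The stationary weight flows along the powers of \<open>Q\<close> from a state of positive weight to every
  other state.
\<close>

lemma mu_pos: "\<mu> $ k > 0"
proof -
  have "\<exists>j. \<mu> $ j > 0"
  proof (rule ccontr)
    assume "\<nexists>j. \<mu> $ j > 0"
    hence "(\<Sum>j\<in>UNIV. \<mu> $ j) \<le> 0" by (intro sum_nonpos) (auto simp: not_less)
    thus False using stationary by (simp add: stationary_distribution_def)
  qed
  then obtain j where j: "\<mu> $ j > 0" ..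
  obtain n where n: "matrix_pow Q n $ j $ k > 0" using irreducible by (auto simp: irreducible_chain_def)
  have "\<mu> v* matrix_pow Q n = \<mu>" for n
  proof (induction n)
    case (Suc n)
    have "\<mu> v* matrix_pow Q (Suc n) = (\<mu> v* Q) v* matrix_pow Q n"
      by (simp add: matrix_pow_def vector_matrix_mul_assoc)
    thus ?case using Suc stationary by (simp add: stationary_distribution_def)
  qed (simp add: matrix_pow_def)
  hence "\<mu> $ k = (\<mu> v* matrix_pow Q n) $ k" by simp
  also have "\<dots> = (\<Sum>i\<in>UNIV. matrix_pow Q n $ i $ k * \<mu> $ i)"
    by (simp add: vector_matrix_mult_def mult.commute)
  also have "\<dots> \<ge> matrix_pow Q n $ j $ k * \<mu> $ j"
    by (rule member_le_sum) (auto intro!: mult_nonneg_nonneg mu_nonneg matrix_pow_nonneg Q_nonneg)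
  finally show ?thesis using n j by (meson less_le_trans mult_pos_pos)
qed

text \<open>
  \<open>Q - 1\<close> kills exactly the constants and maps into the hyperplane orthogonal to \<open>\<mu>\<close>. Adding the
  projection to the constants makes it invertible without changing it on that hyperplane.
\<close>

definition poisson_op :: "real ^ 'e \<Rightarrow> real ^ 'e" where
  "poisson_op f = Q *v f - f + (\<mu> \<bullet> f) *\<^sub>R 1"

lemma linear_poisson_op: "linear poisson_op"
  by (rule linearI)
     (simp_all add: poisson_op_def matrix_vector_right_distrib inner_add_right algebra_simps
       matrix_vector_mult_scaleR)

lemma mu_poisson_op: "\<mu> \<bullet> poisson_op f = \<mu> \<bullet> f"
  by (simp only: poisson_op_def inner_add_right inner_diff_right inner_scaleR_right mu_Q mu_one)

lemma inj_poisson_op: "inj poisson_op"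
proof (subst linear_injective_0[OF linear_poisson_op], intro allI impI)
  fix f assume f: "poisson_op f = 0"
  have m: "\<mu> \<bullet> f = 0" using mu_poisson_op[of f] f by simp
  hence "Q *v f = f" using f by (simp add: poisson_op_def)
  then obtain c where c: "f = c *\<^sub>R 1"
    using harmonic_constant[OF Q_nonneg Q_one irreducible] by blast
  hence "c = 0" using m mu_one by simp
  thus "f = 0" using c by simp
qed

definition poisson_inv :: "real ^ 'e \<Rightarrow> real ^ 'e" where
  "poisson_inv = inv poisson_op"

lemma poisson_op_inv: "poisson_op (poisson_inv f) = f"
proof -
  have "surj poisson_op"
    using linear_injective_imp_surjective[OF linear_poisson_op] inj_poisson_op by auto
  thus ?thesis unfolding poisson_inv_def by (rule surj_f_inv_f)
qed

lemma poisson_inv_op: "poisson_inv (poisson_op f) = f"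
  unfolding poisson_inv_def by (rule inv_f_f) (rule inj_poisson_op)

lemma linear_poisson_inv: "linear poisson_inv"
proof (rule linearI)
  fix x y and r :: real
  show "poisson_inv (x + y) = poisson_inv x + poisson_inv y"
    by (rule injD[OF inj_poisson_op]) (simp add: poisson_op_inv linear_add[OF linear_poisson_op])
  show "poisson_inv (r *\<^sub>R x) = r *\<^sub>R poisson_inv x"
    by (rule injD[OF inj_poisson_op]) (simp add: poisson_op_inv linear_scale[OF linear_poisson_op])
qed

lemma mu_poisson_inv: "\<mu> \<bullet> poisson_inv f = \<mu> \<bullet> f"
  by (metis poisson_op_inv mu_poisson_op)

lemma poisson_inv_solves: "Q *v poisson_inv f - poisson_inv f = f - (\<mu> \<bullet> f) *\<^sub>R 1"
  using poisson_op_inv[of f] by (simp add: poisson_op_def mu_poisson_inv algebra_simps)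

lemma Q_minus_1_inv_eq:
  assumes "\<mu> \<bullet> f = 0"
  shows "Q_minus_1_inv p \<mu> f = poisson_inv f"
  unfolding Q_minus_1_inv_def
proof (rule the_equality)
  show "\<mu> \<bullet> poisson_inv f = 0 \<and> Q *v poisson_inv f - poisson_inv f = f" using assms by (simp add: mu_poisson_inv poisson_inv_solves)
next
  fix v assume v: "\<mu> \<bullet> v = 0 \<and> Q *v v - v = f"
  hence "poisson_op v = f" by (simp add: poisson_op_def)
  thus "v = poisson_inv f" using poisson_inv_op by metis
qed

lemma poisson_inv_bounded: "\<exists>B>0. \<forall>f. norm (poisson_inv f) \<le> B * norm f"
  using linear_bounded_pos[OF linear_poisson_inv] by (metis mult.commute)

section \<open>Taylor expansion of the characteristic operator\<close>

lemma integrable_moment: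
  assumes "r \<le> 3"
  shows "integrable (measure_pmf (step_pmf p j)) (\<lambda>v. norm (real_vec (fst v)) ^ r)"
proof (rule Bochner_Integration.integrable_bound)
  show "integrable (measure_pmf (step_pmf p j)) (\<lambda>v. 1 + norm (real_vec (fst v)) ^ 3)"
    using moment_integrable[OF stochastic third_moment] by simp
  show "AE x in step_pmf p j. norm (norm (real_vec (fst x)) ^ r) \<le> norm (1 + norm (real_vec (fst x)) ^ 3)"
    using lattice_norm_power_le[OF assms] by (auto intro: order_trans)
qed simp

text \<open>
  One constant that dominates all moments up to order three from all states.
\<close>

definition moment_bound :: real where
  "moment_bound = (\<Sum>j\<in>UNIV. mean (step_pmf p j) (\<lambda>v. 1 + norm (real_vec (fst v)) ^ 3))"

lemma moment_bound:
  assumes "r \<le> 3"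
  shows "mean (step_pmf p j) (\<lambda>v. norm (real_vec (fst v)) ^ r) \<le> moment_bound"
proof -
  have "mean (step_pmf p j) (\<lambda>v. norm (real_vec (fst v)) ^ r)
      \<le> mean (step_pmf p j) (\<lambda>v. 1 + norm (real_vec (fst v)) ^ 3)"
    using integrable_moment[OF assms] integrable_moment[of 3] lattice_norm_power_le[OF assms]
    by (intro integral_mono) auto
  also have "\<dots> \<le> moment_bound"
    unfolding moment_bound_def by (rule member_le_sum) (auto intro!: integral_nonneg_AE)
  finally show ?thesis .
qed

lemma moment_bound_nonneg: "0 \<le> moment_bound"
  unfolding moment_bound_def by (intro sum_nonneg integral_nonneg_AE) auto

text \<open>
  The first and second moments of the displacement in the direction \<open>t\<close>.
\<close>

definition M_dir :: "real ^ 'd \<Rightarrow> real ^ 'e ^ 'e" where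
  "M_dir t = (\<Sum>l\<in>UNIV. t $ l *\<^sub>R M_mat p l)"

definition Sigma_dir :: "real ^ 'd \<Rightarrow> real ^ 'e ^ 'e" where
  "Sigma_dir t = (\<Sum>l\<in>UNIV. \<Sum>m\<in>UNIV. (t $ l * t $ m) *\<^sub>R Sigma_mat p l m)"

lemma integrable_weight:
  fixes \<phi> :: "int ^ 'd \<Rightarrow> real" and f :: "'e \<Rightarrow> real"
  assumes "\<And>z. \<bar>\<phi> z\<bar> \<le> c * norm (real_vec z) ^ r" and "r \<le> 3"
  shows "integrable (measure_pmf (step_pmf p j)) (\<lambda>v. \<phi> (fst v) * f (snd v))"
proof (rule Bochner_Integration.integrable_bound)
  let ?B = "\<Sum>k\<in>UNIV. \<bar>f k\<bar>"
  show "integrable (measure_pmf (step_pmf p j)) (\<lambda>v. c * ?B * norm (real_vec (fst v)) ^ r)"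
    using integrable_moment[OF assms(2)] by simp
  have B: "\<bar>f k\<bar> \<le> ?B" for k by (rule member_le_sum) auto
  have "\<bar>\<phi> z * f k\<bar> \<le> \<bar>c * ?B * norm (real_vec z) ^ r\<bar>" for z k
  proof -
    have "\<bar>\<phi> z * f k\<bar> \<le> (c * norm (real_vec z) ^ r) * ?B"
      unfolding abs_mult by (rule mult_mono[OF assms(1) B order_trans[OF abs_ge_zero assms(1)] abs_ge_zero])
    thus ?thesis by (simp add: mult_ac)
  qed
  thus "AE x in step_pmf p j. norm (\<phi> (fst x) * f (snd x)) \<le> norm (c * ?B * norm (real_vec (fst x)) ^ r)"
    by simp
qed simp

lemma M_mat_vec:
  "(M_mat p l *v f) $ j = mean (step_pmf p j) (\<lambda>v. real_of_int (fst v $ l) * f $ snd v)"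
proof -
  have "integrable (measure_pmf (step_pmf p j)) (\<lambda>v. real_of_int (fst v $ l))" for j
    using integrable_weight[of "\<lambda>z. real_of_int (z $ l)" 1 1 j "\<lambda>_. 1"] coord_bound[of _ l] by simp
  thus ?thesis unfolding M_mat_def by (rule weighted_kernel_vec[OF stochastic])
qed

lemma Sigma_mat_vec:
  "(Sigma_mat p l m *v f) $ j
     = mean (step_pmf p j) (\<lambda>v. real_of_int (fst v $ l * fst v $ m) * f $ snd v)"
proof -
  have "\<bar>real_of_int (z $ l * z $ m)\<bar> \<le> 1 * norm (real_vec z :: real ^ 'd) ^ 2" for z
    using mult_mono[OF coord_bound[of z l] coord_bound[of z m]] by (simp add: abs_mult power2_eq_square)
  hence "integrable (measure_pmf (step_pmf p j)) (\<lambda>v. real_of_int (fst v $ l * fst v $ m))" for j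
    using integrable_weight[of "\<lambda>z. real_of_int (z $ l * z $ m)" 1 2 j "\<lambda>_. 1"] by simp
  thus ?thesis unfolding Sigma_mat_def by (rule weighted_kernel_vec[OF stochastic])
qed

lemma M_dir_vec:
  "(M_dir t *v f) $ j = mean (step_pmf p j) (\<lambda>v. (t \<bullet> real_vec (fst v)) * f $ snd v)"
proof -
  have i: "integrable (measure_pmf (step_pmf p j)) (\<lambda>v. real_of_int (fst v $ l) * f $ snd v)" for l
    using integrable_weight[of "\<lambda>z. real_of_int (z $ l)" 1 1 j "($) f"] coord_bound[of _ l] by simp
  have "(M_dir t *v f) $ j
    = (\<Sum>l\<in>UNIV. t $ l * mean (step_pmf p j) (\<lambda>v. real_of_int (fst v $ l) * f $ snd v))"
    by (simp add: M_dir_def matrix_sum_vec scaleR_matrix_vector_assoc[symmetric] M_mat_vec)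
  also have "\<dots> = (\<Sum>l\<in>UNIV. mean (step_pmf p j) (\<lambda>v. t $ l * (real_of_int (fst v $ l) * f $ snd v)))"
    by simp
  also have "\<dots> = mean (step_pmf p j) (\<lambda>v. \<Sum>l\<in>UNIV. t $ l * (real_of_int (fst v $ l) * f $ snd v))"
    using i by (intro Bochner_Integration.integral_sum[symmetric]) auto
  finally show ?thesis by (simp add: inner_real_vec sum_distrib_right mult.assoc)
qed

lemma Sigma_dir_vec:
  "(Sigma_dir t *v f) $ j = mean (step_pmf p j) (\<lambda>v. (t \<bullet> real_vec (fst v))\<^sup>2 * f $ snd v)"
proof -
  have b: "\<bar>real_of_int (z $ l * z $ m)\<bar> \<le> 1 * norm (real_vec z :: real ^ 'd) ^ 2" for z l m
    using mult_mono[OF coord_bound[of z l] coord_bound[of z m]] by (simp add: abs_mult power2_eq_square)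
  have i: "integrable (measure_pmf (step_pmf p j)) (\<lambda>v. real_of_int (fst v $ l * fst v $ m) * f $ snd v)" for l m
    using integrable_weight[of "\<lambda>z. real_of_int (z $ l * z $ m)" 1 2 j "($) f"] b by simp
  let ?F = "\<lambda>l m v. (t $ l * t $ m) * (real_of_int (fst v $ l * fst v $ m) * f $ snd v)"
  have "(Sigma_dir t *v f) $ j = (\<Sum>l\<in>UNIV. \<Sum>m\<in>UNIV. (t $ l * t $ m) *
      mean (step_pmf p j) (\<lambda>v. real_of_int (fst v $ l * fst v $ m) * f $ snd v))"
    by (simp only: Sigma_dir_def matrix_sum_vec scaleR_matrix_vector_assoc[symmetric] sum_component
        vector_scaleR_component Sigma_mat_vec real_scaleR_def)
  also have "\<dots> = (\<Sum>l\<in>UNIV. \<Sum>m\<in>UNIV. mean (step_pmf p j) (?F l m))"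
    by simp
  also have "\<dots> = (\<Sum>l\<in>UNIV. mean (step_pmf p j) (\<lambda>v. \<Sum>m\<in>UNIV. ?F l m v))"
    using i by (intro sum.cong refl Bochner_Integration.integral_sum[symmetric] integrable_mult_right)
  also have "\<dots> = mean (step_pmf p j) (\<lambda>v. \<Sum>l\<in>UNIV. \<Sum>m\<in>UNIV. ?F l m v)"
    using i by (intro Bochner_Integration.integral_sum[symmetric] Bochner_Integration.integrable_sum integrable_mult_right)
  also have "(\<lambda>v. \<Sum>l\<in>UNIV. \<Sum>m\<in>UNIV. ?F l m v) = (\<lambda>v. (t \<bullet> real_vec (fst v))\<^sup>2 * f $ snd v)"
  proof (rule ext)
    fix v :: "(int ^ 'd) \<times> 'e"
    have "(t \<bullet> real_vec (fst v))\<^sup>2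
        = (\<Sum>l\<in>UNIV. \<Sum>m\<in>UNIV. (t $ l * t $ m) * real_of_int (fst v $ l * fst v $ m))"
      unfolding inner_real_vec power2_eq_square sum_product by (simp add: mult_ac)
    thus "(\<Sum>l\<in>UNIV. \<Sum>m\<in>UNIV. ?F l m v) = (t \<bullet> real_vec (fst v))\<^sup>2 * f $ snd v"
      by (simp add: sum_distrib_right mult.assoc)
  qed
  finally show ?thesis .
qed

abbreviation cf :: "real ^ 'e \<Rightarrow> 'e \<Rightarrow> complex" where
  "cf f \<equiv> (\<lambda>k. complex_of_real (f $ k))"

abbreviation T :: "real ^ 'd \<Rightarrow> ('e \<Rightarrow> complex) \<Rightarrow> 'e \<Rightarrow> complex" where
  "T \<equiv> char_op p"

text \<open>
  Replacing the exponential by a polynomial \<open>P\<close> costs the expectation of the pointwise remainder.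
\<close>

lemma taylor_remainder:
  assumes P: "\<And>z. cmod (iexp (t \<bullet> real_vec z) - P z) \<le> \<bar>t \<bullet> real_vec z\<bar> ^ r" and r: "r \<le> 3"
    and I: "integrable (measure_pmf (step_pmf p j)) (\<lambda>v. P (fst v) * cf f (snd v))"
  shows "cmod (T t (cf f) j - mean (step_pmf p j) (\<lambda>v. P (fst v) * cf f (snd v)))
          \<le> norm t ^ r * moment_bound * norm f"
proof -
  let ?D = "\<lambda>v. iexp (t \<bullet> real_vec (fst v)) * cf f (snd v) - P (fst v) * cf f (snd v)"
  have "T t (cf f) j - mean (step_pmf p j) (\<lambda>v. P (fst v) * cf f (snd v))
     = mean (step_pmf p j) ?D"
    unfolding char_op_def using integrable_char[of "step_pmf p j" t "cf f"] I
    by (intro Bochner_Integration.integral_diff[symmetric])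
  also have "cmod \<dots> \<le> mean (step_pmf p j) (\<lambda>v. cmod (?D v))"
    by (rule integral_norm_bound)
  also have "\<dots> \<le> mean (step_pmf p j) (\<lambda>v. norm t ^ r * norm f * norm (real_vec (fst v)) ^ r)"
  proof (rule integral_mono)
    show "integrable (measure_pmf (step_pmf p j)) (\<lambda>v. cmod (?D v))"
      using integrable_char[of "step_pmf p j" t "cf f"] I by (intro integrable_norm Bochner_Integration.integrable_diff)
    show "integrable (measure_pmf (step_pmf p j)) (\<lambda>v. norm t ^ r * norm f * norm (real_vec (fst v)) ^ r)"
      using integrable_moment[OF r] by simp
    fix v :: "(int ^ 'd) \<times> 'e"
    have "cmod (?D v) = cmod (iexp (t \<bullet> real_vec (fst v)) - P (fst v)) * \<bar>f $ snd v\<bar>"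
      by (simp add: left_diff_distrib[symmetric] norm_mult)
    also have "\<dots> \<le> (norm t ^ r * norm (real_vec (fst v)) ^ r) * norm f"
      using order_trans[OF P phase_power_bound] by (intro mult_mono component_le_norm_cart) auto
    finally show "cmod (?D v) \<le> norm t ^ r * norm f * norm (real_vec (fst v)) ^ r" by (simp add: mult_ac)
  qed
  also have "\<dots> = norm t ^ r * norm f * mean (step_pmf p j) (\<lambda>v. norm (real_vec (fst v)) ^ r)"
    by simp
  also have "\<dots> \<le> norm t ^ r * norm f * moment_bound"
    using moment_bound[OF r] by (intro mult_left_mono) auto
  finally show ?thesis by (simp add: mult_ac)
qed

lemma char_op_taylor_0: "cmod (T t (cf f) j - of_real ((Q *v f) $ j)) \<le> norm t * moment_bound * norm f"
proof -
  have "cmod (iexp x - 1) \<le> \<bar>x\<bar> ^ 1" for x using iexp_approx1[of x 0] by simp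
  hence "cmod (T t (cf f) j - mean (step_pmf p j) (\<lambda>v. 1 * cf f (snd v)))
          \<le> norm t ^ 1 * moment_bound * norm f"
    by (intro taylor_remainder) (auto intro!: integrable_pmf_bounded[where B="norm f"] component_le_norm_cart)
  thus ?thesis by (simp add: Q_mat_vec[OF stochastic])
qed

lemma char_op_taylor_1:
  "cmod (T t (cf f) j - of_real ((Q *v f) $ j) - \<i> * of_real ((M_dir t *v f) $ j))
     \<le> norm t ^ 2 * moment_bound * norm f"
proof -
  let ?P = "\<lambda>z. 1 + \<i> * of_real (t \<bullet> real_vec z)"
  have i0: "integrable (measure_pmf (step_pmf p j)) (\<lambda>v. f $ snd v)"
    by (auto intro!: integrable_pmf_bounded[where B="norm f"] component_le_norm_cart)
  have i1: "integrable (measure_pmf (step_pmf p j)) (\<lambda>v. (t \<bullet> real_vec (fst v)) * f $ snd v)"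
    by (rule integrable_weight[of _ "norm t" 1]) (use phase_bound in auto)
  have eq: "(\<lambda>v. ?P (fst v) * cf f (snd v))
     = (\<lambda>v. of_real (f $ snd v) + \<i> * of_real ((t \<bullet> real_vec (fst v)) * f $ snd v) - of_real 0)"
    by (simp add: fun_eq_iff algebra_simps)
  have E: "mean (step_pmf p j) (\<lambda>v. ?P (fst v) * cf f (snd v))
     = of_real ((Q *v f) $ j) + \<i> * of_real ((M_dir t *v f) $ j)"
    unfolding eq Q_mat_vec[OF stochastic] M_dir_vec
    by (subst expectation_complex_combination(1)[OF i0 i1]) simp_all
  have "cmod (iexp x - (1 + \<i> * of_real x)) \<le> \<bar>x\<bar> ^ 2" for x
  proof -
    have "cmod (iexp x - (1 + \<i> * of_real x)) \<le> \<bar>x\<bar> ^ 2 / 2"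
      using iexp_approx1[of x 1] by (simp add: numeral_2_eq_2)
    also have "\<dots> \<le> \<bar>x\<bar> ^ 2" by simp
    finally show ?thesis .
  qed
  hence "cmod (T t (cf f) j - mean (step_pmf p j) (\<lambda>v. ?P (fst v) * cf f (snd v)))
          \<le> norm t ^ 2 * moment_bound * norm f"
    using expectation_complex_combination(2)[OF i0 i1, of "\<lambda>_. 0"]
    by (intro taylor_remainder) (unfold eq, simp_all)
  thus ?thesis unfolding E by (simp add: diff_diff_add)
qed

lemma char_op_taylor_2:
  "cmod (T t (cf f) j - of_real ((Q *v f) $ j) - \<i> * of_real ((M_dir t *v f) $ j) + of_real ((Sigma_dir t *v f) $ j / 2))
     \<le> norm t ^ 3 * moment_bound * norm f"
proof -
  let ?P = "\<lambda>z. 1 + \<i> * of_real (t \<bullet> real_vec z) - of_real ((t \<bullet> real_vec z)\<^sup>2 / 2)"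
  have i0: "integrable (measure_pmf (step_pmf p j)) (\<lambda>v. f $ snd v)"
    by (auto intro!: integrable_pmf_bounded[where B="norm f"] component_le_norm_cart)
  have i1: "integrable (measure_pmf (step_pmf p j)) (\<lambda>v. (t \<bullet> real_vec (fst v)) * f $ snd v)"
    by (rule integrable_weight[of _ "norm t" 1]) (use phase_bound in auto)
  have i2: "integrable (measure_pmf (step_pmf p j)) (\<lambda>v. (t \<bullet> real_vec (fst v))\<^sup>2 * f $ snd v)"
    by (rule integrable_weight[of _ "norm t ^ 2" 2]) (use phase_power_bound[of t _ 2] in auto)
  have i2': "integrable (measure_pmf (step_pmf p j)) (\<lambda>v. (t \<bullet> real_vec (fst v))\<^sup>2 * f $ snd v / 2)"
    using i2 by (rule integrable_divide)
  have eq: "(\<lambda>v. ?P (fst v) * cf f (snd v))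
     = (\<lambda>v. of_real (f $ snd v) + \<i> * of_real ((t \<bullet> real_vec (fst v)) * f $ snd v)
            - of_real ((t \<bullet> real_vec (fst v))\<^sup>2 * f $ snd v / 2))"
    by (simp add: fun_eq_iff algebra_simps)
  have E: "mean (step_pmf p j) (\<lambda>v. ?P (fst v) * cf f (snd v))
     = of_real ((Q *v f) $ j) + \<i> * of_real ((M_dir t *v f) $ j) - of_real ((Sigma_dir t *v f) $ j / 2)"
    unfolding eq Q_mat_vec[OF stochastic] M_dir_vec Sigma_dir_vec
    by (subst expectation_complex_combination(1)[OF i0 i1 i2']) simp_all
  have "cmod (iexp x - (1 + \<i> * of_real x - of_real (x\<^sup>2 / 2))) \<le> \<bar>x\<bar> ^ 3" for x
  proof -
    have "{..2} = {0, 1, 2::nat}" by auto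
    moreover have "(\<i> * of_real x)\<^sup>2 = - of_real (x\<^sup>2)" by (simp add: power_mult_distrib)
    ultimately have "(\<Sum>k\<le>2. (\<i> * of_real x)^k / fact k) = 1 + \<i> * of_real x - of_real (x\<^sup>2 / 2)"
      by simp
    hence "cmod (iexp x - (1 + \<i> * of_real x - of_real (x\<^sup>2 / 2))) \<le> \<bar>x\<bar> ^ 3 / fact 3"
      using iexp_approx1[of x 2] by (simp add: numeral_3_eq_3)
    also have "\<dots> \<le> \<bar>x\<bar> ^ 3" by (simp add: field_simps fact_numeral)
    finally show ?thesis .
  qed
  hence "cmod (T t (cf f) j - mean (step_pmf p j) (\<lambda>v. ?P (fst v) * cf f (snd v)))
          \<le> norm t ^ 3 * moment_bound * norm f"
    using expectation_complex_combination(2)[OF i0 i1 i2']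
    by (intro taylor_remainder) (unfold eq, simp_all only: order_refl)
  thus ?thesis unfolding E by (simp add: algebra_simps)
qed

section \<open>An approximate eigenvector and the local expansion\<close>

text \<open>
  The exponent of the limiting Gaussian.
\<close>

definition qf :: "real ^ 'd \<Rightarrow> real" where
  "qf t = (t \<bullet> (covariance p \<mu> *v t)) / 2"

text \<open>
  Coefficients of an approximate eigenvector \<open>1 + \<i> * eig1 t + eig2 t\<close> with eigenvalue \<open>exp (- qf t)\<close>.
  Comparing the terms of order one and two in \<open>t\<close> on both sides of the eigenvalue equation gives
  the Poisson equations \<open>Q_eig1\<close> and \<open>Q_eig2\<close>. The first is solvable because the mean vanishes, and
  the second because \<open>qf\<close> is defined through the covariance matrix.
\<close>

definition eig1 :: "real ^ 'd \<Rightarrow> real ^ 'e" where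
  "eig1 t = - poisson_inv (M_dir t *v 1)"

definition eig2 :: "real ^ 'd \<Rightarrow> real ^ 'e" where
  "eig2 t = poisson_inv ((1/2) *\<^sub>R (Sigma_dir t *v 1) + M_dir t *v eig1 t - qf t *\<^sub>R 1)"

definition approx_eig :: "real ^ 'd \<Rightarrow> 'e \<Rightarrow> complex" where
  "approx_eig t k = 1 + \<i> * of_real (eig1 t $ k) + of_real (eig2 t $ k)"

lemma M_dir_sum: "M_dir t *v f = (\<Sum>l\<in>UNIV. t $ l *\<^sub>R (M_mat p l *v f))"
  by (simp add: M_dir_def matrix_sum_vec scaleR_matrix_vector_assoc[symmetric])

lemma mu_M_one: "\<mu> \<bullet> (M_mat p l *v 1) = 0"
  using basic by (simp add: basic_assumptions_def zero_mean_def)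

lemma mu_M_dir_one: "\<mu> \<bullet> (M_dir t *v 1) = 0"
  by (simp add: M_dir_sum inner_sum_right mu_M_one)

lemma eig1_sum: "eig1 t = - (\<Sum>m\<in>UNIV. t $ m *\<^sub>R poisson_inv (M_mat p m *v 1))"
  by (simp add: eig1_def M_dir_sum linear_sum[OF linear_poisson_inv] linear_scale[OF linear_poisson_inv])

lemma covariance_entry:
  "covariance p \<mu> $ l $ m = \<mu> \<bullet> (Sigma_mat p l m *v 1) - \<mu> \<bullet> (M_mat p l *v poisson_inv (M_mat p m *v 1))
     - \<mu> \<bullet> (M_mat p m *v poisson_inv (M_mat p l *v 1))"
  by (simp add: covariance_def Q_minus_1_inv_eq[OF mu_M_one])

text \<open>
  The quadratic form of the covariance matrix is the solvability condition for the second order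
  term: its two symmetric correction terms contribute equally.
\<close>

lemma qf_eq: "qf t = (1/2) * (\<mu> \<bullet> (Sigma_dir t *v 1)) + \<mu> \<bullet> (M_dir t *v eig1 t)"
proof -
  define A where "A l m = \<mu> \<bullet> (Sigma_mat p l m *v 1)" for l m
  define B where "B l m = \<mu> \<bullet> (M_mat p l *v poisson_inv (M_mat p m *v 1))" for l m
  have S: "\<mu> \<bullet> (Sigma_dir t *v 1) = (\<Sum>l\<in>UNIV. \<Sum>m\<in>UNIV. t $ l * t $ m * A l m)"
    by (simp add: Sigma_dir_def matrix_sum_vec scaleR_matrix_vector_assoc[symmetric] inner_sum_right A_def)
  have M: "\<mu> \<bullet> (M_dir t *v eig1 t) = - (\<Sum>l\<in>UNIV. \<Sum>m\<in>UNIV. t $ l * t $ m * B l m)"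
  proof -
    have "M_mat p l *v eig1 t = - (\<Sum>m\<in>UNIV. t $ m *\<^sub>R (M_mat p l *v poisson_inv (M_mat p m *v 1)))" for l
      by (simp add: eig1_sum linear_neg[OF matrix_vector_mul_linear] linear_sum[OF matrix_vector_mul_linear]
          linear_scale[OF matrix_vector_mul_linear])
    thus ?thesis
      by (simp add: M_dir_sum inner_sum_right B_def sum_distrib_left mult.assoc sum_negf)
  qed
  have sw: "(\<Sum>l\<in>UNIV. \<Sum>m\<in>UNIV. t $ l * t $ m * B m l) = (\<Sum>l\<in>UNIV. \<Sum>m\<in>UNIV. t $ l * t $ m * B l m)"
    by (subst sum.swap) (simp add: mult_ac)
  have "t \<bullet> (covariance p \<mu> *v t) = (\<Sum>l\<in>UNIV. \<Sum>m\<in>UNIV. t $ l * t $ m * (A l m - B l m - B m l))"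
    by (simp add: inner_vec_def matrix_vector_mult_def covariance_entry sum_distrib_left A_def B_def mult_ac)
  also have "\<dots> = (\<Sum>l\<in>UNIV. \<Sum>m\<in>UNIV. t $ l * t $ m * A l m)
      - 2 * (\<Sum>l\<in>UNIV. \<Sum>m\<in>UNIV. t $ l * t $ m * B l m)"
    by (simp add: right_diff_distrib sum_subtractf sw)
  finally show ?thesis by (simp add: qf_def S M)
qed

lemma Q_eig1: "(Q *v eig1 t) $ j = eig1 t $ j - (M_dir t *v 1) $ j"
proof -
  have "Q *v eig1 t - eig1 t = - (Q *v poisson_inv (M_dir t *v 1) - poisson_inv (M_dir t *v 1))"
    by (simp add: eig1_def linear_neg[OF matrix_vector_mul_linear])
  also have "\<dots> = - (M_dir t *v 1)" by (simp add: poisson_inv_solves mu_M_dir_one)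
  finally have "(Q *v eig1 t - eig1 t) $ j = (- (M_dir t *v 1)) $ j" by simp
  thus ?thesis by simp
qed

lemma Q_eig2: "(Q *v eig2 t) $ j = eig2 t $ j + (Sigma_dir t *v 1) $ j / 2 + (M_dir t *v eig1 t) $ j - qf t"
proof -
  let ?f = "(1/2) *\<^sub>R (Sigma_dir t *v 1) + M_dir t *v eig1 t - qf t *\<^sub>R 1"
  have "\<mu> \<bullet> ?f = 0" by (simp add: inner_add_right inner_diff_right mu_one qf_eq)
  hence "Q *v eig2 t - eig2 t = ?f" by (simp add: eig2_def poisson_inv_solves)
  hence "(Q *v eig2 t - eig2 t) $ j = ?f $ j" by simp
  thus ?thesis by simp
qed

lemma weight_expectation_bound:
  fixes \<phi> :: "int ^ 'd \<Rightarrow> real" and f :: "real ^ 'e"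
  assumes \<phi>: "\<And>z. \<bar>\<phi> z\<bar> \<le> c * norm (real_vec z) ^ r" and r: "r \<le> 3" and c: "0 \<le> c"
  shows "\<bar>mean (step_pmf p j) (\<lambda>v. \<phi> (fst v) * f $ snd v)\<bar> \<le> c * moment_bound * norm f"
proof -
  have i: "integrable (measure_pmf (step_pmf p j)) (\<lambda>v. \<phi> (fst v) * f $ snd v)"
    by (rule integrable_weight[OF \<phi> r])
  have "\<bar>mean (step_pmf p j) (\<lambda>v. \<phi> (fst v) * f $ snd v)\<bar>
      \<le> mean (step_pmf p j) (\<lambda>v. \<bar>\<phi> (fst v) * f $ snd v\<bar>)"
    by (rule integral_abs_bound)
  also have "\<dots> \<le> mean (step_pmf p j) (\<lambda>v. c * norm f * norm (real_vec (fst v)) ^ r)"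
  proof (rule integral_mono)
    fix v :: "(int ^ 'd) \<times> 'e"
    have "\<bar>\<phi> (fst v) * f $ snd v\<bar> \<le> (c * norm (real_vec (fst v)) ^ r) * norm f"
      unfolding abs_mult using c
      by (intro mult_mono \<phi> component_le_norm_cart) auto
    thus "\<bar>\<phi> (fst v) * f $ snd v\<bar> \<le> c * norm f * norm (real_vec (fst v)) ^ r" by (simp add: mult_ac)
  qed (use i integrable_moment[OF r] in auto)
  also have "\<dots> = c * norm f * mean (step_pmf p j) (\<lambda>v. norm (real_vec (fst v)) ^ r)"
    by simp
  also have "\<dots> \<le> c * norm f * moment_bound"
    using moment_bound[OF r] c by (intro mult_left_mono) auto
  finally show ?thesis by (simp add: mult_ac)
qed

lemma M_dir_bound: "norm (M_dir t *v f) \<le> CARD('e) * (norm t * moment_bound * norm f)"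
  by (rule norm_vec_le_sum, subst M_dir_vec, rule weight_expectation_bound[where r=1])
     (use phase_bound in auto)

lemma Sigma_dir_bound: "norm (Sigma_dir t *v f) \<le> CARD('e) * (norm t ^ 2 * moment_bound * norm f)"
  by (rule norm_vec_le_sum, subst Sigma_dir_vec, rule weight_expectation_bound[where r=2])
     (use phase_power_bound[of t _ 2] in auto)

lemma qf_bound: "\<exists>C\<ge>0. \<forall>t. \<bar>qf t\<bar> \<le> C * norm t ^ 2"
proof -
  obtain B where B: "B > 0" "\<And>t. norm (covariance p \<mu> *v t) \<le> B * norm t"
    using linear_bounded_pos[OF matrix_vector_mul_linear] by metis
  have "\<bar>qf t\<bar> \<le> B * norm t ^ 2" for t
  proof -
    have "\<bar>t \<bullet> (covariance p \<mu> *v t)\<bar> \<le> norm t * (B * norm t)"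
      by (rule order_trans[OF Cauchy_Schwarz_ineq2 mult_left_mono[OF B(2)]]) simp
    moreover have "\<bar>qf t\<bar> \<le> \<bar>t \<bullet> (covariance p \<mu> *v t)\<bar>" by (simp add: qf_def)
    ultimately show ?thesis by (simp add: power2_eq_square mult_ac)
  qed
  thus ?thesis using B(1) by (intro exI[of _ B]) auto
qed

text \<open>
  By compactness of the unit sphere and homogeneity.
\<close>

lemma qf_lower: "\<exists>c>0. \<forall>t. c * norm t ^ 2 \<le> qf t"
proof -
  have pd: "t \<noteq> 0 \<Longrightarrow> t \<bullet> (covariance p \<mu> *v t) > 0" for t
    using basic by (simp add: basic_assumptions_def positive_definite_def)
  have cont: "continuous_on (sphere 0 1) qf"
    unfolding qf_def by (intro continuous_intros linear_continuous_on_compose[OF continuous_on_id] matrix_vector_mul_linear) simp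
  have ne: "sphere (0 :: real ^ 'd) 1 \<noteq> {}" by simp
  obtain u where u: "u \<in> sphere 0 1" "\<And>v. v \<in> sphere 0 1 \<Longrightarrow> qf u \<le> qf v"
    using continuous_attains_inf[OF compact_sphere ne cont] by blast
  have "u \<noteq> 0" using u(1) by auto
  hence "qf u > 0" using pd[of u] by (simp add: qf_def)
  moreover have "qf u * norm t ^ 2 \<le> qf t" for t
  proof (cases "t = 0")
    case False
    let ?v = "(1 / norm t) *\<^sub>R t"
    have "qf t = norm t ^ 2 * qf ?v"
      using False by (simp add: qf_def matrix_vector_mult_scaleR power2_eq_square)
    moreover have "qf u \<le> qf ?v" using False by (intro u(2)) simp
    ultimately show ?thesis by (metis mult.commute mult_left_mono zero_le_power2)
  qed (simp add: qf_def)
  ultimately show ?thesis by blast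
qed

lemma eig1_bound: "\<exists>C\<ge>0. \<forall>t. norm (eig1 t) \<le> C * norm t"
proof -
  obtain B where B: "B > 0" "\<And>f. norm (poisson_inv f) \<le> B * norm f" using poisson_inv_bounded by blast
  let ?C = "B * (CARD('e) * (moment_bound * norm (1 :: real ^ 'e)))"
  have "norm (eig1 t) \<le> ?C * norm t" for t
  proof -
    have "norm (eig1 t) \<le> B * norm (M_dir t *v 1)" unfolding eig1_def using B(2) by simp
    also have "\<dots> \<le> B * (CARD('e) * (norm t * moment_bound * norm (1 :: real ^ 'e)))"
      using B(1) by (intro mult_left_mono M_dir_bound) auto
    finally show ?thesis by (simp add: mult_ac)
  qed
  moreover have "?C \<ge> 0" using B(1) moment_bound_nonneg by simp
  ultimately show ?thesis by blast
qed

lemma eig2_bound: "\<exists>C\<ge>0. \<forall>t. norm (eig2 t) \<le> C * norm t ^ 2"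
proof -
  obtain B where B: "B > 0" "\<And>f. norm (poisson_inv f) \<le> B * norm f" using poisson_inv_bounded by blast
  obtain Ca where Ca: "Ca \<ge> 0" "\<And>t. norm (eig1 t) \<le> Ca * norm t" using eig1_bound by blast
  obtain Cq where Cq: "Cq \<ge> 0" "\<And>t. \<bar>qf t\<bar> \<le> Cq * norm t ^ 2" using qf_bound by blast
  let ?o = "norm (1 :: real ^ 'e)"
  let ?K = "CARD('e) * (moment_bound * ?o) + CARD('e) * (moment_bound * Ca) + Cq * ?o"
  have "norm (eig2 t) \<le> (B * ?K) * norm t ^ 2" for t
  proof -
    have 1: "norm ((1/2) *\<^sub>R (Sigma_dir t *v 1)) \<le> CARD('e) * (moment_bound * ?o) * norm t ^ 2"
    proof -
      have "norm ((1/2) *\<^sub>R (Sigma_dir t *v 1)) \<le> norm (Sigma_dir t *v 1)" by simp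
      also have "\<dots> \<le> CARD('e) * (norm t ^ 2 * moment_bound * ?o)" by (rule Sigma_dir_bound)
      finally show ?thesis by (simp add: mult_ac)
    qed
    have 2: "norm (M_dir t *v eig1 t) \<le> CARD('e) * (moment_bound * Ca) * norm t ^ 2"
    proof -
      have "norm (M_dir t *v eig1 t) \<le> CARD('e) * (norm t * moment_bound * norm (eig1 t))" by (rule M_dir_bound)
      also have "\<dots> \<le> CARD('e) * (norm t * moment_bound * (Ca * norm t))"
        using moment_bound_nonneg by (intro mult_left_mono Ca) auto
      finally show ?thesis by (simp add: power2_eq_square mult_ac)
    qed
    have 3: "norm (qf t *\<^sub>R (1 :: real ^ 'e)) \<le> Cq * ?o * norm t ^ 2"
      using mult_right_mono[OF Cq(2)[of t], of ?o] by (simp add: mult_ac)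
    have "norm (eig2 t) \<le> B * norm ((1/2) *\<^sub>R (Sigma_dir t *v 1) + M_dir t *v eig1 t - qf t *\<^sub>R 1)"
      unfolding eig2_def by (rule B(2))
    also have "\<dots> \<le> B * (norm ((1/2) *\<^sub>R (Sigma_dir t *v 1)) + norm (M_dir t *v eig1 t) + norm (qf t *\<^sub>R (1 :: real ^ 'e)))"
      using B(1) by (intro mult_left_mono order_trans[OF norm_triangle_ineq4] add_right_mono norm_triangle_ineq) auto
    also have "\<dots> \<le> B * (CARD('e) * (moment_bound * ?o) * norm t ^ 2 + CARD('e) * (moment_bound * Ca) * norm t ^ 2
        + Cq * ?o * norm t ^ 2)"
      using B(1) by (intro mult_left_mono add_mono 1 2 3) auto
    finally show ?thesis by (simp add: algebra_simps)
  qed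
  moreover have "B * ?K \<ge> 0" using B(1) Ca(1) Cq(1) moment_bound_nonneg by simp
  ultimately show ?thesis by blast
qed

lemma T_approx_eig:
  "T t (approx_eig t) j = T t (cf 1) j + \<i> * T t (cf (eig1 t)) j + T t (cf (eig2 t)) j"
proof -
  have "approx_eig t = (\<lambda>k. (cf 1 k + \<i> * cf (eig1 t) k) + cf (eig2 t) k)" by (auto simp: approx_eig_def)
  thus ?thesis by (simp only: char_op_add char_op_scale)
qed

text \<open>
  All terms up to second order cancel by the choice of \<open>eig1\<close> and \<open>eig2\<close>. Each remaining term is a
  Taylor remainder of total order three, or stems from replacing \<open>exp (- qf t)\<close> by \<open>1 - qf t\<close>.
\<close>

lemma approximate_eigenvector:
  "\<exists>C\<ge>0. \<forall>t\<in>period_cube. \<forall>j. cmod (T t (approx_eig t) j - exp (- qf t) * approx_eig t j) \<le> C * norm t ^ 3 \<and>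
     cmod (approx_eig t j - 1) \<le> C * norm t"
proof -
  obtain Ca where Ca: "Ca \<ge> 0" "\<And>t. norm (eig1 t) \<le> Ca * norm t" using eig1_bound by blast
  obtain Cb where Cb: "Cb \<ge> 0" "\<And>t. norm (eig2 t) \<le> Cb * norm t ^ 2" using eig2_bound by blast
  obtain Cq where Cq: "Cq \<ge> 0" "\<And>t. \<bar>qf t\<bar> \<le> Cq * norm t ^ 2" using qf_bound by blast
  obtain R where R: "R \<ge> 1" "\<And>t :: real ^ 'd. t \<in> period_cube \<Longrightarrow> norm t \<le> R" using period_cube_bounded by blast
  obtain c where c: "c > 0" "\<And>t. c * norm t ^ 2 \<le> qf t" using qf_lower by blast
  define K where "K = moment_bound"
  have K: "K \<ge> 0" using moment_bound_nonneg by (simp add: K_def)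
  define C3 where "C3 = Ca + Cb * R"
  have C3: "C3 \<ge> 0" using Ca Cb R by (simp add: C3_def)
  define C where "C = K * norm (1 :: real ^ 'e) + K * Ca + K * Cb + Cq\<^sup>2 * R * (1 + C3 * R) + Cq * C3"
  have w1: "cmod (approx_eig t j - 1) \<le> C3 * norm t" if t: "t \<in> period_cube" for t j
  proof -
    have "cmod (approx_eig t j - 1) \<le> \<bar>eig1 t $ j\<bar> + \<bar>eig2 t $ j\<bar>"
      unfolding approx_eig_def by (rule order_trans[OF _ order_trans[OF norm_triangle_ineq]])
         (auto simp: norm_mult)
    also have "\<dots> \<le> Ca * norm t + Cb * norm t ^ 2"
      using component_le_norm_cart[of "eig1 t" j] component_le_norm_cart[of "eig2 t" j] Ca(2)[of t] Cb(2)[of t]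
      by linarith
    also have "Cb * norm t ^ 2 \<le> Cb * (R * norm t)"
      unfolding power2_eq_square using Cb R(2)[OF t] by (intro mult_left_mono mult_right_mono) auto
    finally show ?thesis by (simp add: C3_def algebra_simps)
  qed
  have main: "cmod (T t (approx_eig t) j - exp (- qf t) * approx_eig t j) \<le> C * norm t ^ 3" if t: "t \<in> period_cube" for t j
  proof -
    define x where "x = norm t"
    have x: "0 \<le> x" "x \<le> R" using R(2)[OF t] by (auto simp: x_def)
    define q where "q = qf t"
    have q0: "0 \<le> q" using c(2)[of t] c(1) by (simp add: q_def order_trans[OF _ c(2)])
    have qx: "q \<le> Cq * x ^ 2" using Cq(2)[of t] by (simp add: q_def x_def)
    define e2 where "e2 = T t (cf 1) j - of_real ((Q *v 1) $ j) - \<i> * of_real ((M_dir t *v 1) $ j) + of_real ((Sigma_dir t *v 1) $ j / 2)"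
    define e1 where "e1 = T t (cf (eig1 t)) j - of_real ((Q *v eig1 t) $ j) - \<i> * of_real ((M_dir t *v eig1 t) $ j)"
    define e0 where "e0 = T t (cf (eig2 t)) j - of_real ((Q *v eig2 t) $ j)"
    have e2b: "cmod e2 \<le> K * norm (1 :: real ^ 'e) * x ^ 3"
      using char_op_taylor_2[of t 1 j] by (simp add: e2_def K_def x_def mult_ac)
    have e1b: "cmod e1 \<le> K * Ca * x ^ 3"
    proof -
      have "cmod e1 \<le> x ^ 2 * K * norm (eig1 t)" using char_op_taylor_1[of t "eig1 t" j] by (simp add: e1_def K_def x_def)
      also have "\<dots> \<le> x ^ 2 * K * (Ca * x)"
        using K Ca(2)[of t] by (intro mult_left_mono) (auto simp: x_def)
      finally show ?thesis by (simp add: power2_eq_square power3_eq_cube mult_ac)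
    qed
    have e0b: "cmod e0 \<le> K * Cb * x ^ 3"
    proof -
      have "cmod e0 \<le> x * K * norm (eig2 t)" using char_op_taylor_0[of t "eig2 t" j] by (simp add: e0_def K_def x_def)
      also have "\<dots> \<le> x * K * (Cb * x ^ 2)"
        using K Cb(2)[of t] x by (intro mult_left_mono) (auto simp: x_def)
      finally show ?thesis by (simp add: power2_eq_square power3_eq_cube mult_ac)
    qed
    \<comment> \<open>The second order expansion is used for the constant part, the first order one for \<open>eig1\<close>, and so on: every part then has an error of order three.\<close>
    have Tw: "T t (approx_eig t) j = e2 + \<i> * e1 + e0 + (approx_eig t j - of_real q)"
    proof -
      have f1: "T t (cf 1) j = e2 + 1 + \<i> * of_real ((M_dir t *v 1) $ j) - of_real ((Sigma_dir t *v 1) $ j / 2)"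
        by (simp add: e2_def Q_one algebra_simps)
      have f2: "T t (cf (eig1 t)) j
          = e1 + of_real (eig1 t $ j - (M_dir t *v 1) $ j) + \<i> * of_real ((M_dir t *v eig1 t) $ j)"
        by (simp add: e1_def Q_eig1 algebra_simps)
      have f3: "T t (cf (eig2 t)) j
          = e0 + of_real (eig2 t $ j + (Sigma_dir t *v 1) $ j / 2 + (M_dir t *v eig1 t) $ j - q)"
        by (simp add: e0_def Q_eig2 q_def algebra_simps)
      show ?thesis unfolding T_approx_eig approx_eig_def f1 f2 f3
        by (simp add: algebra_simps)
    qed
    have rest: "cmod (approx_eig t j - of_real q - exp (- q) * approx_eig t j)
        \<le> Cq\<^sup>2 * R * (1 + C3 * R) * x ^ 3 + Cq * C3 * x ^ 3"
    proof -
      have wx: "cmod (approx_eig t j - 1) \<le> C3 * x" using w1[OF t, of j] by (simp add: x_def)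
      have "cmod (approx_eig t j) \<le> 1 + cmod (approx_eig t j - 1)"
        using norm_triangle_ineq[of 1 "approx_eig t j - 1"] by simp
      also have "\<dots> \<le> 1 + C3 * R" using wx mult_left_mono[OF x(2) C3] by simp
      finally have w: "cmod (approx_eig t j) \<le> 1 + C3 * R" .
      have q2: "q\<^sup>2 \<le> Cq\<^sup>2 * R * x ^ 3"
      proof -
        have "q\<^sup>2 \<le> (Cq * x ^ 2)\<^sup>2" using q0 qx by (rule power_mono[rotated])
        also have "\<dots> = Cq\<^sup>2 * x * x ^ 3" by (simp add: power2_eq_square power3_eq_cube)
        also have "\<dots> \<le> Cq\<^sup>2 * R * x ^ 3"
          using x by (intro mult_right_mono mult_left_mono) auto
        finally show ?thesis .
      qed
      have "approx_eig t j - of_real q - exp (- q) * approx_eig t j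
          = of_real (1 - q - exp (- q)) * approx_eig t j + of_real q * (approx_eig t j - 1)"
        by (simp add: algebra_simps exp_of_real[symmetric])
      also have "cmod \<dots> \<le> \<bar>1 - q - exp (- q)\<bar> * cmod (approx_eig t j) + q * cmod (approx_eig t j - 1)"
        using q0 by (intro order_trans[OF norm_triangle_ineq]) (simp add: norm_mult del: of_real_diff)
      also have "\<dots> \<le> (Cq\<^sup>2 * R * x ^ 3) * (1 + C3 * R) + (Cq * x ^ 2) * (C3 * x)"
        using q0 qx x C3 Cq R
        by (intro add_mono mult_mono order_trans[OF exp_minus_bound[OF q0] q2] w wx) auto
      finally show ?thesis by (simp add: power2_eq_square power3_eq_cube mult_ac)
    qed
    have "T t (approx_eig t) j - exp (- qf t) * approx_eig t j
        = (e2 + \<i> * e1) + e0 + (approx_eig t j - of_real q - exp (- q) * approx_eig t j)"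
      unfolding Tw q_def by simp
    also have "cmod \<dots> \<le> cmod e2 + cmod e1 + cmod e0 + cmod (approx_eig t j - of_real q - exp (- q) * approx_eig t j)"
    proof -
      have "cmod (e2 + \<i> * e1) \<le> cmod e2 + cmod e1"
        using norm_triangle_ineq[of e2 "\<i> * e1"] by (simp add: norm_mult)
      thus ?thesis
        using norm_triangle_ineq[of "e2 + \<i> * e1" e0]
          norm_triangle_ineq[of "(e2 + \<i> * e1) + e0" "approx_eig t j - of_real q - exp (- q) * approx_eig t j"]
        by linarith
    qed
    also have "\<dots> \<le> C * x ^ 3"
      using e2b e1b e0b rest by (simp add: C_def distrib_right)
    finally show ?thesis by (simp add: x_def)
  qed
  have "C \<ge> 0" using K Ca Cb Cq C3 R by (simp add: C_def)
  show ?thesis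
  proof (intro exI[of _ "C + C3"] conjI ballI allI)
    show "0 \<le> C + C3" using \<open>C \<ge> 0\<close> C3 by simp
    fix t :: "real ^ 'd" and j assume t: "t \<in> period_cube"
    show "cmod (T t (approx_eig t) j - exp (- qf t) * approx_eig t j) \<le> (C + C3) * norm t ^ 3"
      using main[OF t, of j] C3 by (simp add: distrib_right add_increasing2)
    show "cmod (approx_eig t j - 1) \<le> (C + C3) * norm t"
      using w1[OF t, of j] \<open>C \<ge> 0\<close> by (simp add: distrib_right add_increasing)
  qed
qed

text \<open>
  Solution of the Poisson equation for the centred indicator of the state \<open>k\<close>.
\<close>

definition corrector :: "'e \<Rightarrow> real ^ 'e" where
  "corrector k = poisson_inv (axis k 1 - (\<mu> $ k) *\<^sub>R 1)"

lemma axis_decomposition: "axis k 1 = (\<mu> $ k) *\<^sub>R 1 + (Q *v corrector k - corrector k)"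
proof -
  have "\<mu> \<bullet> (axis k 1 - (\<mu> $ k) *\<^sub>R 1) = 0" by (simp add: inner_diff_right mu_one inner_axis)
  thus ?thesis by (simp add: corrector_def poisson_inv_solves)
qed

text \<open>
  A common rate for the decay of the operator powers and of the limiting Gaussian.
\<close>

lemma decay_constants:
  "\<exists>C c. c > 0 \<and> C > 0 \<and> (\<forall>t. c * norm t ^ 2 \<le> qf t) \<and>
     (\<forall>t\<in>period_cube. \<forall>n f B j. (\<forall>k. cmod (f k) \<le> B) \<longrightarrow>
        cmod ((T t ^^ n) f j) \<le> C * B * exp (- c * (n * (norm t)\<^sup>2)))"
proof -
  obtain c1 where c1: "c1 > 0" "\<And>t. c1 * norm t ^ 2 \<le> qf t" using qf_lower by blast
  obtain C c2 where c2: "c2 > 0" "C > 0" "\<And>t n f B j. t \<in> period_cube \<Longrightarrow> (\<And>k. cmod (f k) \<le> B) \<Longrightarrow>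
      cmod ((T t ^^ n) f j) \<le> C * B * exp (- c2 * n * (norm t)\<^sup>2)"
    using char_op_decay[OF stochastic arithmetic] by metis
  define c where "c = min c1 c2"
  have c: "c > 0" "c \<le> c1" "c \<le> c2" using c1 c2 by (auto simp: c_def)
  have "c * norm t ^ 2 \<le> qf t" for t
    using mult_right_mono[OF c(2), of "norm t ^ 2"] c1(2)[of t] by simp
  moreover have "cmod ((T t ^^ n) f j) \<le> C * B * exp (- c * (n * (norm t)\<^sup>2))"
    if t: "t \<in> period_cube" and f: "\<forall>k. cmod (f k) \<le> B" for t n f B j
  proof -
    have B: "B \<ge> 0" using f by (meson norm_ge_zero order_trans)
    have "c * (n * (norm t)\<^sup>2) \<le> c2 * (n * (norm t)\<^sup>2)" using c(3) by (rule mult_right_mono) simp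
    hence "exp (- c2 * n * (norm t)\<^sup>2) \<le> exp (- c * (n * (norm t)\<^sup>2))" by (simp add: mult.assoc)
    hence "C * B * exp (- c2 * n * (norm t)\<^sup>2) \<le> C * B * exp (- c * (n * (norm t)\<^sup>2))"
      using B c2(2) by (intro mult_left_mono) auto
    thus ?thesis using c2(3)[OF t, of f B n j] f by auto
  qed
  ultimately show ?thesis using c(1) c2(2) by blast
qed

text \<open>
  The indicator of \<open>k\<close> is split into its mean and the coboundary of the corrector. On the constant
  function, \<open>T t ^^ n\<close> acts like multiplication by \<open>exp (- n * qf t)\<close>; on the coboundary it
  produces an exact difference in \<open>n\<close>, which is not small by itself but telescopes later on. The
  errors are of size \<open>norm t\<close> and \<open>n * (norm t) ^ 3\<close>, times the exponential decay. The
  factor \<open>n * (norm t)\<^sup>2\<close> is absorbed by halving the rate of decay.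
\<close>

lemma local_expansion:
  "\<exists>C c. c > 0 \<and> C \<ge> 0 \<and> (\<forall>t. c * norm t ^ 2 \<le> qf t) \<and> (\<forall>t\<in>period_cube. \<forall>n j.
     cmod ((T t ^^ n) (cf (axis k 1)) j - of_real (\<mu> $ k * exp (- qf t) ^ n)
         - ((T t ^^ Suc n) (cf (corrector k)) j - (T t ^^ n) (cf (corrector k)) j))
       \<le> C * (norm t * exp (- c * (n * (norm t)\<^sup>2))))"
proof -
  obtain D c where c: "c > 0" and D: "D > 0" and ql: "\<And>t. c * norm t ^ 2 \<le> qf t"
    and dec: "\<And>t n f B j. t \<in> period_cube \<Longrightarrow> (\<And>k. cmod (f k) \<le> B) \<Longrightarrow>
        cmod ((T t ^^ n) f j) \<le> D * B * exp (- c * (n * (norm t)\<^sup>2))"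
    using decay_constants by metis
  obtain E where E: "E \<ge> 0" and ae: "\<And>t j. t \<in> period_cube \<Longrightarrow> cmod (T t (approx_eig t) j - exp (- qf t) * approx_eig t j) \<le> E * norm t ^ 3"
    and aw: "\<And>t j. t \<in> period_cube \<Longrightarrow> cmod (approx_eig t j - 1) \<le> E * norm t"
    using approximate_eigenvector by metis
  obtain R where R: "R \<ge> 1" "\<And>t :: real ^ 'd. t \<in> period_cube \<Longrightarrow> norm t \<le> R" using period_cube_bounded by blast
  define U where "U = moment_bound * norm (corrector k)"
  have U: "U \<ge> 0" using moment_bound_nonneg by (simp add: U_def)
  define H where "H = D * E * exp (c * R\<^sup>2)"
  have H: "H \<ge> 0" using D E by (simp add: H_def)
  define C where "C = D * E + H * (2 / c) + E + H + D * U"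
  have "cmod ((T t ^^ n) (cf (axis k 1)) j - of_real (\<mu> $ k * exp (- qf t) ^ n)
         - ((T t ^^ Suc n) (cf (corrector k)) j - (T t ^^ n) (cf (corrector k)) j))
       \<le> C * (norm t * exp (- (c/2) * (n * (norm t)\<^sup>2)))" if t: "t \<in> period_cube" for t n j
  proof -
    define x where "x = norm t"
    define r where "r = exp (- qf t)"
    define g where "g = exp (- c * x\<^sup>2)"
    define h where "h = exp (- (c/2) * (n * (norm t)\<^sup>2))"
    have x: "0 \<le> x" "x \<le> R" using R(2)[OF t] by (auto simp: x_def)
    have rg: "0 \<le> r" "r \<le> g" using ql[of t] by (auto simp: r_def g_def x_def)
    have g0: "0 < g" by (simp add: g_def)
    have gn: "exp (- c * (m * (norm t)\<^sup>2)) = g ^ m" for m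
      by (simp add: g_def x_def exp_of_nat_mult[symmetric] mult_ac)
    have dec': "cmod ((T t ^^ m) f j) \<le> D * B * g ^ m" if "\<And>k. cmod (f k) \<le> B" for f B m j
      using dec[where n=m and j=j, OF t that] unfolding gn .
    have g1: "1 / g \<le> exp (c * R\<^sup>2)"
    proof -
      have "x\<^sup>2 \<le> R\<^sup>2" using x by (intro power_mono) auto
      thus ?thesis using c by (simp add: g_def exp_minus field_simps)
    qed
    \<comment> \<open>Errors of the eigenvalue equation accumulate linearly in the number of steps. The factor \<open>g\<close> on the left absorbs the shift between \<open>g ^ m\<close> and \<open>g ^ Suc m\<close> in the induction.\<close>
    have step: "g * (cmod ((T t ^^ m) (approx_eig t) j - of_real (r ^ m) * approx_eig t j)) \<le> m * (D * E * x ^ 3) * g ^ m" for m j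
    proof (induction m arbitrary: j)
      case (Suc m)
      let ?d = "\<lambda>j. T t (approx_eig t) j - of_real r * approx_eig t j"
      have "(T t ^^ Suc m) (approx_eig t) j - of_real (r ^ Suc m) * approx_eig t j
          = (T t ^^ m) ?d j + of_real r * ((T t ^^ m) (approx_eig t) j - of_real (r ^ m) * approx_eig t j)"
        unfolding char_op_pow_diff char_op_pow_scale
        by (simp add: funpow_swap1 algebra_simps)
      also have "cmod \<dots> \<le> cmod ((T t ^^ m) ?d j) + r * cmod ((T t ^^ m) (approx_eig t) j - of_real (r ^ m) * approx_eig t j)"
        using rg by (intro order_trans[OF norm_triangle_ineq]) (simp add: norm_mult del: of_real_power)
      also have "\<dots> \<le> D * (E * x ^ 3) * g ^ m + r * cmod ((T t ^^ m) (approx_eig t) j - of_real (r ^ m) * approx_eig t j)"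
        by (intro add_right_mono dec') (use ae[OF t] in \<open>simp add: r_def x_def\<close>)
      also have "\<dots> \<le> D * (E * x ^ 3) * g ^ m + g * cmod ((T t ^^ m) (approx_eig t) j - of_real (r ^ m) * approx_eig t j)"
        using rg by (intro add_left_mono mult_right_mono) auto
      also have "\<dots> \<le> D * (E * x ^ 3) * g ^ m + m * (D * E * x ^ 3) * g ^ m"
        using Suc by (intro add_left_mono)
      also have "\<dots> = Suc m * (D * E * x ^ 3) * g ^ m" by (simp add: algebra_simps)
      finally have "g * cmod ((T t ^^ Suc m) (approx_eig t) j - of_real (r ^ Suc m) * approx_eig t j)
          \<le> g * (Suc m * (D * E * x ^ 3) * g ^ m)"
        using g0 by (intro mult_left_mono) auto
      thus ?case by (simp add: mult_ac)
    qed simp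
    have w: "cmod ((T t ^^ n) (approx_eig t) j - of_real (r ^ n) * approx_eig t j) \<le> H * (n * x ^ 3) * g ^ n"
    proof -
      have "cmod ((T t ^^ n) (approx_eig t) j - of_real (r ^ n) * approx_eig t j) \<le> (1 / g) * (n * (D * E * x ^ 3) * g ^ n)"
        using step[of n j] g0 by (simp add: field_simps)
      also have "\<dots> \<le> exp (c * R\<^sup>2) * (n * (D * E * x ^ 3) * g ^ n)"
        using g1 D E x g0 by (intro mult_right_mono) auto
      finally show ?thesis by (simp add: H_def mult_ac)
    qed
    have one: "cmod ((T t ^^ n) (\<lambda>_. 1) j - of_real (r ^ n)) \<le> (D * E * x + H * (n * x ^ 3) + E * x) * g ^ n"
    proof -
      have "(T t ^^ n) (\<lambda>_. 1) j - of_real (r ^ n) = (T t ^^ n) (approx_eig t) j - (T t ^^ n) (\<lambda>k. approx_eig t k - 1) j - of_real (r ^ n)"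
        unfolding char_op_pow_diff by simp
      also have "\<dots> = ((T t ^^ n) (approx_eig t) j - of_real (r ^ n) * approx_eig t j) - (T t ^^ n) (\<lambda>k. approx_eig t k - 1) j
            + of_real (r ^ n) * (approx_eig t j - 1)"
        by (simp add: algebra_simps)
      also have "cmod \<dots> \<le> cmod ((T t ^^ n) (approx_eig t) j - of_real (r ^ n) * approx_eig t j)
            + cmod ((T t ^^ n) (\<lambda>k. approx_eig t k - 1) j) + cmod (of_real (r ^ n) * (approx_eig t j - 1))"
        by (intro order_trans[OF norm_triangle_ineq] add_right_mono norm_triangle_ineq4)
      also have "\<dots> \<le> H * (n * x ^ 3) * g ^ n + D * (E * x) * g ^ n + g ^ n * (E * x)"
      proof (intro add_mono w)
        show "cmod ((T t ^^ n) (\<lambda>k. approx_eig t k - 1) j) \<le> D * (E * x) * g ^ n"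
          by (rule dec') (use aw[OF t] in \<open>simp add: x_def\<close>)
        show "cmod (of_real (r ^ n) * (approx_eig t j - 1)) \<le> g ^ n * (E * x)"
          unfolding norm_mult using aw[OF t] rg
          by (intro mult_mono) (auto simp: x_def power_mono norm_power)
      qed
      finally show ?thesis by (simp add: algebra_simps)
    qed
    \<comment> \<open>The coboundary \<open>Q u - u\<close> is traded for \<open>T t u - u\<close>, at the price of an error of first order in \<open>t\<close>.\<close>
    have ax: "cf (axis k 1) = (\<lambda>i. of_real (\<mu> $ k) * 1 + (T t (cf (corrector k)) i - cf (corrector k) i)
                   - (T t (cf (corrector k)) i - of_real ((Q *v corrector k) $ i)))"
    proof (rule ext)
      fix i
      have "(axis k 1 :: real ^ 'e) $ i = \<mu> $ k + ((Q *v corrector k) $ i - corrector k $ i)"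
        by (subst axis_decomposition) simp
      thus "cf (axis k 1) i = of_real (\<mu> $ k) * 1 + (T t (cf (corrector k)) i - cf (corrector k) i)
                   - (T t (cf (corrector k)) i - of_real ((Q *v corrector k) $ i))"
        by simp
    qed
    have "(T t ^^ n) (cf (axis k 1)) j = of_real (\<mu> $ k) * (T t ^^ n) (\<lambda>_. 1) j
        + ((T t ^^ Suc n) (cf (corrector k)) j - (T t ^^ n) (cf (corrector k)) j)
        - (T t ^^ n) (\<lambda>i. T t (cf (corrector k)) i - of_real ((Q *v corrector k) $ i)) j"
      unfolding ax
      by (simp only: char_op_pow_diff char_op_pow_add char_op_pow_scale funpow_Suc_right o_apply)
    moreover define V where "V = (T t ^^ n) (\<lambda>i. T t (cf (corrector k)) i - of_real ((Q *v corrector k) $ i)) j"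
    moreover define W where "W = (T t ^^ n) (\<lambda>_. 1) j - of_real (r ^ n)"
    ultimately have "(T t ^^ n) (cf (axis k 1)) j - of_real (\<mu> $ k * exp (- qf t) ^ n)
         - ((T t ^^ Suc n) (cf (corrector k)) j - (T t ^^ n) (cf (corrector k)) j) = of_real (\<mu> $ k) * W - V"
      by (simp add: r_def right_diff_distrib)
    hence "cmod ((T t ^^ n) (cf (axis k 1)) j - of_real (\<mu> $ k * exp (- qf t) ^ n)
         - ((T t ^^ Suc n) (cf (corrector k)) j - (T t ^^ n) (cf (corrector k)) j)) = cmod (of_real (\<mu> $ k) * W - V)"
      by (rule arg_cong)
    also have "\<dots> \<le> \<mu> $ k * cmod W + cmod V"
      using mu_nonneg[of k] by (intro order_trans[OF norm_triangle_ineq4]) (simp add: norm_mult)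
    also have "\<dots> \<le> 1 * ((D * E * x + H * (n * x ^ 3) + E * x) * g ^ n) + D * (U * x) * g ^ n"
    proof (rule add_mono)
      have "\<mu> $ k \<le> (\<Sum>j\<in>UNIV. \<mu> $ j)" by (rule member_le_sum) (auto simp: mu_nonneg)
      hence "\<mu> $ k \<le> 1" using stationary by (simp add: stationary_distribution_def)
      thus "\<mu> $ k * cmod W \<le> 1 * ((D * E * x + H * (n * x ^ 3) + E * x) * g ^ n)"
        unfolding W_def by (rule mult_mono[OF _ one]) simp_all
      have "cmod (T t (cf (corrector k)) i - of_real ((Q *v corrector k) $ i)) \<le> U * x" for i
        using char_op_taylor_0[of t "corrector k" i] by (simp add: U_def x_def mult_ac)
      thus "cmod V \<le> D * (U * x) * g ^ n"
        unfolding V_def by (rule dec')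
    qed
    also have "\<dots> = (D * E + E + D * U) * x * g ^ n + H * x * (n * x\<^sup>2 * g ^ n)"
      by (simp add: algebra_simps power2_eq_square power3_eq_cube)
    also have "\<dots> \<le> (D * E + E + D * U) * x * h + H * x * (2 / c * h)"
    proof (rule add_mono[OF mult_left_mono mult_left_mono])
      have "c / 2 * (n * (norm t)\<^sup>2) \<le> c * (n * (norm t)\<^sup>2)" using c by (intro mult_right_mono) auto
      thus "g ^ n \<le> h" unfolding gn[symmetric] h_def by simp
      show "n * x\<^sup>2 * g ^ n \<le> 2 / c * h"
        unfolding gn[symmetric] h_def x_def using times_exp_minus_le[OF c, of "n * (norm t)\<^sup>2"] by simp
    qed (use D E U H x in auto)
    also have "\<dots> \<le> C * (x * h)"
    proof -
      have "0 \<le> H * (x * h)" using H x by (simp add: h_def)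
      thus ?thesis by (simp add: C_def algebra_simps)
    qed
    finally show ?thesis unfolding x_def h_def .
  qed
  moreover have "C \<ge> 0" using D E H U c by (simp add: C_def)
  moreover have "c / 2 * norm t ^ 2 \<le> qf t" for t
    using ql[of t] c by (intro order_trans[OF _ ql]) auto
  ultimately show ?thesis using c by (intro exI[of _ C] exI[of _ "c / 2"]) simp
qed

end

section \<open>Fourier inversion on the square\<close>

text \<open>
  Pairs are used as coordinates, so that the Lebesgue measure is a product measure and the
  integrals over frequencies can be iterated.
\<close>

definition plane_vec :: "real \<times> real \<Rightarrow> real ^ 2" where
  "plane_vec z = fst z *\<^sub>R axis 1 1 + snd z *\<^sub>R axis 2 1"

lemma plane_vec_nth [simp]: "plane_vec z $ 1 = fst z" "plane_vec z $ 2 = snd z"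
  by (simp_all add: plane_vec_def axis_def)

lemma norm_plane_vec: "norm (plane_vec z) = norm z"
  by (cases z) (simp add: norm_vec_def L2_set_def sum_2 norm_Pair)

lemma continuous_on_plane_vec [continuous_intros]:
  "continuous_on A f \<Longrightarrow> continuous_on A (\<lambda>z. plane_vec (f z))"
  unfolding plane_vec_def by (intro continuous_intros)

definition square :: "(real \<times> real) set" where
  "square = {-pi..pi} \<times> {-pi..pi}"

lemma compact_square: "compact square"
  unfolding square_def by (intro compact_Times compact_Icc)

lemma plane_vec_period_cube: "z \<in> square \<Longrightarrow> plane_vec z \<in> period_cube"
  by (auto simp: square_def period_cube_def forall_2 abs_le_iff)

lemma integral_iexp_period:
  fixes a :: int
  shows "(\<integral>x. indicator {-pi..pi} x *\<^sub>R iexp (x * a) \<partial>lborel) = (if a = 0 then 2 * pi else 0)"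
proof (cases "a = 0")
  case True
  have "(\<integral>x. indicator {-pi..pi} x *\<^sub>R (1::complex) \<partial>lborel) = of_real (measure lborel {-pi..pi}) * 1"
    by (subst integral_scaleR_left) (auto simp: scaleR_conv_of_real)
  thus ?thesis using True by simp
next
  case False
  define F where "F = (\<lambda>x::real. iexp (x * a) / (\<i> * of_int a))"
  have "has_bochner_integral lborel (\<lambda>x. indicator {-pi..pi} x *\<^sub>R iexp (x * a)) (F pi - F (- pi))"
  proof (rule has_bochner_integral_FTC_Icc[where F=F])
    show "continuous_on {-pi..pi} (\<lambda>x. iexp (x * a))" by (intro continuous_intros)
    show "(F has_vector_derivative iexp (x * a)) (at x within {-pi..pi})" for x :: real
      unfolding F_def using False
      by (auto intro!: derivative_eq_intros has_vector_derivative_real_field simp: field_simps)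
  qed simp
  moreover have "iexp (pi * a) = iexp (- pi * a)"
  proof -
    have "sin (pi * a) = 0" using sin_zero_iff_int2[of "pi * a"] by (auto simp: mult.commute)
    thus ?thesis by (intro complex_eqI) (simp_all add: Re_exp Im_exp)
  qed
  ultimately show ?thesis using False by (simp add: F_def has_bochner_integral_iff)
qed

lemma phase_two: "plane_vec z \<bullet> real_vec v = fst z * real_of_int (v $ 1) + snd z * real_of_int (v $ 2)"
  by (simp add: inner_vec_def sum_2 real_vec_def)

lemma integral_square_phase:
  "(\<integral>z. indicator square z *\<^sub>R iexp (plane_vec z \<bullet> real_vec v) \<partial>lborel) = (if v = 0 then 4 * pi\<^sup>2 else 0)"
proof -
  let ?g = "\<lambda>a x. indicator {-pi..pi} x *\<^sub>R iexp (x * real_of_int a)"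
  let ?f = "\<lambda>z. indicator square z *\<^sub>R iexp (plane_vec z \<bullet> real_vec v)"
  have eq: "?f (x, y) = ?g (v $ 1) x * ?g (v $ 2) y" for x y
    by (simp add: square_def indicator_times phase_two distrib_left exp_add)
  have "integrable lborel ?f"
    by (rule borel_integrable_compact[OF compact_square]) (intro continuous_intros)
  hence "integrable (lborel \<Otimes>\<^sub>M lborel) ?f" by (simp only: lborel_prod)
  from lborel_pair.integral_fst'[OF this]
  have "(\<integral>z. ?f z \<partial>lborel) = (\<integral>x. \<integral>y. ?f (x, y) \<partial>lborel \<partial>lborel)"
    by (simp only: lborel_prod)
  also have "\<dots> = (\<integral>x. ?g (v $ 1) x \<partial>lborel) * (\<integral>y. ?g (v $ 2) y \<partial>lborel)"
    unfolding eq by (simp only: integral_mult_right_zero integral_mult_left_zero)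
  also have "\<dots> = (if v = 0 then 4 * pi\<^sup>2 else 0)"
    unfolding integral_iexp_period
    by (auto simp: vec_eq_iff forall_2 power2_eq_square)
  finally show ?thesis .
qed

text \<open>
  Integrating the characteristic function of \<open>P\<close> over the square and exchanging the integrals leaves
  the mass at the origin, as the characters of the lattice are orthogonal.
\<close>

lemma fourier_inversion:
  fixes P :: "((int ^ 2) \<times> 'e::finite) pmf"
  shows "complex_of_real (4 * pi\<^sup>2 * pmf P (0, k)) =
    (\<integral>z. indicator square z *\<^sub>R
        mean P (\<lambda>v. iexp (plane_vec z \<bullet> real_vec (fst v)) * of_bool (snd v = k)) \<partial>lborel)"
proof -
  interpret pair_sigma_finite "measure_pmf P" "lborel :: (real \<times> real) measure" ..
  let ?F = "\<lambda>v z. indicator square z *\<^sub>R (iexp (plane_vec z \<bullet> real_vec (fst v)) * of_bool (snd v = k)) :: complex"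
  have int2: "integrable lborel (?F v)" for v
    by (rule borel_integrable_compact[OF compact_square]) (intro continuous_intros)
  have fin: "integrable lborel (indicator square :: _ \<Rightarrow> real)"
    using borel_integrable_compact[OF compact_square, of "\<lambda>_. 1 :: real"] by simp
  have int: "integrable (measure_pmf P \<Otimes>\<^sub>M lborel) (\<lambda>(v, z). ?F v z)"
  proof (rule Fubini_integrable)
    have "(\<lambda>(v, z). ?F v z) \<in> borel_measurable (count_space UNIV \<Otimes>\<^sub>M lborel)"
      by (rule measurable_pair_measure_countable1) (use int2 in auto)
    thus "(\<lambda>(v, z). ?F v z) \<in> borel_measurable (measure_pmf P \<Otimes>\<^sub>M lborel)"
      by (simp cong: measurable_cong_sets sets_pair_measure_cong)
    have "(\<integral>z. norm (case (v, z) of (v, z) \<Rightarrow> ?F v z) \<partial>lborel) = of_bool (snd v = k) * measure lborel square"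
      for v :: "(int ^ 2) \<times> 'e"
    proof -
      have "(\<lambda>z. norm (?F v z)) = (\<lambda>z. of_bool (snd v = k) * indicator square z)"
        by (auto simp: fun_eq_iff norm_mult)
      thus ?thesis by simp
    qed
    thus "integrable (measure_pmf P) (\<lambda>v. \<integral>z. norm (case (v, z) of (v, z) \<Rightarrow> ?F v z) \<partial>lborel)"
      by (simp only:) (rule integrable_pmf_bounded[where B="measure lborel square"], simp add: of_bool_def)
  qed (use int2 in auto)
  have "(\<integral>z. indicator square z *\<^sub>R
        mean P (\<lambda>v. iexp (plane_vec z \<bullet> real_vec (fst v)) * of_bool (snd v = k)) \<partial>lborel)
      = (\<integral>z. (\<integral>v. ?F v z \<partial>P) \<partial>lborel)"
    by simp
  also have "\<dots> = (\<integral>v. (\<integral>z. ?F v z \<partial>lborel) \<partial>P)"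
    by (rule Fubini_integral[OF int])
  also have "\<dots> = (\<integral>v. of_real (4 * pi\<^sup>2 * indicator {(0, k)} v) \<partial>P)"
  proof (rule Bochner_Integration.integral_cong[OF refl])
    fix v
    have "(\<integral>z. ?F v z \<partial>lborel) = (\<integral>z. indicator square z *\<^sub>R iexp (plane_vec z \<bullet> real_vec (fst v)) \<partial>lborel) * of_bool (snd v = k)"
      by (subst integral_mult_left_zero[symmetric]) simp
    also have "\<dots> = of_real (4 * pi\<^sup>2 * indicator {(0, k)} v)"
      unfolding integral_square_phase by (cases v) (auto simp: indicator_def)
    finally show "(\<integral>z. ?F v z \<partial>lborel) = of_real (4 * pi\<^sup>2 * indicator {(0, k)} v)" .
  qed
  also have "\<dots> = of_real (4 * pi\<^sup>2 * pmf P (0, k))"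
    by (subst integral_complex_of_real) (simp add: measure_pmf_single)
  finally show ?thesis by simp
qed

section \<open>Gaussian integrals in the plane\<close>

lemma nn_integral_gaussian_line:
  fixes a m :: real assumes a: "a > 0"
  shows "(\<integral>\<^sup>+x. ennreal (exp (- a * (x + m)\<^sup>2)) \<partial>lborel) = ennreal (sqrt (pi / a))"
proof -
  define s where "s = 1 / sqrt (2 * a)"
  have s: "s > 0" using a by (simp add: s_def)
  have s2: "2 * s\<^sup>2 = 1 / a" using a by (simp add: s_def power_divide)
  have nd: "exp (- a * (x + m)\<^sup>2) = sqrt (pi / a) * normal_density (- m) s x" for x
  proof -
    have "2 * pi * s\<^sup>2 = pi / a" using s2 by (simp add: field_simps)
    thus ?thesis using a s2 by (simp add: normal_density_def)
  qed
  have "(\<integral>\<^sup>+x. ennreal (exp (- a * (x + m)\<^sup>2)) \<partial>lborel)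
      = ennreal (\<integral>x. sqrt (pi / a) * normal_density (- m) s x \<partial>lborel)"
    unfolding nd using a s by (intro nn_integral_eq_integral) auto
  thus ?thesis using s by simp
qed

text \<open>
  Completing the square in the first coordinate reduces the integral to two Gaussians on the line.
\<close>

lemma gaussian_plane:
  fixes a b c :: real
  assumes a: "a > 0" and D: "a * c - b\<^sup>2 > 0"
  shows "has_bochner_integral lborel
     (\<lambda>z. exp (- (a * (fst z)\<^sup>2 + 2 * b * (fst z * snd z) + c * (snd z)\<^sup>2))) (pi / sqrt (a * c - b\<^sup>2))"
proof (rule has_bochner_integral_nn_integral)
  let ?f = "\<lambda>z. exp (- (a * (fst z)\<^sup>2 + 2 * b * (fst z * snd z) + c * (snd z)\<^sup>2))"
  define d where "d = c - b\<^sup>2 / a"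
  have d: "d > 0" using a D by (simp add: d_def field_simps power2_eq_square)
  have eq: "?f (x, y) = exp (- a * (x + b * y / a)\<^sup>2) * exp (- d * (y + 0)\<^sup>2)" for x y
  proof -
    have "a * x\<^sup>2 + 2 * b * (x * y) + c * y\<^sup>2 = a * (x + b * y / a)\<^sup>2 + d * (y + 0)\<^sup>2"
      using a by (simp add: d_def power2_eq_square field_simps)
    thus ?thesis by (simp add: exp_add[symmetric])
  qed
  have "?f \<in> borel_measurable borel"
    by (intro borel_measurable_continuous_onI continuous_intros)
  thus meas: "?f \<in> borel_measurable lborel" by simp
  have "(\<integral>\<^sup>+z. ennreal (?f z) \<partial>lborel) = (\<integral>\<^sup>+z. ennreal (?f z) \<partial>(lborel \<Otimes>\<^sub>M lborel))"
    by (simp only: lborel_prod)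
  also have "\<dots> = (\<integral>\<^sup>+y. \<integral>\<^sup>+x. ennreal (?f (x, y)) \<partial>lborel \<partial>lborel)"
    by (rule lborel_pair.nn_integral_snd[symmetric]) (use meas in \<open>simp add: lborel_prod\<close>)
  also have "\<dots> = (\<integral>\<^sup>+y. ennreal (sqrt (pi / a)) * ennreal (exp (- d * (y + 0)\<^sup>2)) \<partial>lborel)"
  proof (rule nn_integral_cong)
    fix y :: real
    have "(\<integral>\<^sup>+x. ennreal (?f (x, y)) \<partial>lborel)
        = (\<integral>\<^sup>+x. ennreal (exp (- a * (x + b * y / a)\<^sup>2)) * ennreal (exp (- d * (y + 0)\<^sup>2)) \<partial>lborel)"
      unfolding eq by (simp add: ennreal_mult)
    also have "\<dots> = (\<integral>\<^sup>+x. ennreal (exp (- a * (x + b * y / a)\<^sup>2)) \<partial>lborel) * ennreal (exp (- d * (y + 0)\<^sup>2))"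
      by (rule nn_integral_multc) measurable
    finally show "(\<integral>\<^sup>+x. ennreal (?f (x, y)) \<partial>lborel) = ennreal (sqrt (pi / a)) * ennreal (exp (- d * (y + 0)\<^sup>2))"
      unfolding nn_integral_gaussian_line[OF a] .
  qed
  also have "\<dots> = ennreal (sqrt (pi / a)) * (\<integral>\<^sup>+y. ennreal (exp (- d * (y + 0)\<^sup>2)) \<partial>lborel)"
    by (rule nn_integral_cmult) measurable
  also have "\<dots> = ennreal (sqrt (pi / a) * sqrt (pi / d))"
    unfolding nn_integral_gaussian_line[OF d] using a d by (simp add: ennreal_mult)
  also have "sqrt (pi / a) * sqrt (pi / d) = pi / sqrt (a * c - b\<^sup>2)"
  proof -
    have "a * d = a * c - b\<^sup>2" using a by (simp add: d_def field_simps)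
    hence "sqrt a * sqrt d = sqrt (a * c - b\<^sup>2)" by (simp flip: real_sqrt_mult)
    thus ?thesis by (simp add: real_sqrt_divide)
  qed
  finally show "(\<integral>\<^sup>+z. ennreal (?f z) \<partial>lborel) = ennreal (pi / sqrt (a * c - b\<^sup>2))" .
qed (use D in auto)

lemma gaussian_norm:
  assumes m: "m > 0"
  shows "has_bochner_integral lborel (\<lambda>z :: real \<times> real. exp (- m * (norm z)\<^sup>2)) (pi / m)"
proof -
  have "(norm z)\<^sup>2 = (fst z)\<^sup>2 + (snd z)\<^sup>2" for z :: "real \<times> real"
    by (cases z) (simp add: norm_Pair)
  thus ?thesis using gaussian_plane[of m m 0] m
    by (simp add: algebra_simps real_sqrt_mult flip: power2_eq_square)
qed

text \<open>
  With \<open>y = sqrt m * x\<close> this is \<open>y \<le> exp (y\<^sup>2 / 2)\<close>. It turns the factor \<open>norm t\<close> in the error of the local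
  expansion into a gain of \<open>1 / sqrt n\<close>.
\<close>

lemma norm_gaussian_le:
  fixes x m :: real
  assumes m: "m > 0" and x: "x \<ge> 0"
  shows "x * exp (- m * x\<^sup>2) \<le> 1 / sqrt m * exp (- (m / 2) * x\<^sup>2)"
proof -
  define y where "y = sqrt m * x"
  have "0 \<le> (y - 1)\<^sup>2" by simp
  hence "y \<le> 1 + y\<^sup>2 / 2" by (simp add: power2_diff)
  also have "\<dots> \<le> exp (y\<^sup>2 / 2)" by (rule exp_ge_add_one_self)
  finally have "y * exp (- y\<^sup>2) \<le> exp (y\<^sup>2 / 2) * exp (- y\<^sup>2)" by (rule mult_right_mono) simp
  also have "\<dots> = exp (- y\<^sup>2 / 2)" by (simp add: exp_add[symmetric])
  finally have "sqrt m * x * exp (- m * x\<^sup>2) \<le> exp (- (m / 2) * x\<^sup>2)"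
    using m by (simp add: y_def power_mult_distrib)
  thus ?thesis using m by (simp add: field_simps)
qed

section \<open>Return probabilities\<close>

lemma inverse_sum_ln:
  assumes "N \<ge> 1"
  shows "\<bar>(\<Sum>n=1..N. 1 / real n) - ln (real N)\<bar> \<le> 1"
proof -
  have h: "(\<Sum>n=1..N. 1 / real n) = harm N" by (simp add: harm_def inverse_eq_divide)
  have "ln (real N) \<le> ln (real N + 1)" using assms by simp
  also have "\<dots> \<le> harm N" by (rule ln_le_harm)
  finally have "ln (real N) \<le> harm N" .
  moreover have "harm N - ln (real N) \<le> (harm 1 - ln (real 1) :: real)"
    using assms euler_mascheroni_sequence_decreasing[of 1 N] by simp
  ultimately show ?thesis unfolding h by (simp add: harm_def)
qed

locale rwwis2 = rwwis p \<mu> for p :: "(2, 'e::finite) kernel" and \<mu> :: "real ^ 'e"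
begin

abbreviation \<sigma> where "\<sigma> \<equiv> covariance p \<mu>"

definition returns :: "'e \<Rightarrow> nat \<Rightarrow> 'e \<Rightarrow> real" where
  "returns j n k = pmf (walk_pmf p n (0, j)) (0, k)"

lemma sigma_sym: "\<sigma> $ 2 $ 1 = \<sigma> $ 1 $ 2"
proof -
  have "transpose \<sigma> = \<sigma>" using basic by (simp add: basic_assumptions_def positive_definite_def)
  hence "transpose \<sigma> $ 1 $ 2 = \<sigma> $ 1 $ 2" by simp
  thus ?thesis by (simp add: transpose_def)
qed

lemma qf_plane_vec: "qf (plane_vec z) = (\<sigma> $ 1 $ 1 * (fst z)\<^sup>2 + 2 * \<sigma> $ 1 $ 2 * (fst z * snd z) + \<sigma> $ 2 $ 2 * (snd z)\<^sup>2) / 2"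
  by (simp add: qf_def inner_vec_def matrix_vector_mult_def sum_2 sigma_sym power2_eq_square algebra_simps)

lemma qf_pos: "z \<noteq> 0 \<Longrightarrow> qf (plane_vec z) > 0"
proof -
  assume z: "z \<noteq> 0"
  obtain c where "c > 0" "\<And>t. c * norm t ^ 2 \<le> qf t" using qf_lower by blast
  moreover have "norm (plane_vec z) ^ 2 > 0" using z by (simp add: norm_plane_vec)
  ultimately show ?thesis by (meson less_le_trans mult_pos_pos)
qed

lemma sigma11_pos: "\<sigma> $ 1 $ 1 > 0"
  using qf_pos[of "(1, 0)"] by (simp add: qf_plane_vec zero_prod_def)

lemma det_sigma: "det \<sigma> = \<sigma> $ 1 $ 1 * \<sigma> $ 2 $ 2 - (\<sigma> $ 1 $ 2)\<^sup>2"
  by (simp add: det_2 sigma_sym power2_eq_square)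

lemma det_pos: "det \<sigma> > 0"
proof -
  have "2 * qf (plane_vec (- (\<sigma> $ 1 $ 2), \<sigma> $ 1 $ 1)) = \<sigma> $ 1 $ 1 * det \<sigma>"
    by (simp add: qf_plane_vec det_sigma power2_eq_square field_simps)
  moreover have "qf (plane_vec (- (\<sigma> $ 1 $ 2), \<sigma> $ 1 $ 1)) > 0" using sigma11_pos by (intro qf_pos) (simp add: zero_prod_def)
  ultimately have "0 < \<sigma> $ 1 $ 1 * det \<sigma>" by linarith
  thus ?thesis using sigma11_pos by (rule zero_less_mult_pos)
qed

lemma gaussian_qf:
  assumes n: "n \<ge> 1"
  shows "has_bochner_integral lborel (\<lambda>z. exp (- qf (plane_vec z)) ^ n) (2 * pi / (real n * sqrt (det \<sigma>)))"
proof -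
  let ?a = "real n * \<sigma> $ 1 $ 1 / 2" and ?b = "real n * \<sigma> $ 1 $ 2 / 2" and ?c = "real n * \<sigma> $ 2 $ 2 / 2"
  have D: "?a * ?c - ?b\<^sup>2 = (real n / 2)\<^sup>2 * det \<sigma>"
    by (simp add: det_sigma power2_eq_square algebra_simps)
  have "has_bochner_integral lborel
     (\<lambda>z. exp (- (?a * (fst z)\<^sup>2 + 2 * ?b * (fst z * snd z) + ?c * (snd z)\<^sup>2))) (pi / sqrt (?a * ?c - ?b\<^sup>2))"
    by (rule gaussian_plane) (use n sigma11_pos det_pos D in auto)
  also have "(\<lambda>z. exp (- (?a * (fst z)\<^sup>2 + 2 * ?b * (fst z * snd z) + ?c * (snd z)\<^sup>2)))
     = (\<lambda>z. exp (- qf (plane_vec z)) ^ n)"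
    by (simp add: fun_eq_iff qf_plane_vec exp_of_nat_mult[symmetric] field_simps)
  also have "pi / sqrt (?a * ?c - ?b\<^sup>2) = 2 * pi / (real n * sqrt (det \<sigma>))"
    unfolding D by (simp add: real_sqrt_mult)
  finally show ?thesis .
qed

lemma char_op_pow_expectation:
  "(T t ^^ n) f j = mean (walk_pmf p n (0, j)) (\<lambda>v. iexp (t \<bullet> real_vec (fst v)) * f (snd v))"
  using char_op_pow_walk[of p n "(0, j)" t f] by (simp add: real_vec_simps)

lemma continuous_char_op_pow: "continuous_on A (\<lambda>z. (T (plane_vec z) ^^ n) f j)"
proof -
  obtain B where B: "\<And>k. cmod (f k) \<le> B" using finite_range_bound by blast
  show ?thesis unfolding char_op_pow_expectation
    by (rule continuous_on_LINT_pmf[where B=B]) (auto intro!: continuous_intros simp: norm_mult B)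
qed

lemma integrable_char_op_pow: "integrable lborel (\<lambda>z. indicator square z *\<^sub>R (T (plane_vec z) ^^ n) f j)"
  by (rule borel_integrable_compact[OF compact_square continuous_char_op_pow])

lemma returns_fourier:
  "complex_of_real (4 * pi\<^sup>2 * returns j n k)
     = (\<integral>z. indicator square z *\<^sub>R (T (plane_vec z) ^^ n) (cf (axis k 1)) j \<partial>lborel)"
  unfolding returns_def fourier_inversion char_op_pow_expectation
  by (intro Bochner_Integration.integral_cong refl arg_cong2[where f=scaleR]) (auto simp: axis_def of_bool_def)

text \<open>
  The decay estimate gives at most the order of the integral of a Gaussian of variance \<open>1 / n\<close>.
\<close>

lemma returns_upper: "\<exists>C\<ge>0. \<forall>n\<ge>1. \<forall>j k. returns j n k \<le> C / real n"
proof -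
  obtain D c where c: "c > 0" and D: "D > 0"
    and dec: "\<And>t n f B j. t \<in> period_cube \<Longrightarrow> (\<And>k. cmod (f k) \<le> B) \<Longrightarrow>
        cmod ((T t ^^ n) f j) \<le> D * B * exp (- c * (n * (norm t)\<^sup>2))"
    using decay_constants by metis
  have "returns j n k \<le> (D * (pi / c) / (4 * pi\<^sup>2)) / real n" if n: "n \<ge> 1" for n j k
  proof -
    have cn: "c * n > 0" using c n by simp
    have g: "has_bochner_integral lborel (\<lambda>z :: real \<times> real. D * exp (- (c * n) * (norm z)\<^sup>2)) (D * (pi / (c * n)))"
      by (intro has_bochner_integral_mult_right gaussian_norm cn)
    have "4 * pi\<^sup>2 * returns j n k = cmod (complex_of_real (4 * pi\<^sup>2 * returns j n k))"
      by (simp only: norm_of_real) (simp add: returns_def)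
    also have "\<dots> \<le> (\<integral>z. cmod (indicator square z *\<^sub>R (T (plane_vec z) ^^ n) (cf (axis k 1)) j) \<partial>lborel)"
      unfolding returns_fourier by (rule integral_norm_bound)
    also have "\<dots> \<le> integral\<^sup>L lborel (\<lambda>z::real \<times> real. D * exp (- (c * n) * (norm z)\<^sup>2))"
    proof (rule integral_mono)
      fix z :: "real \<times> real"
      have "cmod ((T (plane_vec z) ^^ n) (cf (axis k 1)) j) \<le> D * 1 * exp (- c * (n * (norm (plane_vec z))\<^sup>2))" if "z \<in> square"
        by (rule dec[OF plane_vec_period_cube[OF that]]) (simp add: axis_def)
      thus "cmod (indicator square z *\<^sub>R (T (plane_vec z) ^^ n) (cf (axis k 1)) j) \<le> D * exp (- (c * n) * (norm z)\<^sup>2)"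
        using D by (auto simp: indicator_def norm_plane_vec mult.assoc)
    qed (use g integrable_char_op_pow in \<open>auto simp: has_bochner_integral_iff simp del: norm_scaleR\<close>)
    also have "\<dots> = D * (pi / (c * n))" using g by (simp add: has_bochner_integral_iff)
    finally show ?thesis using n c by (simp add: field_simps)
  qed
  moreover have "D * (pi / c) / (4 * pi\<^sup>2) \<ge> 0" using D c by simp
  ultimately show ?thesis by blast
qed

definition corrector_integral :: "'e \<Rightarrow> 'e \<Rightarrow> nat \<Rightarrow> complex" where
  "corrector_integral k j n =
     (\<integral>z. indicator square z *\<^sub>R (T (plane_vec z) ^^ n) (cf (corrector k)) j \<partial>lborel)"

text \<open>
  The Gaussian integral is taken over the whole plane. Outside of the square \<open>norm z \<ge> 1\<close> holds, so the
  excess is dominated by the same function \<open>norm z * exp (- c * n * (norm z)\<^sup>2)\<close> as the error inside.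
\<close>

lemma returns_expansion:
  "\<exists>C\<ge>0. \<forall>n\<ge>1. \<forall>j. cmod (complex_of_real (4 * pi\<^sup>2 * returns j n k - \<mu> $ k * (2 * pi / (real n * sqrt (det \<sigma>))))
     - (corrector_integral k j (Suc n) - corrector_integral k j n)) \<le> C * real n powr (- 3 / 2)"
proof -
  obtain C c where c: "c > 0" and C: "C \<ge> 0" and ql: "\<And>t. c * norm t ^ 2 \<le> qf t" and
    le: "\<And>t n j. t \<in> period_cube \<Longrightarrow> cmod ((T t ^^ n) (cf (axis k 1)) j - of_real (\<mu> $ k * exp (- qf t) ^ n)
         - ((T t ^^ Suc n) (cf (corrector k)) j - (T t ^^ n) (cf (corrector k)) j))
       \<le> C * (norm t * exp (- c * (n * (norm t)\<^sup>2)))"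
    using local_expansion[of k] by metis
  define K where "K = (C + 1) * (2 * pi / (c * sqrt c))"
  have K: "K \<ge> 0" using C c by (simp add: K_def)
  have "cmod (complex_of_real (4 * pi\<^sup>2 * returns j n k - \<mu> $ k * (2 * pi / (real n * sqrt (det \<sigma>))))
     - (corrector_integral k j (Suc n) - corrector_integral k j n))
     \<le> K * real n powr (- 3 / 2)" if n: "n \<ge> 1" for n j
  proof -
    have cn: "c * n > 0" using c n by simp
    let ?I = "indicator square :: real \<times> real \<Rightarrow> real"
    let ?A = "\<lambda>z. ?I z *\<^sub>R (T (plane_vec z) ^^ n) (cf (axis k 1)) j"
    let ?U = "\<lambda>n z. ?I z *\<^sub>R (T (plane_vec z) ^^ n) (cf (corrector k)) j"
    let ?g = "\<lambda>z. complex_of_real (\<mu> $ k * exp (- qf (plane_vec z)) ^ n)"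
    let ?h = "\<lambda>z :: real \<times> real. (C + 1) * (1 / sqrt (c * n) * exp (- (c * n / 2) * (norm z)\<^sup>2))"
    have g: "has_bochner_integral lborel ?g (of_real (\<mu> $ k * (2 * pi / (real n * sqrt (det \<sigma>)))))"
      by (intro has_bochner_integral_of_real has_bochner_integral_mult_right gaussian_qf n)
    have h: "has_bochner_integral lborel ?h ((C + 1) * (1 / sqrt (c * n) * (pi / (c * n / 2))))"
      by (intro has_bochner_integral_mult_right gaussian_norm) (use cn in simp)
    have ig: "integrable lborel ?g" using g by (simp add: has_bochner_integral_iff)
    have iA: "integrable lborel ?A" by (rule integrable_char_op_pow)
    have iU: "integrable lborel (?U m)" for m by (rule integrable_char_op_pow)
    have "complex_of_real (4 * pi\<^sup>2 * returns j n k - \<mu> $ k * (2 * pi / (real n * sqrt (det \<sigma>))))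
        - ((\<integral>z. ?U (Suc n) z \<partial>lborel) - (\<integral>z. ?U n z \<partial>lborel))
        = (\<integral>z. ?A z \<partial>lborel) - (\<integral>z. ?g z \<partial>lborel) - ((\<integral>z. ?U (Suc n) z \<partial>lborel) - (\<integral>z. ?U n z \<partial>lborel))"
      using g returns_fourier[of j n k] by (simp add: has_bochner_integral_iff)
    also have "\<dots> = (\<integral>z. ?A z - ?g z - (?U (Suc n) z - ?U n z) \<partial>lborel)"
      using iA ig iU by (simp only: Bochner_Integration.integral_diff Bochner_Integration.integrable_diff)
    finally have eq: "complex_of_real (4 * pi\<^sup>2 * returns j n k - \<mu> $ k * (2 * pi / (real n * sqrt (det \<sigma>))))
        - ((\<integral>z. ?U (Suc n) z \<partial>lborel) - (\<integral>z. ?U n z \<partial>lborel))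
        = (\<integral>z. ?A z - ?g z - (?U (Suc n) z - ?U n z) \<partial>lborel)" .
    have "cmod (\<integral>z. ?A z - ?g z - (?U (Suc n) z - ?U n z) \<partial>lborel)
        \<le> (\<integral>z. cmod (?A z - ?g z - (?U (Suc n) z - ?U n z)) \<partial>lborel)"
      by (rule integral_norm_bound)
    also have "\<dots> \<le> (\<integral>z. ?h z \<partial>lborel)"
    proof (rule integral_mono)
      show "integrable lborel (\<lambda>z. cmod (?A z - ?g z - (?U (Suc n) z - ?U n z)))"
        by (intro integrable_norm Bochner_Integration.integrable_diff iA ig iU)
      show "integrable lborel ?h" using h by (simp add: has_bochner_integral_iff)
      fix z :: "real \<times> real"
      let ?x = "norm z"
      have xh: "?x * exp (- (c * n) * ?x\<^sup>2) \<le> 1 / sqrt (c * n) * exp (- (c * n / 2) * ?x\<^sup>2)"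
        by (rule norm_gaussian_le[OF cn]) simp
      show "cmod (?A z - ?g z - (?U (Suc n) z - ?U n z)) \<le> ?h z"
      proof (cases "z \<in> square")
        case True
        have "cmod (?A z - ?g z - (?U (Suc n) z - ?U n z)) \<le> C * (?x * exp (- (c * n) * ?x\<^sup>2))"
          using le[OF plane_vec_period_cube[OF True], of n j] True by (simp add: norm_plane_vec mult.assoc)
        also have "\<dots> \<le> (C + 1) * (1 / sqrt (c * n) * exp (- (c * n / 2) * ?x\<^sup>2))"
          using C by (intro mult_mono xh) auto
        finally show ?thesis .
      next
        case False
        have x1: "1 \<le> ?x"
        proof -
          have "\<bar>fst z\<bar> > pi \<or> \<bar>snd z\<bar> > pi" using False by (cases z) (auto simp: square_def abs_le_iff not_le)
          moreover have "\<bar>fst z\<bar> \<le> ?x" "\<bar>snd z\<bar> \<le> ?x"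
            using norm_fst_le[of "fst z" "snd z"] norm_snd_le[of "snd z" "fst z"] by auto
          ultimately show ?thesis using pi_gt3 by linarith
        qed
        have mu1: "\<mu> $ k \<le> 1"
        proof -
          have "\<mu> $ k \<le> (\<Sum>j\<in>UNIV. \<mu> $ j)" by (rule member_le_sum) (auto simp: mu_nonneg)
          thus ?thesis using stationary by (simp add: stationary_distribution_def)
        qed
        have "cmod (?A z - ?g z - (?U (Suc n) z - ?U n z)) = \<mu> $ k * exp (- qf (plane_vec z)) ^ n"
          using False mu_nonneg[of k] by (simp add: norm_mult norm_power del: of_real_mult)
        also have "\<dots> \<le> 1 * exp (- qf (plane_vec z)) ^ n"
          using mu1 by (intro mult_right_mono) auto
        also have "\<dots> = exp (- (n * qf (plane_vec z)))" by (simp add: exp_of_nat_mult[symmetric])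
        also have "\<dots> \<le> exp (- (c * n) * ?x\<^sup>2)"
          using mult_left_mono[OF ql[of "plane_vec z"], of "real n"] by (simp add: norm_plane_vec mult_ac)
        also have "\<dots> \<le> ?x * exp (- (c * n) * ?x\<^sup>2)" using x1 by simp
        also have "\<dots> \<le> (C + 1) * (1 / sqrt (c * n) * exp (- (c * n / 2) * ?x\<^sup>2))"
          using xh C mult_mono[of 1 "C + 1", OF _ xh] by simp
        finally show ?thesis .
      qed
    qed
    also have "\<dots> = (C + 1) * (1 / sqrt (c * n) * (pi / (c * n / 2)))"
      using h by (simp add: has_bochner_integral_iff)
    also have "\<dots> = K * (1 / (real n * sqrt n))"
      by (simp add: K_def real_sqrt_mult field_simps)
    also have "1 / (real n * sqrt n) = real n powr (- 3 / 2)"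
    proof -
      have "real n powr (3 / 2) = real n powr (1 + 1 / 2)" by simp
      also have "\<dots> = real n * sqrt n" using n by (simp only: powr_add powr_half_sqrt) simp
      finally show ?thesis using n by (simp add: powr_minus_divide)
    qed
    finally show ?thesis unfolding corrector_integral_def eq .
  qed
  thus ?thesis using K by blast
qed

text \<open>
  The reciprocal of the leading constant of the theorem.
\<close>

definition renewal_const :: real where "renewal_const = 1 / (2 * pi * sqrt (det \<sigma>))"

lemma renewal_const_pos: "renewal_const > 0"
  using det_pos by (simp add: renewal_const_def)

text \<open>
  Summing the expansion, the main terms form a harmonic sum, the corrector integrals telescope and
  stay bounded, and the remaining errors \<open>real n powr (- 3 / 2)\<close> are summable.
\<close>

lemma returns_sum_state:
  "\<exists>C\<ge>0. \<forall>N\<ge>1. \<forall>j. \<bar>(\<Sum>n=1..N. returns j n k) - \<mu> $ k * renewal_const * ln (real N)\<bar> \<le> C"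
proof -
  define V where "V = corrector_integral k"
  obtain C where C: "C \<ge> 0" and le: "\<forall>n\<ge>1. \<forall>j. cmod (complex_of_real (4 * pi\<^sup>2 * returns j n k
      - \<mu> $ k * (2 * pi / (real n * sqrt (det \<sigma>)))) - (V j (Suc n) - V j n)) \<le> C * real n powr (- 3 / 2)"
    using returns_expansion[of k] unfolding V_def by blast
  define S where "S = (\<Sum>n. real n powr (- 3 / 2))"
  have sm: "summable (\<lambda>n. real n powr (- 3 / 2))" by (simp add: summable_real_powr_iff)
  have S: "(\<Sum>n=1..N. real n powr (- 3 / 2)) \<le> S" for N
    unfolding S_def by (rule sum_le_suminf[OF sm]) auto
  have S0: "0 \<le> S" unfolding S_def by (rule suminf_nonneg[OF sm]) simp
  define B where "B = norm (corrector k) * measure lborel square"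
  have B0: "B \<ge> 0" by (simp add: B_def)
  have V: "cmod (V j n) \<le> B" for j n
  proof -
    have i: "integrable lborel (indicator square :: _ \<Rightarrow> real)"
      using borel_integrable_compact[OF compact_square, of "\<lambda>_. 1 :: real"] by simp
    have "cmod (V j n) \<le> (\<integral>z. cmod (indicator square z *\<^sub>R (T (plane_vec z) ^^ n) (cf (corrector k)) j) \<partial>lborel)"
      unfolding V_def corrector_integral_def by (rule integral_norm_bound)
    also have "\<dots> \<le> (\<integral>z. norm (corrector k) * indicator square z \<partial>lborel)"
    proof (rule integral_mono)
      show "integrable lborel (\<lambda>z. cmod (indicator square z *\<^sub>R (T (plane_vec z) ^^ n) (cf (corrector k)) j))"
        by (rule integrable_norm[OF integrable_char_op_pow])
      fix z
      have "cmod ((T (plane_vec z) ^^ n) (cf (corrector k)) j) \<le> norm (corrector k)"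
        by (rule char_op_pow_bound) (simp add: component_le_norm_cart)
      thus "cmod (indicator square z *\<^sub>R (T (plane_vec z) ^^ n) (cf (corrector k)) j) \<le> norm (corrector k) * indicator square z"
        by (simp add: indicator_def)
    qed (use i in simp)
    finally show ?thesis by (simp add: B_def)
  qed
  define K where "K = 2 * B + C * S"
  have K: "K \<ge> 0" using B0 C S0 by (simp add: K_def)
  have "\<bar>(\<Sum>n=1..N. returns j n k) - \<mu> $ k * renewal_const * ln (real N)\<bar> \<le> K / (4 * pi\<^sup>2) + \<mu> $ k * renewal_const"
    if N: "N \<ge> 1" for N j
  proof -
    define a where "a n = 4 * pi\<^sup>2 * returns j n k - \<mu> $ k * (2 * pi / (real n * sqrt (det \<sigma>)))" for n
    have "(\<Sum>n=1..N. V j (Suc n) - V j n) = V j (Suc N) - V j 1"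
      using N by (intro sum_Suc_diff) simp
    hence "complex_of_real (\<Sum>n=1..N. a n)
        = (\<Sum>n=1..N. complex_of_real (a n) - (V j (Suc n) - V j n)) + (V j (Suc N) - V j 1)"
      by (simp only: sum_subtractf of_real_sum) simp
    also have "cmod \<dots> \<le> (\<Sum>n=1..N. C * real n powr (- 3 / 2)) + (B + B)"
    proof (rule order_trans[OF norm_triangle_ineq add_mono])
      show "cmod (\<Sum>n=1..N. complex_of_real (a n) - (V j (Suc n) - V j n)) \<le> (\<Sum>n=1..N. C * real n powr (- 3 / 2))"
        by (rule sum_norm_le) (use le in \<open>simp add: a_def\<close>)
      show "cmod (V j (Suc N) - V j 1) \<le> B + B"
        by (rule order_trans[OF norm_triangle_ineq4 add_mono[OF V V]])
    qed
    also have "(\<Sum>n=1..N. C * real n powr (- 3 / 2)) \<le> C * S"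
      unfolding sum_distrib_left[symmetric] using S C by (intro mult_left_mono) auto
    finally have 1: "\<bar>\<Sum>n=1..N. a n\<bar> \<le> K" by (simp only: norm_of_real) (simp add: K_def)
    have "(\<Sum>n=1..N. a n) = 4 * pi\<^sup>2 * ((\<Sum>n=1..N. returns j n k) - \<mu> $ k * renewal_const * (\<Sum>n=1..N. 1 / real n))"
    proof -
      have "a n = 4 * pi\<^sup>2 * (returns j n k - \<mu> $ k * renewal_const * (1 / real n))" for n
        by (simp add: a_def renewal_const_def power2_eq_square field_simps)
      hence "(\<Sum>n=1..N. a n) = 4 * pi\<^sup>2 * (\<Sum>n=1..N. returns j n k - \<mu> $ k * renewal_const * (1 / real n))"
        by (simp only: sum_distrib_left)
      thus ?thesis by (simp only: sum_subtractf sum_distrib_left[of "\<mu> $ k * renewal_const"])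
    qed
    with 1 have "4 * pi\<^sup>2 * \<bar>(\<Sum>n=1..N. returns j n k) - \<mu> $ k * renewal_const * (\<Sum>n=1..N. 1 / real n)\<bar> \<le> K"
      by (simp add: abs_mult)
    hence 2: "\<bar>(\<Sum>n=1..N. returns j n k) - \<mu> $ k * renewal_const * (\<Sum>n=1..N. 1 / real n)\<bar> \<le> K / (4 * pi\<^sup>2)"
      by (simp add: field_simps)
    have "\<bar>\<mu> $ k * renewal_const * (\<Sum>n=1..N. 1 / real n) - \<mu> $ k * renewal_const * ln (real N)\<bar> \<le> \<mu> $ k * renewal_const * 1"
      unfolding right_diff_distrib[symmetric] abs_mult
      using inverse_sum_ln[OF N] mu_nonneg[of k] renewal_const_pos by (intro mult_mono) auto
    with 2 show ?thesis by linarith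
  qed
  moreover have "K / (4 * pi\<^sup>2) + \<mu> $ k * renewal_const \<ge> 0" using K mu_nonneg[of k] renewal_const_pos by simp
  ultimately show ?thesis by blast
qed

lemma returns_sum:
  "\<exists>C\<ge>0. \<forall>N\<ge>1. \<forall>j k. \<bar>(\<Sum>n=1..N. returns j n k) - \<mu> $ k * renewal_const * ln (real N)\<bar> \<le> C"
proof -
  obtain C where C: "\<And>k. C k \<ge> 0"
    "\<And>k N j. N \<ge> 1 \<Longrightarrow> \<bar>(\<Sum>n=1..N. returns j n k) - \<mu> $ k * renewal_const * ln (real N)\<bar> \<le> C k"
    using returns_sum_state by metis
  have "C k \<le> sum C UNIV" for k by (rule member_le_sum) (auto simp: C)
  moreover have "sum C UNIV \<ge> 0" by (rule sum_nonneg) (auto simp: C)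
  ultimately show ?thesis using C(2) by (meson order_trans)
qed

lemma escape_renewal:
  "escape p n j + (\<Sum>i=1..n. \<Sum>k\<in>UNIV. returns j i k * escape p (n - i) k) = 1"
  using last_visit_decomposition[of p 0 n "(0, j)"] by (simp add: escape_def returns_def)

end

section \<open>The Tauberian argument of Dvoretzky and Erdos\<close>

text \<open>
  Put \<open>\<gamma> n = (\<Sum>k. m k * g n k)\<close>. In the renewal equation for \<open>n\<close>, monotonicity allows to replace every
  \<open>g (n - i)\<close> by the smaller \<open>g n\<close>, which gives \<open>\<gamma> n * (c * ln n - O(1)) \<le> 1\<close>. For the
  converse the equation is used at a much later time \<open>n * L + n\<close>. There \<open>g (n * L + n - i) \<le> g n\<close> holds for
  \<open>i \<le> n * L\<close>, and the \<open>n\<close> remaining summands are \<open>O(1 / (n * L))\<close> each. This gives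
  \<open>1 \<le> \<gamma> n * (c * ln (n * L) + O(1)) + O(1 / L)\<close>. The choice of \<open>L\<close> as \<open>ln n\<close>, rounded up, makes the last term as small as
  the desired precision allows, and is responsible for the iterated logarithm in \<open>ln (n * L)\<close>.
\<close>

lemma escape_asymptotics:
  fixes u g :: "nat \<Rightarrow> 'e::finite \<Rightarrow> real" and m :: "'e \<Rightarrow> real" and c C :: real
  assumes m: "\<And>k. m k > 0" and c: "c > 0" and C: "C \<ge> 0"
    and u0: "\<And>i k. u i k \<ge> 0" and g0: "\<And>n k. g n k \<ge> 0" and g1: "\<And>n k. g n k \<le> 1"
    and dec: "\<And>n n' k. n \<le> n' \<Longrightarrow> g n' k \<le> g n k"
    and renewal: "\<And>n. g n j + (\<Sum>i=1..n. \<Sum>k\<in>UNIV. u i k * g (n - i) k) = 1"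
    and sums: "\<And>N k. N \<ge> 1 \<Longrightarrow> \<bar>(\<Sum>i=1..N. u i k) - m k * c * ln (real N)\<bar> \<le> C"
    and upper: "\<And>i k. i \<ge> 1 \<Longrightarrow> u i k \<le> C / real i"
  shows "\<exists>K\<ge>0. \<forall>\<^sub>F n in sequentially.
     \<bar>(\<Sum>k\<in>UNIV. m k * g n k) - 1 / (c * ln (real n))\<bar> \<le> K * ln (ln (real n)) / (ln (real n))\<^sup>2"
proof -
  define \<gamma> where "\<gamma> n = (\<Sum>k\<in>UNIV. m k * g n k)" for n
  define G where "G n = (\<Sum>k\<in>UNIV. g n k)" for n
  define w where "w = Min (range m)"
  have w: "w > 0" "\<And>k. w \<le> m k" using m by (auto simp: w_def)
  have G: "G n \<le> \<gamma> n / w" for n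
  proof -
    have "w * G n \<le> \<gamma> n"
      unfolding G_def \<gamma>_def sum_distrib_left using w g0 by (intro sum_mono mult_right_mono) auto
    thus ?thesis using w by (simp add: field_simps)
  qed
  have gG: "g n k \<le> G n" for n k unfolding G_def by (rule member_le_sum) (auto simp: g0)
  have \<gamma>0: "\<gamma> n \<ge> 0" for n unfolding \<gamma>_def using m g0 by (intro sum_nonneg mult_nonneg_nonneg) (auto intro: less_imp_le)
  define C1 where "C1 = C / w"
  have C1: "C1 \<ge> 0" using C w by (simp add: C1_def)
  define C2 where "C2 = (1 + C) / w"
  have C2: "C2 \<ge> 0" using C w by (simp add: C2_def)
  define C3 where "C3 = real CARD('e) * C"
  have C3: "C3 \<ge> 0" using C by (simp add: C3_def)
  define D where "D = 2 * c + C2"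
  have D: "D \<ge> 0" using c C2 by (simp add: D_def)
  define K where "K = (2 * C1 + D + c * C3) / c\<^sup>2"
  have K: "K \<ge> 0" using c C1 D C3 by (simp add: K_def)
  have up: "\<gamma> n * (c * ln (real n) - C1) \<le> 1" if n: "n \<ge> 1" for n
  proof -
    have "(\<Sum>k\<in>UNIV. (m k * c * ln (real n) - C) * g n k) \<le> (\<Sum>k\<in>UNIV. (\<Sum>i=1..n. u i k) * g n k)"
    proof (intro sum_mono mult_right_mono g0)
      fix k show "m k * c * ln (real n) - C \<le> (\<Sum>i=1..n. u i k)" using sums[OF n, of k] by linarith
    qed
    also have "\<dots> = (\<Sum>i=1..n. \<Sum>k\<in>UNIV. u i k * g n k)"
      by (simp only: sum_distrib_right) (rule sum.swap)
    also have "\<dots> \<le> (\<Sum>i=1..n. \<Sum>k\<in>UNIV. u i k * g (n - i) k)"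
      using u0 by (intro sum_mono mult_left_mono dec) auto
    also have "\<dots> \<le> 1" using renewal[of n] g0[of n j] by linarith
    also have "(\<Sum>k\<in>UNIV. (m k * c * ln (real n) - C) * g n k) = c * ln (real n) * \<gamma> n - C * G n"
    proof -
      have "(m k * c * ln (real n) - C) * g n k = c * ln (real n) * (m k * g n k) - C * g n k" for k
        by (simp add: algebra_simps)
      thus ?thesis by (simp only: \<gamma>_def G_def sum_subtractf sum_distrib_left)
    qed
    finally have "c * ln (real n) * \<gamma> n - C * G n \<le> 1" .
    moreover have "C * G n \<le> C1 * \<gamma> n" using mult_left_mono[OF G C, of n] by (simp add: C1_def)
    ultimately show ?thesis by (simp add: algebra_simps)
  qed
  have low: "1 \<le> \<gamma> n * (c * ln (real (n * L)) + C2) + C3 / real L" if n: "n \<ge> 1" and L: "L \<ge> 1" for n L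
  proof -
    define N where "N = n * L + n"
    have nL: "n * L \<ge> 1" using n L by (simp add: Suc_le_eq)
    let ?f = "\<lambda>i. \<Sum>k\<in>UNIV. u i k * g (N - i) k"
    have split: "{1..N} = {1..n * L} \<union> {n * L + 1..N}" using nL by (auto simp: N_def)
    have "(\<Sum>i=1..N. ?f i) = (\<Sum>i=1..n * L. ?f i) + (\<Sum>i=n * L + 1..N. ?f i)"
      unfolding split by (rule sum.union_disjoint) auto
    moreover have "(\<Sum>i=1..n * L. ?f i) \<le> c * ln (real (n * L)) * \<gamma> n + C * G n"
    proof -
      have "(\<Sum>i=1..n * L. ?f i) \<le> (\<Sum>i=1..n * L. \<Sum>k\<in>UNIV. u i k * g n k)"
        using u0 by (intro sum_mono mult_left_mono dec) (auto simp: N_def)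
      also have "\<dots> = (\<Sum>k\<in>UNIV. (\<Sum>i=1..n * L. u i k) * g n k)"
        by (simp only: sum_distrib_right) (rule sum.swap)
      also have "\<dots> \<le> (\<Sum>k\<in>UNIV. (m k * c * ln (real (n * L)) + C) * g n k)"
      proof (intro sum_mono mult_right_mono g0)
        fix k show "(\<Sum>i=1..n * L. u i k) \<le> m k * c * ln (real (n * L)) + C" using sums[OF nL, of k] by linarith
      qed
      also have "\<dots> = c * ln (real (n * L)) * \<gamma> n + C * G n"
      proof -
        have "(m k * c * ln (real (n * L)) + C) * g n k = c * ln (real (n * L)) * (m k * g n k) + C * g n k" for k
          by (simp add: algebra_simps)
        thus ?thesis by (simp only: \<gamma>_def G_def sum.distrib sum_distrib_left)
      qed
      finally show ?thesis .
    qed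
    moreover have "(\<Sum>i=n * L + 1..N. ?f i) \<le> C3 / real L"
    proof -
      have "(\<Sum>i=n * L + 1..N. ?f i) \<le> (\<Sum>i=n * L + 1..N. \<Sum>k\<in>(UNIV :: 'e set). C / real (n * L) * 1)"
      proof (intro sum_mono mult_mono g1 u0 g0)
        fix i k assume i: "i \<in> {n * L + 1..N}"
        have "u i k \<le> C / real i" using i by (intro upper) auto
        also have "\<dots> \<le> C / real (n * L)" using i C nL by (intro divide_left_mono) (auto simp flip: of_nat_mult)
        finally show "u i k \<le> C / real (n * L)" .
      qed (use C in auto)
      also have "\<dots> = real n * (real CARD('e) * (C / real (n * L)))" by (simp add: N_def)
      also have "\<dots> = C3 / real L" using n by (simp add: C3_def)
      finally show ?thesis .
    qed
    moreover have "g N j \<le> G n" using dec[of n N j] gG[of n j] by (simp add: N_def)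
    ultimately have "1 \<le> G n + (c * ln (real (n * L)) * \<gamma> n + C * G n) + C3 / real L"
      using renewal[of N] by linarith
    also have "G n + (c * ln (real (n * L)) * \<gamma> n + C * G n) \<le> \<gamma> n * (c * ln (real (n * L)) + C2)"
    proof -
      have "(1 + C) * G n \<le> C2 * \<gamma> n" using mult_left_mono[OF G, of "1 + C" n] C by (simp add: C2_def)
      thus ?thesis by (simp add: algebra_simps)
    qed
    finally show ?thesis by simp
  qed
  have "\<forall>\<^sub>F n in sequentially. \<bar>\<gamma> n - 1 / (c * ln (real n))\<bar> \<le> K * ln (ln (real n)) / (ln (real n))\<^sup>2"
  proof -
    have "\<forall>\<^sub>F n in sequentially. 1 \<le> ln (ln (real n))" by real_asymp
    moreover have "\<forall>\<^sub>F n in sequentially. 2 * C1 / c \<le> ln (real n)" by real_asymp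
    moreover have "\<forall>\<^sub>F n in sequentially. 1 \<le> ln (real n)" by real_asymp
    moreover have "\<forall>\<^sub>F n in sequentially. (1::nat) \<le> n" by (rule eventually_ge_at_top)
    ultimately show ?thesis
    proof eventually_elim
      case (elim n)
      define l where "l = ln (real n)"
      define X where "X = ln l"
      define A where "A = c * l"
      have l: "l \<ge> 1" "2 * C1 \<le> A" and X: "X \<ge> 1" using elim c by (auto simp: l_def X_def A_def field_simps)
      have A: "A > 0" using l c by (simp add: A_def)
      have Kx: "K * X / l\<^sup>2 = (2 * C1 + D + c * C3) * X / A\<^sup>2"
        by (simp add: K_def A_def power_mult_distrib)
      have 1: "\<gamma> n \<le> 1 / A + K * X / l\<^sup>2"
      proof -
        have AC: "A - C1 > 0" "A / 2 \<le> A - C1" using l A by auto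
        have "\<gamma> n \<le> 1 / (A - C1)"
          using up[OF elim(4)] AC by (simp add: A_def l_def field_simps)
        also have "\<dots> = 1 / A + C1 / (A * (A - C1))" using A AC by (simp add: field_simps)
        also have "C1 / (A * (A - C1)) \<le> C1 / (A * (A / 2))"
          using A AC C1 by (intro divide_left_mono mult_left_mono mult_pos_pos) auto
        also have "\<dots> = 2 * C1 * 1 / A\<^sup>2" by (simp add: power2_eq_square)
        also have "\<dots> \<le> (2 * C1 + D + c * C3) * X / A\<^sup>2"
          using C1 D C3 c X by (intro divide_right_mono mult_mono) auto
        finally show ?thesis unfolding Kx by simp
      qed
      have 2: "1 / A - K * X / l\<^sup>2 \<le> \<gamma> n"
      proof -
        define L where "L = nat \<lceil>l\<rceil>"
        have L: "l \<le> real L" "real L \<le> l + 1" "L \<ge> 1" using l by (auto simp: L_def le_nat_iff)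
        have "ln (real (n * L)) = l + ln (real L)" using L elim by (simp add: ln_mult l_def)
        also have "ln (real L) \<le> ln (2 * l)" using L l by (intro ln_mono) auto
        also have "\<dots> = ln 2 + X" using l by (simp add: ln_mult X_def)
        also have "\<dots> \<le> 2 * X" using ln_2_less_1 X by linarith
        finally have lnL: "c * ln (real (n * L)) \<le> c * (l + 2 * X)" using c by simp
        have "C2 * 1 \<le> C2 * X" using C2 X by (rule mult_left_mono[rotated])
        with lnL have Lb: "c * ln (real (n * L)) + C2 \<le> A + D * X"
          by (simp add: A_def D_def algebra_simps)
        have "1 \<le> \<gamma> n * (c * ln (real (n * L)) + C2) + C3 / real L" by (rule low) (use elim L in auto)
        also have "\<dots> \<le> \<gamma> n * (A + D * X) + C3 / l"
        proof (rule add_mono)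
          show "\<gamma> n * (c * ln (real (n * L)) + C2) \<le> \<gamma> n * (A + D * X)"
            by (rule mult_left_mono[OF Lb \<gamma>0])
          show "C3 / real L \<le> C3 / l" using C3 L l by (intro divide_left_mono mult_pos_pos) auto
        qed
        finally have g: "1 - C3 / l \<le> \<gamma> n * (A + D * X)" by simp
        have AD: "A + D * X > 0" "A \<le> A + D * X" using A D X by (auto intro: add_pos_nonneg)
        have "1 / A - (1 - C3 / l) / (A + D * X) = (D * X + c * C3) / (A * (A + D * X))"
        proof -
          have frac: "1 / A - (1 - e) / S = (S - A + A * e) / (A * S)" if "S > 0" for S e :: real
            using A that by (simp add: field_simps)
          have "A * (C3 / l) = c * C3" using l by (simp add: A_def)
          with frac[OF AD(1), of "C3 / l"] show ?thesis by simp
        qed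
        also have "\<dots> \<le> (D * X + c * C3) / (A * A)"
          using A D C3 c X by (intro divide_left_mono mult_left_mono mult_pos_pos AD) auto
        also have "\<dots> \<le> (2 * C1 + D + c * C3) * X / (A * A)"
        proof (intro divide_right_mono)
          have "c * C3 * 1 \<le> c * C3 * X" using c C3 X by (intro mult_left_mono) auto
          moreover have "0 \<le> 2 * C1 * X" using C1 X by simp
          ultimately show "D * X + c * C3 \<le> (2 * C1 + D + c * C3) * X" by (simp add: algebra_simps)
        qed (use A in simp)
        finally have "1 / A - K * X / l\<^sup>2 \<le> (1 - C3 / l) / (A + D * X)"
          unfolding Kx by (simp add: power2_eq_square)
        also have "\<dots> \<le> \<gamma> n" using g AD by (simp add: field_simps)
        finally show ?thesis .
      qed
      from 1 2 show ?case by (simp add: A_def X_def l_def abs_le_iff)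
    qed
  qed
  with K show ?thesis unfolding \<gamma>_def by blast
qed

text \<open>
  A form of \<open>ln (fact n) \<ge> n * ln n - n\<close>: the average of \<open>ln n - ln m\<close> over \<open>m\<close> is at most one.
\<close>

lemma sum_ln_ratio_le: "(\<Sum>m=1..n. ln (real n) - ln (real m)) \<le> real n"
proof (induction n)
  case (Suc n)
  show ?case
  proof (cases "n = 0")
    case False
    have "(\<Sum>m=1..Suc n. ln (real (Suc n)) - ln (real m))
        = (\<Sum>m=1..n. (ln (real n) - ln (real m)) + (ln (real (Suc n)) - ln (real n)))"
      by simp
    also have "\<dots> = (\<Sum>m=1..n. ln (real n) - ln (real m)) + real n * (ln (real (Suc n)) - ln (real n))"
      by (simp only: sum.distrib) simp
    also have "real n * (ln (real (Suc n)) - ln (real n)) \<le> 1"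
    proof -
      have "ln (real (Suc n)) - ln (real n) = ln (1 + 1 / real n)"
      proof -
        have "1 + 1 / real n = real (Suc n) / real n" using False by (simp add: field_simps)
        thus ?thesis using False ln_div[of "real (Suc n)" "real n"] by (simp only:) simp
      qed
      also have "\<dots> \<le> 1 / real n" by (rule ln_add_one_self_le_self) simp
      finally show ?thesis using False by (simp add: field_simps)
    qed
    finally show ?thesis using Suc by simp
  qed simp
qed simp

text \<open>
  By monotonicity the sum is at least \<open>n * \<gamma> n\<close>, which gives the lower bound. For the upper bound, the terms
  with \<open>m\<close> below \<open>sqrt n\<close> are negligible. Above, \<open>ln m\<close> is at least half of \<open>ln n\<close>, so the error terms
  are comparable to the one for \<open>n\<close>. Replacing \<open>1 / ln m\<close> by \<open>1 / ln n\<close> costs \<open>(ln n - ln m) / (ln n)\<^sup>2\<close> up to a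
  constant, which is bounded on average by \<open>sum_ln_ratio_le\<close>.
\<close>

lemma sum_asymptotics:
  fixes \<gamma> :: "nat \<Rightarrow> real" and c K :: real
  assumes c: "c > 0" and K: "K \<ge> 0" and \<gamma>0: "\<And>n. \<gamma> n \<ge> 0" and \<gamma>1: "\<And>n. \<gamma> n \<le> 1"
    and dec: "\<And>n n'. n \<le> n' \<Longrightarrow> \<gamma> n' \<le> \<gamma> n"
    and ev: "\<forall>\<^sub>F n in sequentially. \<bar>\<gamma> n - 1 / (c * ln (real n))\<bar> \<le> K * ln (ln (real n)) / (ln (real n))\<^sup>2"
  shows "(\<lambda>n. (\<Sum>m\<le>n. \<gamma> m) - real n / (c * ln (real n)))
      \<in> O(\<lambda>n. real n * ln (ln (real n)) / (ln (real n))\<^sup>2)"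
proof -
  obtain n0 where n0: "\<And>n. n \<ge> n0 \<Longrightarrow> \<bar>\<gamma> n - 1 / (c * ln (real n))\<bar> \<le> K * ln (ln (real n)) / (ln (real n))\<^sup>2"
    using ev by (auto simp: eventually_sequentially)
  define K' where "K' = 2 / c + 4 * K + 1"
  have "\<forall>\<^sub>F n in sequentially. \<bar>(\<Sum>m\<le>n. \<gamma> m) - real n / (c * ln (real n))\<bar>
      \<le> K' * (real n * ln (ln (real n)) / (ln (real n))\<^sup>2)"
  proof -
    have "\<forall>\<^sub>F n in sequentially. 1 \<le> ln (ln (real n))" by real_asymp
    moreover have "\<forall>\<^sub>F n in sequentially. 2 \<le> ln (real n)" by real_asymp
    moreover have "\<forall>\<^sub>F n in sequentially. sqrt (real n) + 1 \<le> real n * ln (ln (real n)) / (ln (real n))\<^sup>2" by real_asymp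
    moreover have "\<forall>\<^sub>F n in sequentially. real n0 \<le> sqrt (real n)" by real_asymp
    moreover have "\<forall>\<^sub>F n in sequentially. exp 2 \<le> sqrt (real n)" by real_asymp
    moreover have "\<forall>\<^sub>F n in sequentially. (1::nat) \<le> n" by (rule eventually_ge_at_top)
    ultimately show ?thesis
    proof eventually_elim
      case (elim n)
      define l where "l = ln (real n)"
      define X where "X = ln l"
      have l: "l \<ge> 2" and X: "X \<ge> 1" using elim by (auto simp: l_def X_def)
      have nn: "n \<ge> n0"
      proof -
        have "sqrt (real n) \<le> real n" using elim(6) by (simp add: sqrt_le_D real_le_lsqrt power2_eq_square)
        thus ?thesis using elim(4) by linarith
      qed
      have 1: "real n / (c * l) - K' * (real n * X / l\<^sup>2) \<le> (\<Sum>m\<le>n. \<gamma> m)"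
      proof -
        have "1 / (c * l) - K * X / l\<^sup>2 \<le> \<gamma> n" using n0[OF nn] by (simp add: l_def X_def abs_le_iff)
        hence "real n * (1 / (c * l) - K * X / l\<^sup>2) \<le> real n * \<gamma> n" by (rule mult_left_mono) simp
        also have "\<dots> \<le> (\<Sum>m\<le>n. \<gamma> n)" using \<gamma>0[of n] by (simp add: distrib_right)
        also have "\<dots> \<le> (\<Sum>m\<le>n. \<gamma> m)" by (intro sum_mono dec) auto
        finally have "real n / (c * l) - K * (real n * X / l\<^sup>2) \<le> (\<Sum>m\<le>n. \<gamma> m)"
          by (simp add: right_diff_distrib mult_ac)
        moreover have "K * (real n * X / l\<^sup>2) \<le> K' * (real n * X / l\<^sup>2)"
          using X K c by (intro mult_right_mono) (auto simp: K'_def)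
        ultimately show ?thesis by linarith
      qed
      have 2: "(\<Sum>m\<le>n. \<gamma> m) \<le> real n / (c * l) + K' * (real n * X / l\<^sup>2)"
      proof -
        define r where "r = nat \<lceil>sqrt (real n)\<rceil>"
        have r: "sqrt (real n) \<le> real r" "real r \<le> sqrt (real n) + 1" by (auto simp: r_def)
        have r1: "r \<ge> 1" using elim(5) r(1) exp_ge_add_one_self[of 2] by linarith
        have small: "(\<Sum>m<r. \<gamma> m) \<le> real r" using sum_mono[of "{..<r}" \<gamma> "\<lambda>_. 1"] \<gamma>1 by simp
        have big: "\<gamma> m \<le> 1 / (c * l) + 2 / (c * l\<^sup>2) * (l - ln (real m)) + 4 * K * X / l\<^sup>2"
          if m: "m \<in> {r..n}" for m
        proof -
          have m0: "real m \<ge> sqrt (real n)" "real m \<le> real n" "m \<ge> 1" using m r r1 by auto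
          define y where "y = ln (real m)"
          have y1: "l / 2 \<le> y"
          proof -
            have "ln (sqrt (real n)) \<le> ln (real m)" using m0 elim by (intro ln_mono) auto
            thus ?thesis using elim by (simp add: y_def l_def ln_sqrt)
          qed
          have y2: "y \<le> l" unfolding y_def l_def using m0 by (intro ln_mono) auto
          have y: "y > 0" "y \<ge> 1" using y1 l by auto
          have "m \<ge> n0" using m0 elim(4) by linarith
          hence "\<gamma> m \<le> 1 / (c * y) + K * ln y / y\<^sup>2" using n0[of m] by (simp add: y_def abs_le_iff)
          also have "K * ln y / y\<^sup>2 \<le> K * X / (l / 2)\<^sup>2"
          proof (rule frac_le)
            show "K * ln y \<le> K * X" unfolding X_def using y y2 K by (intro mult_left_mono ln_mono) auto
            show "0 \<le> K * X" using K X by simp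
            show "0 < (l / 2)\<^sup>2" using l by simp
            show "(l / 2)\<^sup>2 \<le> y\<^sup>2" using y1 l by (intro power_mono) auto
          qed
          also have "\<dots> = 4 * K * X / l\<^sup>2" by (simp add: power2_eq_square)
          also have "1 / (c * y) = 1 / (c * l) + (l - y) / (c * l * y)"
            using c l y by (simp add: field_simps)
          also have "(l - y) / (c * l * y) \<le> (l - y) / (c * l * (l / 2))"
            using c l y y1 y2 by (intro divide_left_mono mult_left_mono mult_pos_pos) auto
          also have "\<dots> = 2 / (c * l\<^sup>2) * (l - y)"
            by (simp add: power2_eq_square right_diff_distrib mult_ac)
          finally show ?thesis by (simp add: y_def)
        qed
        have "(\<Sum>m\<le>n. \<gamma> m) \<le> (\<Sum>m<r. \<gamma> m) + (\<Sum>m\<in>{r..n}. \<gamma> m)"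
        proof -
          have "(\<Sum>m\<le>n. \<gamma> m) \<le> (\<Sum>m\<in>{..<r} \<union> {r..n}. \<gamma> m)"
            by (rule sum_mono2) (auto simp: \<gamma>0)
          also have "\<dots> = (\<Sum>m<r. \<gamma> m) + (\<Sum>m\<in>{r..n}. \<gamma> m)" by (rule sum.union_disjoint) auto
          finally show ?thesis .
        qed
        also have "(\<Sum>m\<in>{r..n}. \<gamma> m)
            \<le> (\<Sum>m\<in>{r..n}. 1 / (c * l) + 2 / (c * l\<^sup>2) * (l - ln (real m)) + 4 * K * X / l\<^sup>2)"
          by (rule sum_mono) (rule big)
        also have "\<dots> \<le> (\<Sum>m=1..n. 1 / (c * l) + 2 / (c * l\<^sup>2) * (l - ln (real m)) + 4 * K * X / l\<^sup>2)"
        proof (rule sum_mono2)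
          fix m assume "m \<in> {1..n} - {r..n}"
          hence "ln (real m) \<le> l" by (auto simp: l_def intro!: ln_mono)
          thus "0 \<le> 1 / (c * l) + 2 / (c * l\<^sup>2) * (l - ln (real m)) + 4 * K * X / l\<^sup>2"
            using c l K X by simp
        qed (use r1 in auto)
        also have "\<dots> = real n / (c * l) + 2 / (c * l\<^sup>2) * (\<Sum>m=1..n. l - ln (real m)) + 4 * K * (real n * X / l\<^sup>2)"
          by (simp add: sum.distrib sum_distrib_left)
        also have "\<dots> \<le> real n / (c * l) + 2 / (c * l\<^sup>2) * real n + 4 * K * (real n * X / l\<^sup>2)"
          using sum_ln_ratio_le[of n] c l
          by (intro add_right_mono add_left_mono mult_left_mono) (auto simp: l_def)
        also have "2 / (c * l\<^sup>2) * real n \<le> 2 / c * (real n * X / l\<^sup>2)"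
        proof -
          have "2 / c * (real n * 1 / l\<^sup>2) \<le> 2 / c * (real n * X / l\<^sup>2)"
            using c X by (intro mult_left_mono divide_right_mono) auto
          thus ?thesis by simp
        qed
        finally have "(\<Sum>m\<le>n. \<gamma> m) \<le> (sqrt (real n) + 1) + (real n / (c * l)
            + 2 / c * (real n * X / l\<^sup>2) + 4 * K * (real n * X / l\<^sup>2))"
          using small r(2) by linarith
        moreover have "sqrt (real n) + 1 \<le> real n * X / l\<^sup>2" using elim(3) by (simp add: X_def l_def)
        moreover have "K' * (real n * X / l\<^sup>2)
            = 2 / c * (real n * X / l\<^sup>2) + 4 * K * (real n * X / l\<^sup>2) + real n * X / l\<^sup>2"
          by (simp only: K'_def distrib_right mult_1)
        ultimately show ?thesis by linarith
      qed
      from 1 2 show ?case by (simp add: X_def l_def abs_le_iff)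
    qed
  qed
  hence "\<forall>\<^sub>F n in sequentially. norm ((\<Sum>m\<le>n. \<gamma> m) - real n / (c * ln (real n)))
      \<le> K' * norm (real n * ln (ln (real n)) / (ln (real n))\<^sup>2)"
  proof eventually_elim
    case (elim n)
    have "K' \<ge> 0" using c K by (simp add: K'_def)
    thus ?case using elim by (smt (verit) real_norm_def mult_left_mono)
  qed
  thus ?thesis by (rule bigoI)
qed

section \<open>The expected number of visited sites\<close>

theorem theorem6:
  fixes p :: "(2, 'e::finite) kernel"
    and \<mu> :: "real ^ 'e"
    and M :: "'w measure"
    and \<xi> :: "nat \<Rightarrow> 'w \<Rightarrow> (int ^ 2) \<times> 'e"
  assumes "stochastic_kernel p"
    and "basic_assumptions p \<mu>"
    and "moment_converges 3 p"
    and "RWwIS p M \<xi>"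
    and "initial_state_law M \<xi> \<mu>"
  shows "(\<lambda>n. expected_visited M \<xi> n
              - 2 * pi * sqrt (det (covariance p \<mu>)) * real n / ln (real n))
         \<in> O(\<lambda>n. real n * ln (ln (real n)) / (ln (real n))\<^sup>2)"
proof -
  interpret rwwis2 p \<mu> using assms(1-3) by unfold_locales
  define \<gamma> where "\<gamma> n = (\<Sum>k\<in>UNIV. \<mu> $ k * escape p n k)" for n
  obtain C where C: "C \<ge> 0"
    "\<And>N j k. N \<ge> 1 \<Longrightarrow> \<bar>(\<Sum>n=1..N. returns j n k) - \<mu> $ k * renewal_const * ln (real N)\<bar> \<le> C"
    using returns_sum by metis
  obtain C' where C': "C' \<ge> 0" "\<And>n j k. n \<ge> 1 \<Longrightarrow> returns j n k \<le> C' / real n"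
    using returns_upper by metis
  have dec: "escape p n' k \<le> escape p n k" if "n \<le> n'" for n n' k
    using that by (rule lift_Suc_antimono_le[of "\<lambda>n. escape p n k", rotated]) (rule escape_antimono)
  have "\<exists>K\<ge>0. \<forall>\<^sub>F n in sequentially.
     \<bar>(\<Sum>k\<in>UNIV. \<mu> $ k * escape p n k) - 1 / (renewal_const * ln (real n))\<bar> \<le> K * ln (ln (real n)) / (ln (real n))\<^sup>2"
  \<comment> \<open>The asymptotics of the returns are uniform in the starting state, so an arbitrary state may serve in the renewal equation.\<close>
  proof (rule escape_asymptotics[where u="returns undefined" and C="C + C'" and j=undefined])
    show "escape p n undefined + (\<Sum>i=1..n. \<Sum>k\<in>UNIV. returns undefined i k * escape p (n - i) k) = 1" for n
      by (rule escape_renewal)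
    show "\<bar>(\<Sum>i=1..N. returns undefined i k) - \<mu> $ k * renewal_const * ln (real N)\<bar> \<le> C + C'" if "N \<ge> 1" for N k
      using C(2)[OF that, of undefined k] C'(1) by linarith
    show "returns undefined i k \<le> (C + C') / real i" if "i \<ge> 1" for i k
      using C'(2)[OF that, of undefined k] C(1) by (simp add: add_divide_distrib add_increasing)
  qed (use C(1) C'(1) renewal_const_pos dec in \<open>auto simp: mu_pos returns_def escape_def avoid_nonneg avoid_le_1\<close>)
  then obtain K where K: "K \<ge> 0" "\<forall>\<^sub>F n in sequentially.
     \<bar>\<gamma> n - 1 / (renewal_const * ln (real n))\<bar> \<le> K * ln (ln (real n)) / (ln (real n))\<^sup>2"
    unfolding \<gamma>_def by blast
  have "(\<lambda>n. (\<Sum>m\<le>n. \<gamma> m) - real n / (renewal_const * ln (real n)))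
      \<in> O(\<lambda>n. real n * ln (ln (real n)) / (ln (real n))\<^sup>2)"
  proof (rule sum_asymptotics[OF renewal_const_pos K(1) _ _ _ K(2)])
    show "0 \<le> \<gamma> n" for n unfolding \<gamma>_def by (auto intro!: sum_nonneg mult_nonneg_nonneg simp: mu_nonneg escape_def avoid_nonneg)
    show "\<gamma> n' \<le> \<gamma> n" if "n \<le> n'" for n n'
      unfolding \<gamma>_def using dec[OF that] by (intro sum_mono mult_left_mono) (auto simp: mu_nonneg)
    show "\<gamma> n \<le> 1" for n
    proof -
      have "\<gamma> n \<le> (\<Sum>k\<in>UNIV. \<mu> $ k * 1)"
        unfolding \<gamma>_def by (intro sum_mono mult_left_mono) (auto simp: mu_nonneg escape_def avoid_le_1)
      thus ?thesis using stationary by (simp add: stationary_distribution_def)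
    qed
  qed
  also have "(\<lambda>n. (\<Sum>m\<le>n. \<gamma> m) - real n / (renewal_const * ln (real n)))
    = (\<lambda>n. expected_visited M \<xi> n - 2 * pi * sqrt (det (covariance p \<mu>)) * real n / ln (real n))"
    by (simp add: fun_eq_iff \<gamma>_def renewal_const_def expected_visited_eq[OF assms(1) stationary assms(4,5)] field_simps)
  finally show ?thesis .
qed

end
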